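(* For all values of the mass $\mathfrak m>0$ and of the inverse temperature $\beta>0$, the set of tempered Euclidean Gibbs measures of the quantum lattice system described in the context is non-empty: $\mathcal G_t\neq\emptyset$.
   Context: Fix $d\in\mathbb N$, $\beta>0$ (inverse temperature), $\mathfrak m>0$ (mass), $a^2>0$, $J>0$. The formal Hamiltonian is $-\frac1{2\mathfrak m}\sum_{k\in\mathbb Z^d}\frac{d^2}{dq_k^2}+\frac{a^2}2\sum_k q_k^2+\sum_k V(q_k)+J\sum_{\langle k,k'\rangle}(q_k-q_{k'})^2$, where $\langle k,k'\rangle$ runs over unordered pairs in $\mathbb Z^d$ with $|k-k'|=1$. The self-interaction $V\in C^2(\mathbb R)$ satisfies: there are constants $P>2$ and $K_V,C_V>0$ such that for all $q\in\mathbb R$ and $l=0,1,2$ $$K_V^{-1}|q|^{P-l}-C_V\le(\mathrm{sgn}\,q)^l\,V^{(l)}(q)\le K_V|q|^{P-l}+C_V .$$ Put $W(q,q'):=J(q-q')^2$. Loop spaces: $S_\beta$ is the circle of length $\beta$ with Lebesgue measure $d\tau$; $C_\beta$ is the space of continuous functions $S_\beta\to\mathbb R$ with sup-norm; $L^2_\beta=L^2(S_\beta,d\tau)$. $\gamma_\beta$ is the centered Gaussian measure on $C_\beta$ with correlation (covariance) operator $A_\beta^{-1}$ in $L^2_\beta$, where $A_\beta=-\mathfrak m\,\Delta_\beta+a^2\mathbf 1$ and $\Delta_\beta=d^2/d\tau^2$ is the Laplace operator on $S_\beta$. The configuration space is $\Omega=[C_\beta]^{\mathbb Z^d}\ni\omega=(\omega_k)_{k\in\mathbb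 Z^d}$ with the product topology and Borel $\sigma$-algebra $\mathcal B(\Omega)$. Tempered configurations: $$\Omega_t=\Big\{\omega\in\Omega:\ \sum_{k}e^{-\delta|k|}|\omega_k|^2_{L^2_\beta}<\infty\ \ \forall\delta\in(0,1)\Big\}.$$ Local specification: $\Lambda\Subset\mathbb Z^d$ means $\Lambda$ is finite and non-empty, $\Lambda^c=\mathbb Z^d\setminus\Lambda$, $\omega_\Lambda=(\omega_k)_{k\in\Lambda}$. For $\Lambda\Subset\mathbb Z^d$, $\xi\in\Omega$, $\Delta\in\mathcal B(\Omega)$, $$\pi_\Lambda(\Delta|\xi)=Z_\Lambda(\xi)^{-1}\int_{[C_\beta]^\Lambda}e^{-\mathcal I_\Lambda(\omega|\xi)}\mathbf 1_\Delta(\omega_\Lambda,\xi_{\Lambda^c})\prod_{k\in\Lambda}d\gamma_\beta(\omega_k),$$ $$\mathcal I_\Lambda(\omega|\xi)=\int_{S_\beta}\Big[\sum_{k\in\Lambda}V(\omega_k)+\sum_{\langle k,k'\rangle\subset\Lambda}W(\omega_k,\omega_{k'})+\sum_{k\in\Lambda,\,k'\in\Lambda^c,\,|k-k'|=1}W(\omega_k,\xi_{k'})\Big]d\tau,$$ with $Z_\Lambda(\xi)$ the normalization making $\pi_\Lambda(\cdot|\xi)$ a probability measure. A Euclidean Gibbs measure is a probability measure $\mu$ on $(\Omega,\mathcal B(\Omega))$ with $\int_\Omega\mu(d\omega)\pi_\Lambda(\Delta|\omega)=\mu(\Delta)$ for all $\Lambda\Subset\mathbb Z^d$, $\Delta\in\mathcal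 B(\Omega)$. $\mathcal G_t$ is the set of tempered Euclidean Gibbs measures, i.e. those with $\mu(\Omega_t)=1$. *)

theory Defs
  imports "HOL-Probability.Probability"
begin

definition C2_function :: "(real \<Rightarrow> real) \<Rightarrow> bool" where
  "C2_function V \<longleftrightarrow>
     (\<forall>q. V differentiable at q) \<and> (\<forall>q. deriv V differentiable at q) \<and>
     continuous_on UNIV (deriv (deriv V))"

definition growth_condition :: "(real \<Rightarrow> real) \<Rightarrow> bool" where
  "growth_condition V \<longleftrightarrow>
     (\<exists>P K C :: real. P > 2 \<and> K > 0 \<and> C > 0 \<and>
       (\<forall>q. \<forall>l\<in>{0, 1, 2 :: nat}.
          inverse K * \<bar>q\<bar> powr (P - real l) - C \<le> sgn q ^ l * (deriv ^^ l) V q \<and>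
          sgn q ^ l * (deriv ^^ l) V q \<le> K * \<bar>q\<bar> powr (P - real l) + C))"

definition pair_interaction :: "real \<Rightarrow> real \<Rightarrow> real \<Rightarrow> real" where
  "pair_interaction J q q' = J * (q - q')\<^sup>2"

text \<open>
  Functions on the circle of length \<open>\<beta>\<close> are represented as \<open>\<beta>\<close>-periodic functions on the
  real line, and integrals over the circle as integrals over one period. The continuous loops
  form a closed subset of the Banach space of bounded continuous functions, whose norm restricts
  to the sup-norm on the circle.
\<close>

definition loops :: "real \<Rightarrow> (real \<Rightarrow>\<^sub>C real) set" where
  "loops \<beta> = {f. \<forall>t. apply_bcontfun f (t + \<beta>) = apply_bcontfun f t}"

definition loop_L2 :: "real \<Rightarrow> (real \<Rightarrow> real) set" where
  "loop_L2 \<beta> = {\<phi>. \<phi> \<in> borel_measurable borel \<and> (\<forall>t. \<phi> (t + \<beta>) = \<phi> t) \<and>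
     set_integrable lborel {0..<\<beta>} (\<lambda>t. (\<phi> t)\<^sup>2)}"

definition loop_inner :: "real \<Rightarrow> (real \<Rightarrow> real) \<Rightarrow> (real \<Rightarrow> real) \<Rightarrow> real" where
  "loop_inner \<beta> \<phi> \<psi> = (LINT t:{0..<\<beta>}|lborel. \<phi> t * \<psi> t)"

text \<open>
  The operators are given by their graphs. \<open>loop_laplacian \<beta> \<psi> g\<close> says that \<open>\<psi>\<close> (in its
  continuously differentiable version) belongs to the second order Sobolev space of the circle,
  the domain of the self-adjoint Laplacian, and that \<open>g\<close> is a representative of its second
  derivative: \<open>\<psi>'\<close> is absolutely continuous with density \<open>g\<close>.
\<close>

definition loop_laplacian :: "real \<Rightarrow> (real \<Rightarrow> real) \<Rightarrow> (real \<Rightarrow> real) \<Rightarrow> bool" where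
  "loop_laplacian \<beta> \<psi> g \<longleftrightarrow>
     (\<forall>t. \<psi> (t + \<beta>) = \<psi> t) \<and> g \<in> loop_L2 \<beta> \<and>
     (\<exists>\<psi>'. (\<forall>t. (\<psi> has_real_derivative \<psi>' t) (at t)) \<and>
           (\<forall>s t. s \<le> t \<longrightarrow> \<psi>' t - \<psi>' s = (LINT u:{s..t}|lborel. g u)))"

text \<open>\<open>loop_operator m a \<beta> \<psi> \<phi>\<close> means \<open>\<phi> = - m \<psi>'' + a\<^sup>2 \<psi>\<close>.\<close>

definition loop_operator ::
    "real \<Rightarrow> real \<Rightarrow> real \<Rightarrow> (real \<Rightarrow> real) \<Rightarrow> (real \<Rightarrow> real) \<Rightarrow> bool" where
  "loop_operator m a \<beta> \<psi> \<phi> \<longleftrightarrow>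
     (\<exists>g. loop_laplacian \<beta> \<psi> g \<and> \<phi> = (\<lambda>t. - m * g t + a\<^sup>2 * \<psi> t))"

text \<open>
  For \<open>\<beta>, m, a\<^sup>2 > 0\<close> the operator above is a bijection from its domain onto the square
  integrable functions, so \<open>\<phi>\<close> below ranges over the whole of \<open>loop_L2 \<beta>\<close> and \<open>\<psi>\<close> is its image
  under the inverse operator, that is, under the covariance operator. The formula is the
  characteristic functional of the centred Gaussian measure with this covariance.
\<close>

definition is_loop_gaussian :: "real \<Rightarrow> real \<Rightarrow> real \<Rightarrow> (real \<Rightarrow>\<^sub>C real) measure \<Rightarrow> bool" where
  "is_loop_gaussian m a \<beta> \<gamma> \<longleftrightarrow>
     prob_space \<gamma> \<and> sets \<gamma> = sets (restrict_space borel (loops \<beta>)) \<and>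
     (\<forall>\<phi>\<in>loop_L2 \<beta>. \<forall>\<psi>. loop_operator m a \<beta> \<psi> \<phi> \<longrightarrow>
        (\<integral>\<omega>. iexp (loop_inner \<beta> \<phi> (apply_bcontfun \<omega>)) \<partial>\<gamma>)
          = complex_of_real (exp (- loop_inner \<beta> \<psi> \<phi> / 2)))"

text \<open>
  The measure is determined by its characteristic functional, so the choice is from a singleton.
\<close>

definition loop_gaussian :: "real \<Rightarrow> real \<Rightarrow> real \<Rightarrow> (real \<Rightarrow>\<^sub>C real) measure" where
  "loop_gaussian m a \<beta> = (SOME \<gamma>. is_loop_gaussian m a \<beta> \<gamma>)"

text \<open>The lattice is \<open>int ^ 'd\<close>, with the Euclidean norm.\<close>

definition lattice_norm :: "int ^ 'd \<Rightarrow> real" where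
  "lattice_norm k = norm (\<chi> i. real_of_int (k $ i))"

definition nearest :: "int ^ 'd \<Rightarrow> int ^ 'd \<Rightarrow> bool" where
  "nearest k k' \<longleftrightarrow> lattice_norm (k - k') = 1"

type_synonym 'd config = "int ^ 'd \<Rightarrow> (real \<Rightarrow>\<^sub>C real)"

definition configs :: "real \<Rightarrow> ('d::finite) config set" where
  "configs \<beta> = {\<omega>. \<forall>k. \<omega> k \<in> loops \<beta>}"

text \<open>
  The topology on \<open>'d config\<close> is the product topology; the trace of its Borel sets on
  \<open>configs \<beta>\<close> is the Borel \<open>\<sigma>\<close>-algebra of the subspace, which carries the product topology
  of the loop spaces.
\<close>

definition config_space :: "real \<Rightarrow> ('d::finite) config measure" where
  "config_space \<beta> = restrict_space borel (configs \<beta>)"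

definition tempered_configs :: "real \<Rightarrow> ('d::finite) config set" where
  "tempered_configs \<beta> = {\<omega> \<in> configs \<beta>. \<forall>\<delta>. 0 < \<delta> \<and> \<delta> < 1 \<longrightarrow>
     (\<lambda>k. exp (- \<delta> * lattice_norm k) * loop_inner \<beta> (\<omega> k) (\<omega> k)) summable_on UNIV}"

text \<open>
  The factor \<open>1/2\<close> is due to the sum over ordered pairs, in which each unordered pair of
  neighbours inside \<open>\<Lambda>\<close> occurs twice.
\<close>

definition local_energy ::
    "real \<Rightarrow> real \<Rightarrow> (real \<Rightarrow> real) \<Rightarrow> (int ^ 'd) set \<Rightarrow> 'd config \<Rightarrow> 'd config \<Rightarrow> real" where
  "local_energy \<beta> J V \<Lambda> \<omega> \<xi> =
     (LINT t:{0..<\<beta>}|lborel.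
        (\<Sum>k\<in>\<Lambda>. V (\<omega> k t))
        + 1/2 * (\<Sum>(k, k') | k \<in> \<Lambda> \<and> k' \<in> \<Lambda> \<and> nearest k k'.
            pair_interaction J (\<omega> k t) (\<omega> k' t))
        + (\<Sum>(k, k') | k \<in> \<Lambda> \<and> k' \<notin> \<Lambda> \<and> nearest k k'.
            pair_interaction J (\<omega> k t) (\<xi> k' t)))"

definition partition_function ::
    "real \<Rightarrow> real \<Rightarrow> real \<Rightarrow> real \<Rightarrow> (real \<Rightarrow> real) \<Rightarrow> (int ^ 'd) set \<Rightarrow> 'd config \<Rightarrow> real" where
  "partition_function \<beta> m a J V \<Lambda> \<xi> =
     (\<integral>\<omega>. exp (- local_energy \<beta> J V \<Lambda> \<omega> \<xi>) \<partial>(\<Pi>\<^sub>M k\<in>\<Lambda>. loop_gaussian m a \<beta>))"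

text \<open>\<open>override_on \<xi> \<omega> \<Lambda>\<close> is the configuration equal to \<open>\<omega>\<close> on \<open>\<Lambda>\<close> and to \<open>\<xi>\<close> off \<open>\<Lambda>\<close>.\<close>

definition local_spec ::
    "real \<Rightarrow> real \<Rightarrow> real \<Rightarrow> real \<Rightarrow> (real \<Rightarrow> real) \<Rightarrow> (int ^ 'd) set \<Rightarrow>
       'd config set \<Rightarrow> 'd config \<Rightarrow> real" where
  "local_spec \<beta> m a J V \<Lambda> D \<xi> =
     inverse (partition_function \<beta> m a J V \<Lambda> \<xi>) *
     (\<integral>\<omega>. exp (- local_energy \<beta> J V \<Lambda> \<omega> \<xi>) * indicator D (override_on \<xi> \<omega> \<Lambda>)
        \<partial>(\<Pi>\<^sub>M k\<in>\<Lambda>. loop_gaussian m a \<beta>))"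

definition euclidean_gibbs_measures ::
    "real \<Rightarrow> real \<Rightarrow> real \<Rightarrow> real \<Rightarrow> (real \<Rightarrow> real) \<Rightarrow> ('d::finite) config measure set" where
  "euclidean_gibbs_measures \<beta> m a J V =
     {\<mu>. prob_space \<mu> \<and> sets \<mu> = sets (config_space \<beta>) \<and>
        (\<forall>\<Lambda> D. finite \<Lambda> \<and> \<Lambda> \<noteq> {} \<and> D \<in> sets (config_space \<beta>) \<longrightarrow>
           (\<integral>\<omega>. local_spec \<beta> m a J V \<Lambda> D \<omega> \<partial>\<mu>) = measure \<mu> D)}"

definition tempered_gibbs_measures ::
    "real \<Rightarrow> real \<Rightarrow> real \<Rightarrow> real \<Rightarrow> (real \<Rightarrow> real) \<Rightarrow> ('d::finite) config measure set" where
  "tempered_gibbs_measures \<beta> m a J V =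
     {\<mu> \<in> euclidean_gibbs_measures \<beta> m a J V. measure \<mu> (tempered_configs \<beta>) = 1}"

end

(*
  Finite volumes. For a finite box the Gibbs measure with constant boundary condition has a density
  with respect to the product of the Gaussian loop measure. Conditioning on everything but one spin
  and comparing numerator and denominator of the single-site kernel (both contain the factor
  exp (- J * S), S the sum of the squared norms of the neighbours, up to exp (e * S)) gives
  E |w_k|^2 <= C + (1/2) * (average over the neighbours of E |w_l|^2), hence a bound on E |w_k|^2
  that is uniform in k and in the box. Of the Gaussian measure only its existence is used.

  Infinite volume. Since the density of the kernel for D is bounded by 1 / Z_D(xi), and Z_D(xi) is
  bounded below when the boundary spins are bounded in square norm, the second moments imply that
  the box measures of events in D are equicontinuous with respect to the product Gaussian measure.
  A cluster point (Tychonoff) of the set functions is therefore countably additive on local events,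
  and extends by Kolmogorov's theorem. The interaction has finite range, so the kernels are bounded
  local functions and the DLR equations pass to this setwise limit without any continuity.

  Gaussian loop measure. As - m * D^2 + a^2 = m * (- D + kappa) * (D + kappa) with
  kappa = sqrt (a^2 / m), it is the law of the periodic solution of X' + kappa * X = white noise
  / sqrt m, where white noise is the random Haar series; its primitives, the Schauder functions,
  make the series converge uniformly.
*)
theory Submission
  imports Defs
begin

section \<open>Finite-volume Gibbs measures\<close>

text \<open>The moment bound controls only the L2 norm of a loop, whereas loops carry the sup-norm,
  so tightness in the product topology would require separate regularity estimates. Setwise limits
  avoid them, and the spin space enters only through the measurable functions \<open>Q\<close>,
  \<open>v\<close>, \<open>w\<close> (squared norm, self-energy, coupling). The factor 1/2 in the
  moment recursion is where the growth of V beyond q^2 is spent: the cross term 2 J x y of the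
  coupling is bounded by an arbitrarily small multiple of y^2 plus a large multiple of x^2, and
  \<open>v\<close> absorbs the latter whatever its size. Loops live inside the bounded continuous
  functions on the line, which are not separable. Kolmogorov's theorem and the identification of
  Borel sets with product-measurable sets therefore pass through a separable copy, the loops of
  period 1. For the Gaussian measure, the factorisation into first-order operators reduces the
  covariance identity to Parseval's identity for one continuous function and keeps the image of each
  Haar function explicit.\<close>

locale pair_model =
  fixes M \<gamma> :: "'a measure" and Q v :: "'a \<Rightarrow> real" and w :: "'a \<Rightarrow> 'a \<Rightarrow> real"
    and nb :: "'i :: countable \<Rightarrow> 'i set" and c :: 'a and J \<nu> :: real
  assumes prob_gamma: "prob_space \<gamma>" and sets_gamma: "sets \<gamma> = sets M"
    and base: "c \<in> space M"
    and Q_measurable [measurable]: "Q \<in> borel_measurable M"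
    and v_measurable [measurable]: "v \<in> borel_measurable M"
    and w_measurable [measurable]: "(\<lambda>(x, y). w x y) \<in> borel_measurable (M \<Otimes>\<^sub>M M)"
    and Q_nonneg: "x \<in> space M \<Longrightarrow> 0 \<le> Q x"
    and w_nonneg: "x \<in> space M \<Longrightarrow> y \<in> space M \<Longrightarrow> 0 \<le> w x y"
    and w_sym: "x \<in> space M \<Longrightarrow> y \<in> space M \<Longrightarrow> w x y = w y x"
    and v_superquadratic: "\<And>l. \<exists>C. \<forall>x\<in>space M. l * Q x - C \<le> v x"
    and w_near: "\<And>e. e > 0 \<Longrightarrow> \<exists>C\<ge>0. \<forall>x\<in>space M. \<forall>y\<in>space M.
        \<bar>w x y - J * Q y\<bar> \<le> e * Q y + C * Q x"
    and finite_nb: "finite (nb k)" and nb_sym: "k \<in> nb l \<longleftrightarrow> l \<in> nb k"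
    and card_nb: "real (card (nb k)) \<le> \<nu>" and nu_pos: "\<nu> > 0" and nb_irrefl: "k \<notin> nb k"
begin

section \<open>Energies, weights and kernels\<close>

definition bonds :: "'i set \<Rightarrow> ('i \<times> 'i) set" where
  "bonds \<Lambda> = {(k, l). l \<in> nb k \<and> (k \<in> \<Lambda> \<or> l \<in> \<Lambda>)}"

text \<open>\<open>bonds\<close> consists of ordered pairs: every bond that meets
  \<open>\<Lambda>\<close>, inner or boundary, occurs in both orientations, whence the factor
  1/2.\<close>

definition energy :: "'i set \<Rightarrow> ('i \<Rightarrow> 'a) \<Rightarrow> real" where
  "energy \<Lambda> \<zeta> = (\<Sum>k\<in>\<Lambda>. v (\<zeta> k)) + 1/2 * (\<Sum>(k, l)\<in>bonds \<Lambda>. w (\<zeta> k) (\<zeta> l))"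

abbreviation \<Omega> :: "('i \<Rightarrow> 'a) measure" where "\<Omega> \<equiv> PiM UNIV (\<lambda>_. M)"
abbreviation G :: "('i \<Rightarrow> 'a) measure" where "G \<equiv> PiM UNIV (\<lambda>_. \<gamma>)"

definition weight :: "'i set \<Rightarrow> ('i \<Rightarrow> 'a) \<Rightarrow> ennreal" where
  "weight \<Lambda> \<zeta> = ennreal (exp (- energy \<Lambda> \<zeta>))"

text \<open>The integral runs over the product over all sites, although only the coordinates in
  \<open>\<Lambda>\<close> survive \<open>override_on\<close>. With one space for all volumes,
  nested volumes need no restriction maps between finite products.\<close>

definition unnorm :: "'i set \<Rightarrow> (('i \<Rightarrow> 'a) \<Rightarrow> ennreal) \<Rightarrow> ('i \<Rightarrow> 'a) \<Rightarrow> ennreal" where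
  "unnorm \<Lambda> F \<xi> = (\<integral>\<^sup>+\<omega>. weight \<Lambda> (override_on \<xi> \<omega> \<Lambda>) * F (override_on \<xi> \<omega> \<Lambda>) \<partial>G)"

definition kern :: "'i set \<Rightarrow> (('i \<Rightarrow> 'a) \<Rightarrow> ennreal) \<Rightarrow> ('i \<Rightarrow> 'a) \<Rightarrow> ennreal" where
  "kern \<Lambda> F \<xi> = unnorm \<Lambda> F \<xi> / unnorm \<Lambda> (\<lambda>_. 1) \<xi>"

definition range_of :: "'i set \<Rightarrow> 'i set" where
  "range_of \<Lambda> = \<Lambda> \<union> (\<Union>k\<in>\<Lambda>. nb k)"

lemma prob_space_G: "prob_space G"
  by (intro prob_space_PiM prob_gamma)

sublocale G: prob_space G by (rule prob_space_G)

lemma sets_G [measurable_cong]: "sets G = sets \<Omega>"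
  by (intro sets_PiM_cong) (auto simp: sets_gamma)

lemma space_gamma: "space \<gamma> = space M"
  using sets_gamma by (rule sets_eq_imp_space_eq)

lemma space_G: "space G = space \<Omega>"
  using sets_G by (rule sets_eq_imp_space_eq)

lemma space_Omega: "\<omega> \<in> space \<Omega> \<longleftrightarrow> (\<forall>k. \<omega> k \<in> space M)"
  by (auto simp: space_PiM PiE_def Pi_def)

lemma finite_bonds: "finite \<Lambda> \<Longrightarrow> finite (bonds \<Lambda>)"
proof -
  assume f: "finite \<Lambda>"
  have "bonds \<Lambda> \<subseteq> Sigma \<Lambda> nb \<union> prod.swap ` Sigma \<Lambda> nb"
    using nb_sym by (force simp: bonds_def)
  moreover have "finite (Sigma \<Lambda> nb \<union> prod.swap ` Sigma \<Lambda> nb)"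
    using f finite_nb by auto
  ultimately show ?thesis by (rule finite_subset)
qed

lemma finite_range_of: "finite \<Lambda> \<Longrightarrow> finite (range_of \<Lambda>)"
  using finite_nb by (auto simp: range_of_def)

lemma energy_measurable [measurable]: "energy \<Lambda> \<in> borel_measurable \<Omega>"
  unfolding energy_def split_def by measurable

lemma weight_measurable [measurable]: "weight \<Lambda> \<in> borel_measurable \<Omega>"
  unfolding weight_def by measurable

lemma override_measurable [measurable (raw)]:
  assumes f [measurable]: "f \<in> measurable N \<Omega>" and g [measurable]: "g \<in> measurable N \<Omega>"
  shows "(\<lambda>x. override_on (f x) (g x) \<Lambda>) \<in> measurable N \<Omega>"
proof (rule measurable_PiM_single')
  show "(\<lambda>x. override_on (f x) (g x) \<Lambda> i) \<in> measurable N M" if "i \<in> UNIV" for i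
    using measurable_component_singleton[of i UNIV "\<lambda>_. M"]
    by (cases "i \<in> \<Lambda>") (auto simp: override_on_def intro: measurable_compose[OF f] measurable_compose[OF g])
  show "(\<lambda>x i. override_on (f x) (g x) \<Lambda> i) \<in> space N \<rightarrow> UNIV \<rightarrow>\<^sub>E space M"
    using measurable_space[OF f] measurable_space[OF g]
    by (auto simp: override_on_def space_PiM PiE_def Pi_def)
qed

lemma override_in_Omega: "\<xi> \<in> space \<Omega> \<Longrightarrow> \<omega> \<in> space \<Omega> \<Longrightarrow> override_on \<xi> \<omega> \<Lambda> \<in> space \<Omega>"
  by (auto simp: space_Omega override_on_def)

lemma unnorm_measurable [measurable]:
  assumes [measurable]: "F \<in> borel_measurable \<Omega>"
  shows "unnorm \<Lambda> F \<in> borel_measurable \<Omega>"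
  unfolding unnorm_def by measurable

lemma kern_measurable [measurable]:
  assumes [measurable]: "F \<in> borel_measurable \<Omega>"
  shows "kern \<Lambda> F \<in> borel_measurable \<Omega>"
  unfolding kern_def by measurable

lemma base_in: "(\<lambda>_. c) \<in> space \<Omega>"
  using base by (simp add: space_Omega)

lemma weight_bounded: "\<exists>K\<ge>0. \<forall>\<zeta>\<in>space \<Omega>. weight \<Lambda> \<zeta> \<le> ennreal K"
proof -
  from v_superquadratic[of 0] obtain C where C: "\<And>x. x \<in> space M \<Longrightarrow> - C \<le> v x" by auto
  have "weight \<Lambda> \<zeta> \<le> ennreal (exp (C * real (card \<Lambda>)))" if "\<zeta> \<in> space \<Omega>" for \<zeta>
  proof -
    have "(\<Sum>k\<in>\<Lambda>. - C) \<le> (\<Sum>k\<in>\<Lambda>. v (\<zeta> k))" using that C by (intro sum_mono) (auto simp: space_Omega)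
    moreover have "0 \<le> (\<Sum>(k, l)\<in>bonds \<Lambda>. w (\<zeta> k) (\<zeta> l))"
      using that w_nonneg by (intro sum_nonneg) (auto simp: space_Omega)
    ultimately have "- energy \<Lambda> \<zeta> \<le> C * real (card \<Lambda>)"
      by (simp add: energy_def algebra_simps)
    then show ?thesis by (auto simp: weight_def intro!: ennreal_leI)
  qed
  then show ?thesis by (intro exI[of _ "exp (C * real (card \<Lambda>))"]) auto
qed

lemma unnorm_finite: "\<xi> \<in> space \<Omega> \<Longrightarrow> unnorm \<Lambda> (\<lambda>_. 1) \<xi> < \<infinity>"
proof -
  assume x: "\<xi> \<in> space \<Omega>"
  from weight_bounded[of \<Lambda>] obtain K where K: "\<And>\<zeta>. \<zeta> \<in> space \<Omega> \<Longrightarrow> weight \<Lambda> \<zeta> \<le> ennreal K" by auto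
  have "unnorm \<Lambda> (\<lambda>_. 1) \<xi> \<le> (\<integral>\<^sup>+\<omega>. ennreal K \<partial>G)"
    unfolding unnorm_def using K override_in_Omega[OF x] by (intro nn_integral_mono) (auto simp: space_G)
  also have "\<dots> < \<infinity>" by (simp add: G.emeasure_space_1)
  finally show ?thesis .
qed

lemma unnorm_pos: "\<xi> \<in> space \<Omega> \<Longrightarrow> unnorm \<Lambda> (\<lambda>_. 1) \<xi> > 0"
proof -
  assume x [measurable]: "\<xi> \<in> space \<Omega>"
  have "unnorm \<Lambda> (\<lambda>_. 1) \<xi> \<noteq> 0"
  proof
    assume "unnorm \<Lambda> (\<lambda>_. 1) \<xi> = 0"
    then have "AE \<omega> in G. weight \<Lambda> (override_on \<xi> \<omega> \<Lambda>) * 1 = 0"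
      unfolding unnorm_def by (subst (asm) nn_integral_0_iff_AE) auto
    then have "AE \<omega> in G. False" by (simp add: weight_def)
    then show False using G.AE_False by simp
  qed
  then show ?thesis by (simp add: zero_less_iff_neq_zero)
qed

section \<open>Resampling and consistency of the kernels\<close>

lemma resample:
  assumes F [measurable]: "F \<in> borel_measurable \<Omega>"
  shows "(\<integral>\<^sup>+\<omega>. F \<omega> \<partial>G) = (\<integral>\<^sup>+\<eta>. \<integral>\<^sup>+\<omega>. F (override_on \<eta> \<omega> \<Lambda>) \<partial>G \<partial>G)"
proof -
  interpret GG: pair_prob_space G G ..
  interpret PP: product_prob_space "\<lambda>_. \<gamma>" UNIV
    by (intro product_prob_spaceI prob_gamma)
  have m: "(\<lambda>(\<eta>, \<omega>). override_on \<eta> \<omega> \<Lambda>) \<in> measurable (G \<Otimes>\<^sub>M G) G"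
    by (simp add: split_def measurable_cong_sets[OF refl sets_G])
  \<comment> \<open>A cylinder over \<open>K\<close> splits into conditions on
    \<open>K - \<Lambda>\<close>, read off from \<open>\<eta>\<close>, and on
    \<open>K \<inter> \<Lambda>\<close>, read off from \<open>\<omega>\<close>; cylinders determine
    a product measure.\<close>
  have "distr (G \<Otimes>\<^sub>M G) G (\<lambda>(\<eta>, \<omega>). override_on \<eta> \<omega> \<Lambda>) = G"
  proof (rule PP.PiM_eq)
    show "sets (distr (G \<Otimes>\<^sub>M G) G (\<lambda>(\<eta>, \<omega>). override_on \<eta> \<omega> \<Lambda>)) = sets G" by simp
    fix K :: "'i set" and F assume K: "finite K" "K \<subseteq> UNIV" and F: "\<And>j. j \<in> K \<Longrightarrow> F j \<in> sets \<gamma>"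
    let ?B = "prod_emb UNIV (\<lambda>_. \<gamma>) K (Pi\<^sub>E K F)"
    let ?B1 = "prod_emb UNIV (\<lambda>_. \<gamma>) (K - \<Lambda>) (Pi\<^sub>E (K - \<Lambda>) F)"
    let ?B2 = "prod_emb UNIV (\<lambda>_. \<gamma>) (K \<inter> \<Lambda>) (Pi\<^sub>E (K \<inter> \<Lambda>) F)"
    have B: "?B \<in> sets G" using K F by (intro sets_PiM_I) auto
    have B1: "?B1 \<in> sets G" "?B2 \<in> sets G" using K F by (auto intro!: sets_PiM_I)
    have eq: "(\<lambda>(\<eta>, \<omega>). override_on \<eta> \<omega> \<Lambda>) -` ?B \<inter> space (G \<Otimes>\<^sub>M G) = ?B1 \<times> ?B2"
      by (auto simp: prod_emb_def space_pair_measure space_PiM PiE_def Pi_def override_on_def restrict_def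
          extensional_def split: if_splits)
    have "emeasure (distr (G \<Otimes>\<^sub>M G) G (\<lambda>(\<eta>, \<omega>). override_on \<eta> \<omega> \<Lambda>)) ?B = emeasure (G \<Otimes>\<^sub>M G) (?B1 \<times> ?B2)"
      by (subst emeasure_distr[OF m B]) (simp only: eq)
    also have "\<dots> = emeasure G ?B1 * emeasure G ?B2"
      using B1 by (simp add: G.emeasure_pair_measure_Times)
    also have "\<dots> = (\<Prod>j\<in>K - \<Lambda>. emeasure \<gamma> (F j)) * (\<Prod>j\<in>K \<inter> \<Lambda>. emeasure \<gamma> (F j))"
      using K F by (subst (1 2) PP.emeasure_PiM_emb) auto
    also have "\<dots> = (\<Prod>j\<in>K. emeasure \<gamma> (F j))"
      using K by (metis (no_types, lifting) prod.Int_Diff mult.commute)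
    finally show "emeasure (distr (G \<Otimes>\<^sub>M G) G (\<lambda>(\<eta>, \<omega>). override_on \<eta> \<omega> \<Lambda>)) ?B = (\<Prod>j\<in>K. emeasure \<gamma> (F j))" .
  qed
  then have "(\<integral>\<^sup>+\<omega>. F \<omega> \<partial>G) = (\<integral>\<^sup>+\<omega>. F \<omega> \<partial>distr (G \<Otimes>\<^sub>M G) G (\<lambda>(\<eta>, \<omega>). override_on \<eta> \<omega> \<Lambda>))" by simp
  also have "\<dots> = (\<integral>\<^sup>+p. F (override_on (fst p) (snd p) \<Lambda>) \<partial>(G \<Otimes>\<^sub>M G))"
    by (subst nn_integral_distr[OF m]) (auto simp: split_def)
  also have "\<dots> = (\<integral>\<^sup>+\<eta>. \<integral>\<^sup>+\<omega>. F (override_on \<eta> \<omega> \<Lambda>) \<partial>G \<partial>G)"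
    by (subst G.nn_integral_fst[symmetric]) auto
  finally show ?thesis .
qed

lemma override_override: "override_on (override_on \<xi> \<omega> \<Lambda>) \<omega>' \<Lambda> = override_on \<xi> \<omega>' \<Lambda>"
  by (auto simp: override_on_def)

lemma override_nested: "\<Delta> \<subseteq> \<Lambda> \<Longrightarrow> override_on (override_on \<xi> \<omega> \<Lambda>) \<omega>' \<Delta> = override_on \<xi> (override_on \<omega> \<omega>' \<Delta>) \<Lambda>"
  by (auto simp: override_on_def fun_eq_iff)

lemma unnorm_override: "unnorm \<Lambda> F (override_on \<xi> \<omega> \<Lambda>) = unnorm \<Lambda> F \<xi>"
  by (simp add: unnorm_def override_override)

lemma energy_split:
  assumes "\<Delta> \<subseteq> \<Lambda>" "finite \<Lambda>"
  shows "energy \<Lambda> \<zeta> = energy \<Delta> \<zeta> + ((\<Sum>k\<in>\<Lambda>-\<Delta>. v (\<zeta> k)) + 1/2 * (\<Sum>(k, l)\<in>bonds \<Lambda> - bonds \<Delta>. w (\<zeta> k) (\<zeta> l)))"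
proof -
  have "bonds \<Delta> \<subseteq> bonds \<Lambda>" using assms by (auto simp: bonds_def)
  then have "(\<Sum>(k, l)\<in>bonds \<Lambda>. w (\<zeta> k) (\<zeta> l)) = (\<Sum>(k, l)\<in>bonds \<Lambda> - bonds \<Delta>. w (\<zeta> k) (\<zeta> l)) + (\<Sum>(k, l)\<in>bonds \<Delta>. w (\<zeta> k) (\<zeta> l))"
    using finite_bonds[OF assms(2)] by (rule sum.subset_diff)
  moreover have "(\<Sum>k\<in>\<Lambda>. v (\<zeta> k)) = (\<Sum>k\<in>\<Lambda>-\<Delta>. v (\<zeta> k)) + (\<Sum>k\<in>\<Delta>. v (\<zeta> k))"
    using assms by (rule sum.subset_diff)
  ultimately show ?thesis by (simp add: energy_def algebra_simps)
qed

text \<open>A bond of \<open>\<Lambda>\<close> that is not a bond of \<open>\<Delta>\<close> touches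
  no site of \<open>\<Delta>\<close>, so what remains after splitting off
  \<open>weight \<Delta>\<close> does not notice a change of the spins in
  \<open>\<Delta>\<close>.\<close>

lemma weight_split:
  assumes "\<Delta> \<subseteq> \<Lambda>" "finite \<Lambda>"
  obtains R where "R \<in> borel_measurable \<Omega>" "\<And>\<zeta>. weight \<Lambda> \<zeta> = weight \<Delta> \<zeta> * R \<zeta>"
    "\<And>\<zeta> \<omega>. R (override_on \<zeta> \<omega> \<Delta>) = R \<zeta>"
proof
  let ?r = "\<lambda>\<zeta>. (\<Sum>k\<in>\<Lambda>-\<Delta>. v (\<zeta> k)) + 1/2 * (\<Sum>(k, l)\<in>bonds \<Lambda> - bonds \<Delta>. w (\<zeta> k) (\<zeta> l))"
  let ?R = "\<lambda>\<zeta>. ennreal (exp (- ?r \<zeta>))"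
  show "?R \<in> borel_measurable \<Omega>" unfolding split_def by measurable
  show "weight \<Lambda> \<zeta> = weight \<Delta> \<zeta> * ?R \<zeta>" for \<zeta>
    unfolding weight_def energy_split[OF assms] by (simp add: ennreal_mult[symmetric] exp_add[symmetric])
  show "?R (override_on \<zeta> \<omega> \<Delta>) = ?R \<zeta>" for \<zeta> \<omega>
  proof -
    have "(\<Sum>k\<in>\<Lambda>-\<Delta>. v (override_on \<zeta> \<omega> \<Delta> k)) = (\<Sum>k\<in>\<Lambda>-\<Delta>. v (\<zeta> k))" by (intro sum.cong) auto
    moreover have "(\<Sum>(k, l)\<in>bonds \<Lambda> - bonds \<Delta>. w (override_on \<zeta> \<omega> \<Delta> k) (override_on \<zeta> \<omega> \<Delta> l))
        = (\<Sum>(k, l)\<in>bonds \<Lambda> - bonds \<Delta>. w (\<zeta> k) (\<zeta> l))"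
    proof (intro sum.cong refl, clarify)
      fix k l assume "(k, l) \<in> bonds \<Lambda>" "(k, l) \<notin> bonds \<Delta>"
      then have "k \<notin> \<Delta>" "l \<notin> \<Delta>" by (auto simp: bonds_def)
      then show "w (override_on \<zeta> \<omega> \<Delta> k) (override_on \<zeta> \<omega> \<Delta> l) = w (\<zeta> k) (\<zeta> l)" by simp
    qed
    ultimately show ?thesis by simp
  qed
qed

text \<open>After resampling in \<open>\<Delta>\<close>, the only factor that depends on the new
  spins is \<open>weight \<Delta>\<close>; it integrates to the denominator of
  \<open>kern \<Delta> F\<close> and cancels it. This is the composition rule of the kernels before
  normalisation in \<open>\<Lambda>\<close>.\<close>

lemma consistency:
  assumes F [measurable]: "F \<in> borel_measurable \<Omega>" and D: "\<Delta> \<subseteq> \<Lambda>" "finite \<Lambda>" and x [measurable]: "\<xi> \<in> space \<Omega>"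
  shows "unnorm \<Lambda> (kern \<Delta> F) \<xi> = unnorm \<Lambda> F \<xi>"
proof -
  obtain R where R [measurable]: "R \<in> borel_measurable \<Omega>" and Rw: "\<And>\<zeta>. weight \<Lambda> \<zeta> = weight \<Delta> \<zeta> * R \<zeta>"
    and Ri: "\<And>\<zeta> \<omega>. R (override_on \<zeta> \<omega> \<Delta>) = R \<zeta>"
    using weight_split[OF D] by metis
  let ?z = "\<lambda>\<omega>. override_on \<xi> \<omega> \<Lambda>"
  have "unnorm \<Lambda> (kern \<Delta> F) \<xi> = (\<integral>\<^sup>+\<eta>. \<integral>\<^sup>+\<omega>. weight \<Lambda> (?z (override_on \<eta> \<omega> \<Delta>)) * kern \<Delta> F (?z (override_on \<eta> \<omega> \<Delta>)) \<partial>G \<partial>G)"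
    unfolding unnorm_def by (subst resample[of _ \<Delta>]) auto
  also have "\<dots> = (\<integral>\<^sup>+\<eta>. \<integral>\<^sup>+\<omega>. weight \<Delta> (override_on (?z \<eta>) \<omega> \<Delta>) * (R (?z \<eta>) * kern \<Delta> F (?z \<eta>)) \<partial>G \<partial>G)"
    by (simp only: override_nested[OF D(1), symmetric] Rw Ri kern_def unnorm_override mult.assoc)
  also have "\<dots> = (\<integral>\<^sup>+\<eta>. R (?z \<eta>) * unnorm \<Delta> F (?z \<eta>) \<partial>G)"
  proof (rule nn_integral_cong)
    fix \<eta> assume "\<eta> \<in> space G"
    then have z [measurable]: "?z \<eta> \<in> space \<Omega>" using x by (auto simp: space_G intro: override_in_Omega)
    have "(\<integral>\<^sup>+\<omega>. weight \<Delta> (override_on (?z \<eta>) \<omega> \<Delta>) * (R (?z \<eta>) * kern \<Delta> F (?z \<eta>)) \<partial>G)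
        = unnorm \<Delta> (\<lambda>_. 1) (?z \<eta>) * (R (?z \<eta>) * kern \<Delta> F (?z \<eta>))"
      unfolding unnorm_def by (subst nn_integral_multc) auto
    also have "\<dots> = R (?z \<eta>) * (unnorm \<Delta> F (?z \<eta>) * (unnorm \<Delta> (\<lambda>_. 1) (?z \<eta>) / unnorm \<Delta> (\<lambda>_. 1) (?z \<eta>)))"
      by (simp add: kern_def ennreal_times_divide mult_ac)
    also have "\<dots> = R (?z \<eta>) * unnorm \<Delta> F (?z \<eta>)"
      using unnorm_finite[OF z, of \<Delta>] unnorm_pos[OF z, of \<Delta>] by (simp add: ennreal_divide_self)
    finally show "(\<integral>\<^sup>+\<omega>. weight \<Delta> (override_on (?z \<eta>) \<omega> \<Delta>) * (R (?z \<eta>) * kern \<Delta> F (?z \<eta>)) \<partial>G) = \<dots>" .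
  qed
  also have "\<dots> = (\<integral>\<^sup>+\<eta>. \<integral>\<^sup>+\<omega>. R (?z \<eta>) * (weight \<Delta> (override_on (?z \<eta>) \<omega> \<Delta>) * F (override_on (?z \<eta>) \<omega> \<Delta>)) \<partial>G \<partial>G)"
  proof (rule nn_integral_cong)
    fix \<eta> assume "\<eta> \<in> space G"
    then have z [measurable]: "?z \<eta> \<in> space \<Omega>" using x by (auto simp: space_G intro: override_in_Omega)
    show "R (?z \<eta>) * unnorm \<Delta> F (?z \<eta>) = (\<integral>\<^sup>+\<omega>. R (?z \<eta>) * (weight \<Delta> (override_on (?z \<eta>) \<omega> \<Delta>) * F (override_on (?z \<eta>) \<omega> \<Delta>)) \<partial>G)"
      unfolding unnorm_def by (subst nn_integral_cmult) auto
  qed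
  also have "\<dots> = (\<integral>\<^sup>+\<eta>. \<integral>\<^sup>+\<omega>. weight \<Lambda> (?z (override_on \<eta> \<omega> \<Delta>)) * F (?z (override_on \<eta> \<omega> \<Delta>)) \<partial>G \<partial>G)"
    by (simp only: override_nested[OF D(1), symmetric] Rw Ri mult_ac)
  also have "\<dots> = unnorm \<Lambda> F \<xi>"
    unfolding unnorm_def by (subst (2) resample[of _ \<Delta>]) auto
  finally show ?thesis .
qed

section \<open>Finite-volume Gibbs measures with constant boundary condition\<close>

definition gibbs :: "'i set \<Rightarrow> ('i \<Rightarrow> 'a) measure" where
  "gibbs \<Lambda> = distr (density G (\<lambda>\<omega>. weight \<Lambda> (override_on (\<lambda>_. c) \<omega> \<Lambda>) / unnorm \<Lambda> (\<lambda>_. 1) (\<lambda>_. c)))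
     \<Omega> (\<lambda>\<omega>. override_on (\<lambda>_. c) \<omega> \<Lambda>)"

lemma sets_gibbs [simp, measurable_cong]: "sets (gibbs \<Lambda>) = sets \<Omega>"
  by (simp add: gibbs_def)

lemma space_gibbs [simp]: "space (gibbs \<Lambda>) = space \<Omega>"
  by (simp add: gibbs_def)

lemma nn_integral_gibbs:
  assumes F [measurable]: "F \<in> borel_measurable \<Omega>"
  shows "(\<integral>\<^sup>+\<omega>. F \<omega> \<partial>gibbs \<Lambda>) = kern \<Lambda> F (\<lambda>_. c)"
proof -
  have [measurable]: "(\<lambda>_. c) \<in> space \<Omega>" by (rule base_in)
  have "(\<integral>\<^sup>+\<omega>. F \<omega> \<partial>gibbs \<Lambda>) = (\<integral>\<^sup>+\<omega>. weight \<Lambda> (override_on (\<lambda>_. c) \<omega> \<Lambda>) / unnorm \<Lambda> (\<lambda>_. 1) (\<lambda>_. c) * F (override_on (\<lambda>_. c) \<omega> \<Lambda>) \<partial>G)"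
    unfolding gibbs_def by (subst nn_integral_distr, measurable, subst nn_integral_density) auto
  also have "\<dots> = (\<integral>\<^sup>+\<omega>. weight \<Lambda> (override_on (\<lambda>_. c) \<omega> \<Lambda>) * F (override_on (\<lambda>_. c) \<omega> \<Lambda>) / unnorm \<Lambda> (\<lambda>_. 1) (\<lambda>_. c) \<partial>G)"
    by (simp add: divide_ennreal_def mult_ac)
  also have "\<dots> = kern \<Lambda> F (\<lambda>_. c)"
    unfolding kern_def by (subst nn_integral_divide) (auto simp: unnorm_def)
  finally show ?thesis .
qed

lemma kern_one: "\<xi> \<in> space \<Omega> \<Longrightarrow> kern \<Lambda> (\<lambda>_. 1) \<xi> = 1"
  using unnorm_finite[of \<xi> \<Lambda>] unnorm_pos[of \<xi> \<Lambda>] by (simp add: kern_def ennreal_divide_self)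

lemma prob_space_gibbs: "prob_space (gibbs \<Lambda>)"
proof
  have "emeasure (gibbs \<Lambda>) (space (gibbs \<Lambda>)) = (\<integral>\<^sup>+\<omega>. 1 \<partial>gibbs \<Lambda>)" by simp
  also have "\<dots> = 1" by (subst nn_integral_gibbs) (auto simp: kern_one base_in)
  finally show "emeasure (gibbs \<Lambda>) (space (gibbs \<Lambda>)) = 1" .
qed

lemma kern_mono:
  assumes "\<xi> \<in> space \<Omega>" "\<And>\<omega>. \<omega> \<in> space \<Omega> \<Longrightarrow> F \<omega> \<le> F' \<omega>"
  shows "kern \<Lambda> F \<xi> \<le> kern \<Lambda> F' \<xi>"
  unfolding kern_def unnorm_def divide_ennreal_def using assms
  by (intro mult_right_mono nn_integral_mono mult_left_mono) (auto simp: space_G override_in_Omega)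

lemma gibbs_DLR:
  assumes F [measurable]: "F \<in> borel_measurable \<Omega>" and D: "\<Delta> \<subseteq> \<Lambda>" "finite \<Lambda>"
  shows "(\<integral>\<^sup>+\<xi>. kern \<Delta> F \<xi> \<partial>gibbs \<Lambda>) = (\<integral>\<^sup>+\<omega>. F \<omega> \<partial>gibbs \<Lambda>)"
proof -
  have "(\<integral>\<^sup>+\<xi>. kern \<Delta> F \<xi> \<partial>gibbs \<Lambda>) = kern \<Lambda> (kern \<Delta> F) (\<lambda>_. c)"
    by (rule nn_integral_gibbs) measurable
  also have "\<dots> = kern \<Lambda> F (\<lambda>_. c)"
    unfolding kern_def[of \<Lambda>] using consistency[OF F D base_in] by simp
  finally show ?thesis by (simp add: nn_integral_gibbs[OF F])
qed

section \<open>Lower bounds for partition functions and uniform second moments\<close>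

lemma bounded_event:
  obtains A r where "A \<in> sets M" "0 \<le> r" "\<And>x. x \<in> A \<Longrightarrow> v x \<le> r \<and> Q x \<le> r" "measure \<gamma> A > 0"
proof -
  interpret g: prob_space \<gamma> by (rule prob_gamma)
  \<comment> \<open>\<open>v\<close> and \<open>Q\<close> are finite everywhere, so these sublevel
    sets exhaust the space and one of them has positive measure.\<close>
  let ?A = "\<lambda>n::nat. {x \<in> space M. v x \<le> real n \<and> Q x \<le> real n}"
  have A: "?A n \<in> sets M" for n by measurable
  have "\<exists>n. measure \<gamma> (?A n) \<noteq> 0"
  proof (rule ccontr)
    assume "\<not> ?thesis"
    then have "emeasure \<gamma> (?A n) = 0" for n by (simp add: g.emeasure_eq_measure)
    then have "emeasure \<gamma> (\<Union>n. ?A n) = 0"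
      using A by (intro emeasure_UN_eq_0) (auto simp: sets_gamma)
    moreover have "(\<Union>n. ?A n) = space \<gamma>"
    proof -
      have "\<exists>n. x \<in> ?A n" if "x \<in> space M" for x
      proof -
        obtain n where "max (v x) (Q x) \<le> real n" using real_arch_simple by blast
        then show ?thesis using that by auto
      qed
      then show ?thesis by (auto simp: space_gamma)
    qed
    ultimately show False using g.emeasure_space_1 by simp
  qed
  then obtain n where "measure \<gamma> (?A n) \<noteq> 0" ..
  then have "measure \<gamma> (?A n) > 0" using measure_nonneg[of \<gamma> "?A n"] by linarith
  then show ?thesis using A[of n] by (intro that[of "?A n" "real n"]) auto
qed

lemma event_measure:
  assumes "finite \<Lambda>" "A \<in> sets M"
  shows "emeasure G {\<omega> \<in> space G. \<forall>k\<in>\<Lambda>. \<omega> k \<in> A} = ennreal (measure \<gamma> A ^ card \<Lambda>)"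
proof -
  interpret g: prob_space \<gamma> by (rule prob_gamma)
  interpret PP: product_prob_space "\<lambda>_. \<gamma>" UNIV
    by (intro product_prob_spaceI prob_gamma)
  have "emeasure G {\<omega> \<in> space G. \<forall>k\<in>\<Lambda>. \<omega> k \<in> A} = (\<Prod>k\<in>\<Lambda>. emeasure \<gamma> A)"
    using assms by (intro PP.emeasure_PiM_Collect) (auto simp: sets_gamma)
  then show ?thesis by (simp add: g.emeasure_eq_measure ennreal_power)
qed

lemma event_sets:
  assumes [measurable]: "A \<in> sets M" and "finite \<Lambda>"
  shows "{\<omega> \<in> space G. \<forall>k\<in>\<Lambda>. \<omega> k \<in> A} \<in> sets G"
  using assms(2) unfolding sets_G space_G by measurable

text \<open>Only the event that all spins of \<open>\<Lambda>\<close> lie in \<open>A\<close> is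
  kept; the spins are independent under \<open>G\<close>, hence the power.\<close>

lemma unnorm_lower:
  assumes L: "finite \<Lambda>" "A \<in> sets M" and x: "\<xi> \<in> space \<Omega>"
    and up: "\<And>\<omega>. \<omega> \<in> space \<Omega> \<Longrightarrow> \<forall>k\<in>\<Lambda>. \<omega> k \<in> A \<Longrightarrow> energy \<Lambda> (override_on \<xi> \<omega> \<Lambda>) \<le> b"
  shows "ennreal (exp (- b) * measure \<gamma> A ^ card \<Lambda>) \<le> unnorm \<Lambda> (\<lambda>_. 1) \<xi>"
proof -
  have "ennreal (exp (- b) * measure \<gamma> A ^ card \<Lambda>) = (\<integral>\<^sup>+\<omega>. ennreal (exp (- b)) * indicator {\<omega> \<in> space G. \<forall>k\<in>\<Lambda>. \<omega> k \<in> A} \<omega> \<partial>G)"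
    using L by (subst nn_integral_cmult_indicator) (auto simp: event_measure ennreal_mult intro!: event_sets)
  also have "\<dots> \<le> unnorm \<Lambda> (\<lambda>_. 1) \<xi>"
    unfolding unnorm_def weight_def using up
    by (intro nn_integral_mono) (auto simp: indicator_def space_G intro!: ennreal_leI)
  finally show ?thesis .
qed

lemma energy_single:
  assumes "\<zeta> \<in> space \<Omega>"
  shows "energy {k} \<zeta> = v (\<zeta> k) + (\<Sum>l\<in>nb k. w (\<zeta> k) (\<zeta> l))"
proof -
  have b: "bonds {k} = Pair k ` nb k \<union> (\<lambda>l. (l, k)) ` nb k"
    using nb_sym by (auto simp: bonds_def)
  have "(\<Sum>(i, l)\<in>bonds {k}. w (\<zeta> i) (\<zeta> l)) = (\<Sum>(i, l)\<in>Pair k ` nb k. w (\<zeta> i) (\<zeta> l)) + (\<Sum>(i, l)\<in>(\<lambda>l. (l, k)) ` nb k. w (\<zeta> i) (\<zeta> l))"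
    unfolding b using finite_nb nb_irrefl by (intro sum.union_disjoint) auto
  also have "(\<Sum>(i, l)\<in>Pair k ` nb k. w (\<zeta> i) (\<zeta> l)) = (\<Sum>l\<in>nb k. w (\<zeta> k) (\<zeta> l))"
    by (subst sum.reindex) (auto simp: inj_on_def)
  also have "(\<Sum>(i, l)\<in>(\<lambda>l. (l, k)) ` nb k. w (\<zeta> i) (\<zeta> l)) = (\<Sum>l\<in>nb k. w (\<zeta> l) (\<zeta> k))"
    by (subst sum.reindex) (auto simp: inj_on_def)
  also have "(\<Sum>l\<in>nb k. w (\<zeta> l) (\<zeta> k)) = (\<Sum>l\<in>nb k. w (\<zeta> k) (\<zeta> l))"
    using assms by (intro sum.cong w_sym) (auto simp: space_Omega)
  finally show ?thesis by (simp add: energy_def)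
qed

text \<open>
  With \<open>S\<close> the sum of \<open>Q\<close> over the neighbours, the interaction shifts the energy of a single spin
  by \<open>J * S\<close> up to an error \<open>e * S\<close>; the shift cancels in the normalised kernel, which leaves
  \<open>2 * e * S\<close>.
\<close>

lemma single_site:
  "\<exists>C\<ge>0. \<forall>k. \<forall>\<xi>\<in>space \<Omega>. kern {k} (\<lambda>\<omega>. ennreal (Q (\<omega> k))) \<xi> \<le> ennreal (C + (\<Sum>l\<in>nb k. Q (\<xi> l)) / (2 * \<nu>))"
proof -
  \<comment> \<open>The final bound contains \<open>2 * e * S\<close>; with this \<open>e\<close> it
    becomes \<open>S / (2 * \<nu>)\<close>, at most half the largest value of \<open>Q\<close> among
    at most \<open>\<nu>\<close> neighbours.\<close>
  define e where "e = 1 / (4 * \<nu>)"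
  have e: "e > 0" using nu_pos by (simp add: e_def)
  from w_near[OF e] obtain D where D: "D \<ge> 0" "\<And>x y. x \<in> space M \<Longrightarrow> y \<in> space M \<Longrightarrow> \<bar>w x y - J * Q y\<bar> \<le> e * Q y + D * Q x"
    by blast
  \<comment> \<open>Each of the at most \<open>\<nu>\<close> neighbours costs \<open>D * Q y\<close>
    when \<open>w\<close> is compared with \<open>J * Q\<close>. The self-energy pays for all of
    them and keeps one more \<open>Q\<close>, which gives an exponential moment.\<close>
  from v_superquadratic[of "1 + \<nu> * D"] obtain C0 where C0: "\<And>x. x \<in> space M \<Longrightarrow> (1 + \<nu> * D) * Q x - C0 \<le> v x" by auto
  define C1 where "C1 = max C0 0"
  have C1: "C1 \<ge> 0" "\<And>x. x \<in> space M \<Longrightarrow> (1 + \<nu> * D) * Q x - C1 \<le> v x" using C0 by (force simp: C1_def)+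
  obtain A r where A: "A \<in> sets M" "0 \<le> r" "\<And>x. x \<in> A \<Longrightarrow> v x \<le> r \<and> Q x \<le> r" "measure \<gamma> A > 0"
    using bounded_event by blast
  define p where "p = measure \<gamma> A"
  interpret g: prob_space \<gamma> by (rule prob_gamma)
  have p: "0 < p" "p \<le> 1" "ln p \<le> 0" using A by (auto simp: p_def)
  define r' where "r' = r + \<nu> * D * r"
  have r': "r' \<ge> 0" using A D nu_pos by (simp add: r'_def)
  define C where "C = C1 + r' - ln p + 1"
  have "kern {k} (\<lambda>\<omega>. ennreal (Q (\<omega> k))) \<xi> \<le> ennreal (C + (\<Sum>l\<in>nb k. Q (\<xi> l)) / (2 * \<nu>))"
    if x [measurable]: "\<xi> \<in> space \<Omega>" for k \<xi>
  proof -
    let ?z = "\<lambda>\<omega>. override_on \<xi> \<omega> {k}"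
    define S where "S = (\<Sum>l\<in>nb k. Q (\<xi> l))"
    have S: "S \<ge> 0" unfolding S_def using x Q_nonneg by (intro sum_nonneg) (auto simp: space_Omega)
    have en: "energy {k} (?z \<omega>) = v (\<omega> k) + (\<Sum>l\<in>nb k. w (\<omega> k) (\<xi> l))" if "\<omega> \<in> space \<Omega>" for \<omega>
    proof -
      have "(\<Sum>l\<in>nb k. w (\<omega> k) (?z \<omega> l)) = (\<Sum>l\<in>nb k. w (\<omega> k) (\<xi> l))"
        using nb_irrefl by (intro sum.cong refl) (auto simp: override_on_def)
      then show ?thesis using energy_single[of "?z \<omega>" k, OF override_in_Omega[OF x that]] by simp
    qed
    have near: "\<bar>(\<Sum>l\<in>nb k. w y (\<xi> l)) - J * S\<bar> \<le> e * S + \<nu> * D * Q y" if y: "y \<in> space M" for y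
    proof -
      have "\<bar>(\<Sum>l\<in>nb k. w y (\<xi> l)) - J * S\<bar> = \<bar>\<Sum>l\<in>nb k. w y (\<xi> l) - J * Q (\<xi> l)\<bar>"
        by (simp add: S_def sum_distrib_left sum_subtractf)
      also have "\<dots> \<le> (\<Sum>l\<in>nb k. e * Q (\<xi> l) + D * Q y)"
        by (rule order_trans[OF sum_abs sum_mono]) (use D y x in \<open>auto simp: space_Omega\<close>)
      also have "\<dots> = e * S + real (card (nb k)) * (D * Q y)"
        by (simp add: S_def sum_distrib_left sum.distrib)
      also have "\<dots> \<le> e * S + \<nu> * (D * Q y)"
        using card_nb[of k] D Q_nonneg[OF y] by (intro add_left_mono mult_right_mono) auto
      finally show ?thesis by (simp add: mult.assoc)
    qed
    have low: "energy {k} (?z \<omega>) \<ge> Q (\<omega> k) - C1 + (J - e) * S" if w: "\<omega> \<in> space \<Omega>" for \<omega>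
    proof -
      have "\<omega> k \<in> space M" using w by (simp add: space_Omega)
      from near[OF this] C1(2)[OF this] show ?thesis unfolding en[OF w] by (simp add: algebra_simps abs_le_iff)
    qed
    have up: "energy {k} (?z \<omega>) \<le> r' + (J + e) * S" if w: "\<omega> \<in> space \<Omega>" and a: "\<omega> k \<in> A" for \<omega>
    proof -
      have "\<omega> k \<in> space M" using w by (simp add: space_Omega)
      moreover have "\<nu> * D * Q (\<omega> k) \<le> \<nu> * D * r" using A(3)[OF a] D nu_pos by (intro mult_left_mono) auto
      ultimately show ?thesis using near[of "\<omega> k"] A(3)[OF a] unfolding en[OF w] by (simp add: algebra_simps abs_le_iff r'_def)
    qed
    define z where "z = exp (- (r' + (J + e) * S)) * p"
    have z: "ennreal z \<le> unnorm {k} (\<lambda>_. 1) \<xi>"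
      using unnorm_lower[OF _ A(1) x, of "{k}" "r' + (J + e) * S"] up by (simp add: z_def p_def)
    \<comment> \<open>Solved from \<open>exp (Q - b - E) \<le> z\<close> with the lower bound for
      the energy \<open>E\<close>: the terms \<open>J * S\<close> of the lower and the upper bound
      cancel, and \<open>2 * e * S\<close> is left.\<close>
    define b where "b = C1 + r' - ln p + 2 * e * S"
    have "2 * e * S \<ge> 0" using S e by simp
    then have b: "b \<ge> 0" using C1(1) r' p(3) unfolding b_def by linarith
    have pt: "weight {k} (?z \<omega>) * ennreal (Q (?z \<omega> k)) \<le> ennreal z + ennreal b * weight {k} (?z \<omega>)"
      if w: "\<omega> \<in> space \<Omega>" for \<omega>
    proof -
      let ?E = "energy {k} (?z \<omega>)"
      \<comment> \<open>Through \<open>x \<le> exp x\<close> the excess of \<open>Q\<close> over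
        \<open>b\<close> has unnormalised expectation at most \<open>z\<close>, which is a lower
        bound for the normaliser; it thus adds at most 1 to the kernel.\<close>
      have "Q (\<omega> k) - b \<le> exp (Q (\<omega> k) - b)" using exp_ge_add_one_self[of "Q (\<omega> k) - b"] by linarith
      then have "exp (- ?E) * Q (\<omega> k) \<le> exp (- ?E) * (exp (Q (\<omega> k) - b) + b)" by (intro mult_left_mono) auto
      also have "\<dots> = exp (Q (\<omega> k) - b - ?E) + b * exp (- ?E)" by (simp add: algebra_simps exp_add[symmetric])
      also have "exp (Q (\<omega> k) - b - ?E) \<le> exp (- (r' + (J + e) * S) + ln p)"
        using low[OF w] by (simp add: b_def algebra_simps)
      also have "\<dots> = z" using p by (simp add: z_def exp_add)
      finally have "exp (- ?E) * Q (\<omega> k) \<le> z + b * exp (- ?E)" by simp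
      then have "ennreal (exp (- ?E) * Q (\<omega> k)) \<le> ennreal (z + b * exp (- ?E))" by (rule ennreal_leI)
      moreover have "z \<ge> 0" using p by (simp add: z_def)
      ultimately show ?thesis using b Q_nonneg w by (simp add: weight_def ennreal_mult space_Omega)
    qed
    have "unnorm {k} (\<lambda>\<omega>. ennreal (Q (\<omega> k))) \<xi> \<le> (\<integral>\<^sup>+\<omega>. ennreal z + ennreal b * weight {k} (?z \<omega>) \<partial>G)"
      unfolding unnorm_def by (intro nn_integral_mono pt) (simp add: space_G)
    also have "\<dots> = ennreal z + ennreal b * unnorm {k} (\<lambda>_. 1) \<xi>"
      by (subst nn_integral_add) (auto simp: nn_integral_cmult unnorm_def G.emeasure_space_1)
    also have "\<dots> \<le> unnorm {k} (\<lambda>_. 1) \<xi> + ennreal b * unnorm {k} (\<lambda>_. 1) \<xi>"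
      using z by (rule add_right_mono)
    also have "\<dots> = ennreal (1 + b) * unnorm {k} (\<lambda>_. 1) \<xi>" using b by (simp add: ring_distribs)
    finally have "kern {k} (\<lambda>\<omega>. ennreal (Q (\<omega> k))) \<xi> \<le> ennreal (1 + b) * unnorm {k} (\<lambda>_. 1) \<xi> / unnorm {k} (\<lambda>_. 1) \<xi>"
      unfolding kern_def by (rule divide_right_mono_ennreal)
    also have "\<dots> = ennreal (1 + b)"
      using unnorm_finite[OF x, of "{k}"] unnorm_pos[OF x, of "{k}"]
      by (simp add: ennreal_times_divide[symmetric] ennreal_divide_self)
    also have "1 + b = C + S / (2 * \<nu>)" by (simp add: b_def C_def e_def)
    finally show ?thesis by (simp add: S_def)
  qed
  moreover have "C \<ge> 0" using C1(1) r' p(3) unfolding C_def by linarith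
  ultimately show ?thesis by blast
qed

text \<open>At the site of \<open>\<Lambda>\<close> with the largest moment \<open>m\<close> the
  single-site bound gives \<open>m \<le> C + (m + Q c) / 2\<close>, where \<open>Q c\<close>
  accounts for the sites outside \<open>\<Lambda>\<close>. Solving for \<open>m\<close> yields
  \<open>2 * C + Q c\<close>, whatever \<open>\<Lambda>\<close> is.\<close>

lemma moment_bound:
  "\<exists>B\<ge>0. \<forall>\<Lambda> k. finite \<Lambda> \<longrightarrow> (\<integral>\<^sup>+\<omega>. ennreal (Q (\<omega> k)) \<partial>gibbs \<Lambda>) \<le> ennreal B"
proof -
  obtain C where C: "C \<ge> 0" "\<And>k \<xi>. \<xi> \<in> space \<Omega> \<Longrightarrow> kern {k} (\<lambda>\<omega>. ennreal (Q (\<omega> k))) \<xi> \<le> ennreal (C + (\<Sum>l\<in>nb k. Q (\<xi> l)) / (2 * \<nu>))"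
    using single_site by blast
  have Qc: "Q c \<ge> 0" using Q_nonneg base by simp
  define B where "B = 2 * C + Q c"
  have B: "B \<ge> 0" using C Qc by (simp add: B_def)
  have "(\<integral>\<^sup>+\<omega>. ennreal (Q (\<omega> k)) \<partial>gibbs \<Lambda>) \<le> ennreal B" if L: "finite \<Lambda>" for \<Lambda> k
  proof -
    define I where "I k = (\<integral>\<^sup>+\<omega>. ennreal (Q (\<omega> k)) \<partial>gibbs \<Lambda>)" for k
    interpret mu: prob_space "gibbs \<Lambda>" by (rule prob_space_gibbs)
    have out: "I k = ennreal (Q c)" if k: "k \<notin> \<Lambda>" for k
    proof -
      have "I k = kern \<Lambda> (\<lambda>\<omega>. ennreal (Q (\<omega> k))) (\<lambda>_. c)" unfolding I_def by (rule nn_integral_gibbs) measurable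
      also have "\<dots> = unnorm \<Lambda> (\<lambda>_. 1) (\<lambda>_. c) * ennreal (Q c) / unnorm \<Lambda> (\<lambda>_. 1) (\<lambda>_. c)"
      proof -
        have [measurable]: "(\<lambda>_. c) \<in> space \<Omega>" by (rule base_in)
        show ?thesis unfolding kern_def unnorm_def using k
          by (simp add: nn_integral_multc)
      qed
      also have "\<dots> = ennreal (Q c) * (unnorm \<Lambda> (\<lambda>_. 1) (\<lambda>_. c) / unnorm \<Lambda> (\<lambda>_. 1) (\<lambda>_. c))"
        by (simp add: ennreal_times_divide mult.commute)
      also have "\<dots> = ennreal (Q c)"
        using unnorm_finite[OF base_in, of \<Lambda>] unnorm_pos[OF base_in, of \<Lambda>] by (simp add: ennreal_divide_self)
      finally show ?thesis .
    qed
    \<comment> \<open>Finiteness, with a bound that may depend on \<open>\<Lambda>\<close>, has to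
      precede the recursion, since \<open>m / 2\<close> is moved to the other side. It follows from
      \<open>Q \<le> exp Q\<close> and \<open>Q - C'' \<le> v\<close>.\<close>
    have fin: "I k < \<infinity>" if k: "k \<in> \<Lambda>" for k
    proof -
      from v_superquadratic[of 0] obtain C' where C': "\<And>x. x \<in> space M \<Longrightarrow> - C' \<le> v x" by auto
      from v_superquadratic[of 1] obtain C'' where C'': "\<And>x. x \<in> space M \<Longrightarrow> Q x - C'' \<le> v x" by auto
      let ?K = "exp (C'' + C' * real (card (\<Lambda> - {k})))"
      have pt: "weight \<Lambda> \<zeta> * ennreal (Q (\<zeta> k)) \<le> ennreal ?K" if z: "\<zeta> \<in> space \<Omega>" for \<zeta>
      proof -
        have "(\<Sum>l\<in>\<Lambda> - {k}. - C') \<le> (\<Sum>l\<in>\<Lambda> - {k}. v (\<zeta> l))" using z C' by (intro sum_mono) (auto simp: space_Omega)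
        moreover have "(\<Sum>l\<in>\<Lambda>. v (\<zeta> l)) = v (\<zeta> k) + (\<Sum>l\<in>\<Lambda> - {k}. v (\<zeta> l))" using L k by (rule sum.remove)
        moreover have "0 \<le> (\<Sum>(k, l)\<in>bonds \<Lambda>. w (\<zeta> k) (\<zeta> l))"
          using z w_nonneg by (intro sum_nonneg) (auto simp: space_Omega)
        moreover have "Q (\<zeta> k) - C'' \<le> v (\<zeta> k)" using C'' z by (simp add: space_Omega)
        ultimately have *: "- energy \<Lambda> \<zeta> + Q (\<zeta> k) \<le> C'' + C' * real (card (\<Lambda> - {k}))"
          unfolding energy_def by (simp add: mult.commute)
        have "exp (- energy \<Lambda> \<zeta>) * Q (\<zeta> k) \<le> exp (- energy \<Lambda> \<zeta>) * exp (Q (\<zeta> k))"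
          using exp_ge_add_one_self[of "Q (\<zeta> k)"] by (intro mult_left_mono) (linarith, simp)
        also have "\<dots> \<le> ?K" unfolding exp_add[symmetric] using * by (subst exp_le_cancel_iff)
        finally show ?thesis using Q_nonneg z by (simp add: weight_def ennreal_mult[symmetric] ennreal_leI space_Omega)
      qed
      have "unnorm \<Lambda> (\<lambda>\<omega>. ennreal (Q (\<omega> k))) (\<lambda>_. c) \<le> (\<integral>\<^sup>+\<omega>. ennreal ?K \<partial>G)"
        unfolding unnorm_def by (intro nn_integral_mono pt override_in_Omega base_in) (simp add: space_G)
      also have "\<dots> < \<infinity>" by (simp add: G.emeasure_space_1)
      finally have "kern \<Lambda> (\<lambda>\<omega>. ennreal (Q (\<omega> k))) (\<lambda>_. c) < \<infinity>"
        unfolding kern_def using unnorm_pos[OF base_in, of \<Lambda>] by (auto simp: ennreal_divide_eq_top_iff less_top[symmetric])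
      then show ?thesis unfolding I_def by (subst nn_integral_gibbs) auto
    qed
    have fin': "I k < \<infinity>" for k using fin[of k] out[of k] by (cases "k \<in> \<Lambda>") auto
    define a where "a k = enn2real (I k)" for k
    have Ia: "I k = ennreal (a k)" for k using fin'[of k] by (simp add: a_def)
    have a0: "a k \<ge> 0" for k by (simp add: a_def)
    have step: "a k \<le> C + (\<Sum>l\<in>nb k. a l) / (2 * \<nu>)" if k: "k \<in> \<Lambda>" for k
    proof -
      have "I k = (\<integral>\<^sup>+\<xi>. kern {k} (\<lambda>\<omega>. ennreal (Q (\<omega> k))) \<xi> \<partial>gibbs \<Lambda>)"
        unfolding I_def using k L by (intro gibbs_DLR[symmetric]) auto
      also have "\<dots> \<le> (\<integral>\<^sup>+\<xi>. ennreal C + ennreal (1 / (2 * \<nu>)) * (\<Sum>l\<in>nb k. ennreal (Q (\<xi> l))) \<partial>gibbs \<Lambda>)"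
      proof (rule nn_integral_mono)
        fix \<xi> assume "\<xi> \<in> space (gibbs \<Lambda>)"
        then have x: "\<xi> \<in> space \<Omega>" by simp
        have q: "Q (\<xi> l) \<ge> 0" for l using x Q_nonneg by (simp add: space_Omega)
        have "ennreal (C + (\<Sum>l\<in>nb k. Q (\<xi> l)) / (2 * \<nu>)) = ennreal C + ennreal (1 / (2 * \<nu>)) * (\<Sum>l\<in>nb k. ennreal (Q (\<xi> l)))"
          using q C nu_pos by (simp add: ennreal_mult[symmetric] ennreal_plus[symmetric] sum_nonneg del: ennreal_plus)
        then show "kern {k} (\<lambda>\<omega>. ennreal (Q (\<omega> k))) \<xi> \<le> ennreal C + ennreal (1 / (2 * \<nu>)) * (\<Sum>l\<in>nb k. ennreal (Q (\<xi> l)))"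
          using C(2)[OF x, of k] by simp
      qed
      also have "\<dots> = ennreal C + ennreal (1 / (2 * \<nu>)) * (\<Sum>l\<in>nb k. I l)"
        by (subst nn_integral_add) (auto simp: nn_integral_cmult nn_integral_sum I_def mu.emeasure_space_1[simplified])
      also have "\<dots> = ennreal (C + (\<Sum>l\<in>nb k. a l) / (2 * \<nu>))"
        using a0 C nu_pos by (simp add: Ia ennreal_mult[symmetric] ennreal_plus[symmetric] sum_nonneg del: ennreal_plus)
      finally have "ennreal (a k) \<le> ennreal (C + (\<Sum>l\<in>nb k. a l) / (2 * \<nu>))" unfolding Ia .
      moreover have "0 \<le> C + (\<Sum>l\<in>nb k. a l) / (2 * \<nu>)" using a0 C nu_pos by (simp add: sum_nonneg)
      ultimately show ?thesis by (simp only: ennreal_le_iff)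
    qed
    have "a k \<le> B" for k
    proof (cases "\<Lambda> = {}")
      case True
      then show ?thesis using out[of k] Ia[of k] a0[of k] C Qc by (simp add: B_def)
    next
      case False
      define m where "m = Max (a ` \<Lambda>)"
      have m: "\<And>k. k \<in> \<Lambda> \<Longrightarrow> a k \<le> m" using L by (simp add: m_def)
      have "m \<in> a ` \<Lambda>" unfolding m_def using L False by (intro Max_in) auto
      then obtain k0 where k0: "k0 \<in> \<Lambda>" "a k0 = m" by auto
      have al: "a l \<le> m + Q c" for l
        using m[of l] out[of l] Ia[of l] a0[of l] a0[of k0] Qc k0 by (cases "l \<in> \<Lambda>") auto
      have "(\<Sum>l\<in>nb k0. a l) \<le> real (card (nb k0)) * (m + Q c)"
        using al by (intro sum_bounded_above) auto
      also have "\<dots> \<le> \<nu> * (m + Q c)" using card_nb[of k0] a0[of k0] k0 Qc by (intro mult_right_mono) auto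
      finally have "(\<Sum>l\<in>nb k0. a l) / (2 * \<nu>) \<le> (m + Q c) / 2" using nu_pos by (simp add: field_simps)
      then have "m \<le> B" using step[OF k0(1)] k0 by (simp add: B_def)
      then show ?thesis using m[of k] out[of k] Ia[of k] a0[of k] C Qc by (cases "k \<in> \<Lambda>") (auto simp: B_def)
    qed
    then show ?thesis using Ia[of k] by (simp add: I_def ennreal_leI)
  qed
  then show ?thesis using B by blast
qed

end

section \<open>The infinite-volume limit\<close>

text \<open>The extension theorem concerns marginals on Polish spaces, while \<open>M\<close> will
  be a trace sigma-algebra on a subset of a non-separable space. The marginals are pushed forward
  along \<open>g\<close>, extended, and brought back along \<open>h\<close>; as \<open>h\<close>
  inverts \<open>g\<close> on \<open>space M\<close>, they are recovered.\<close>

lemma kolmogorov_retract: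
  fixes P :: "'i set \<Rightarrow> ('i \<Rightarrow> 'a) measure" and g :: "'a \<Rightarrow> 'p::polish_space"
  assumes "projective_family I P (\<lambda>_. M)"
    and g [measurable]: "g \<in> measurable M borel" and h [measurable]: "h \<in> measurable borel M"
    and hg: "\<And>x. x \<in> space M \<Longrightarrow> h (g x) = x"
  obtains \<mu> where "prob_space \<mu>" "sets \<mu> = sets (PiM I (\<lambda>_. M))"
    "\<And>J X. finite J \<Longrightarrow> J \<subseteq> I \<Longrightarrow> X \<in> sets (PiM J (\<lambda>_. M)) \<Longrightarrow>
       emeasure \<mu> (prod_emb I (\<lambda>_. M) J X) = emeasure (P J) X"
proof -
  interpret P: projective_family I P "\<lambda>_. M" by fact
  define gg where "gg J = (\<lambda>x::'i \<Rightarrow> 'a. \<lambda>i\<in>J. g (x i))" for J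
  define hh where "hh J = (\<lambda>x::'i \<Rightarrow> 'p. \<lambda>i\<in>J. h (x i))" for J
  have gg [measurable]: "gg J \<in> measurable (PiM J (\<lambda>_. M)) (PiM J (\<lambda>_. borel))" for J
    unfolding gg_def by measurable
  have hh [measurable]: "hh J \<in> measurable (PiM J (\<lambda>_. borel)) (PiM J (\<lambda>_. M))" for J
    unfolding hh_def by measurable
  define P' where "P' J = distr (P J) (PiM J (\<lambda>_. borel)) (gg J)" for J
  have ggP: "gg J \<in> measurable (P J) (PiM J (\<lambda>_. borel))" if "finite J" "J \<subseteq> I" for J
    using gg[of J] by (simp add: measurable_cong_sets[OF P.sets_P[OF that] refl])
  have "projective_family I P' (\<lambda>_. borel)"
  proof (rule projective_family.intro)
    fix J H :: "'i set" assume JH: "J \<subseteq> H" "finite H" "H \<subseteq> I"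
    have r1: "(\<lambda>f. restrict f J) \<in> measurable (P H) (PiM J (\<lambda>_. M))"
      using measurable_restrict_subset[OF JH(1)] by (simp add: measurable_cong_sets[OF P.sets_P[OF JH(2,3)] refl])
    have r2: "(\<lambda>f. restrict f J) \<in> measurable (PiM H (\<lambda>_. borel)) (PiM J (\<lambda>_. borel))"
      using measurable_restrict_subset[OF JH(1)] .
    have "P' J = distr (distr (P H) (PiM J (\<lambda>_. M)) (\<lambda>f. restrict f J)) (PiM J (\<lambda>_. borel)) (gg J)"
      unfolding P'_def using P.P[OF JH] by simp
    also have "\<dots> = distr (P H) (PiM J (\<lambda>_. borel)) (gg J \<circ> (\<lambda>f. restrict f J))"
      by (rule distr_distr[OF gg r1])
    also have "gg J \<circ> (\<lambda>f. restrict f J) = (\<lambda>f. restrict f J) \<circ> gg H"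
      using JH by (auto simp: gg_def fun_eq_iff restrict_def)
    also have "distr (P H) (PiM J (\<lambda>_. borel)) \<dots> = distr (P' H) (PiM J (\<lambda>_. borel)) (\<lambda>f. restrict f J)"
      unfolding P'_def by (rule distr_distr[symmetric, OF r2 ggP]) (use JH in auto)
    finally show "P' J = distr (P' H) (PiM J (\<lambda>_. borel)) (\<lambda>f. restrict f J)" .
  next
    fix J :: "'i set" assume J: "finite J" "J \<subseteq> I"
    then show "prob_space (P' J)" unfolding P'_def
      by (intro prob_space.prob_space_distr P.prob_space_P ggP)
  qed
  then interpret P': polish_projective I P' by (simp add: polish_projective_def)
  have hl: "hh I \<in> measurable P'.lim (PiM I (\<lambda>_. M))"
    using hh[of I] by (simp add: measurable_cong_sets[OF P'.sets_lim refl])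
  show ?thesis
  proof
    show "prob_space (distr P'.lim (PiM I (\<lambda>_. M)) (hh I))"
      by (rule P'.P.prob_space_distr[OF hl])
    show "sets (distr P'.lim (PiM I (\<lambda>_. M)) (hh I)) = sets (PiM I (\<lambda>_. M))" by simp
    fix J X assume J: "finite J" "J \<subseteq> I" and X: "X \<in> sets (PiM J (\<lambda>_. M))"
    have E: "prod_emb I (\<lambda>_. M) J X \<in> sets (PiM I (\<lambda>_. M))" using J X by (auto intro: sets_PiM_I measurable_prod_emb)
    let ?Y = "hh J -` X \<inter> space (PiM J (\<lambda>_. borel))"
    have Y: "?Y \<in> sets (PiM J (\<lambda>_. borel))" using X by measurable
    have hM: "h y \<in> space M" for y using measurable_space[OF h] by simp
    have "emeasure (distr P'.lim (PiM I (\<lambda>_. M)) (hh I)) (prod_emb I (\<lambda>_. M) J X)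
        = emeasure P'.lim (hh I -` prod_emb I (\<lambda>_. M) J X \<inter> space P'.lim)"
      by (rule emeasure_distr[OF hl E])
    also have "hh I -` prod_emb I (\<lambda>_. M) J X \<inter> space P'.lim = prod_emb I (\<lambda>_. borel) J ?Y"
    proof -
      have *: "restrict (hh I x) J = hh J (restrict x J)" for x
        using J by (auto simp: hh_def restrict_def fun_eq_iff)
      have "hh I x \<in> (\<Pi>\<^sub>E i\<in>I. space M)" for x using hM by (auto simp: hh_def)
      then show ?thesis
        by (auto simp: prod_emb_def sets_eq_imp_space_eq[OF P'.sets_lim] space_PiM *)
    qed
    also have "emeasure P'.lim \<dots> = emeasure (P' J) ?Y"
      by (rule P'.emeasure_lim_emb[OF J(2,1) Y])
    also have "\<dots> = emeasure (P J) (gg J -` ?Y \<inter> space (P J))"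
      unfolding P'_def by (rule emeasure_distr[OF ggP[OF J] Y])
    also have "gg J -` ?Y \<inter> space (P J) = X"
    proof -
      have "hh J (gg J x) = x" if "x \<in> space (PiM J (\<lambda>_. M))" for x
        using that hg by (auto simp: hh_def gg_def fun_eq_iff space_PiM PiE_def Pi_def extensional_def restrict_def)
      then show ?thesis using sets.sets_into_space[OF X] by (auto simp: P.space_P[OF J] gg_def space_PiM)
    qed
    finally show "emeasure (distr P'.lim (PiM I (\<lambda>_. M)) (hh I)) (prod_emb I (\<lambda>_. M) J X) = emeasure (P J) X" .
  qed
qed

text \<open>A cluster point in the compact product of unit intervals over all \<open>x\<close>. For
  uncountably many \<open>x\<close> no single subsequence need work, so the limit is taken along a
  filter finer than \<open>sequentially\<close>.\<close>

lemma pointwise_cluster_point: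
  fixes f :: "nat \<Rightarrow> 'x \<Rightarrow> real"
  assumes "\<And>n x. 0 \<le> f n x \<and> f n x \<le> 1"
  obtains U L where "U \<noteq> bot" "U \<le> sequentially" "\<And>x. ((\<lambda>n. f n x) \<longlongrightarrow> L x) U"
proof -
  have "compactin (product_topology (\<lambda>_::'x. euclideanreal) UNIV) (PiE UNIV (\<lambda>_. {0..1}))"
    by (simp add: compactin_PiE)
  then have K: "compact (PiE UNIV (\<lambda>_::'x. {0..1::real}))"
    by (simp add: euclidean_product_topology)
  let ?F = "filtermap f sequentially"
  have "eventually (\<lambda>x. x \<in> PiE UNIV (\<lambda>_::'x. {0..1::real})) ?F"
    using assms by (simp add: eventually_filtermap PiE_def Pi_def)
  moreover have "?F \<noteq> bot" by (simp add: filtermap_bot_iff)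
  ultimately obtain L where L: "inf (nhds L) ?F \<noteq> bot"
    using K unfolding compact_filter by blast
  \<comment> \<open>Late indices \<open>n\<close> for which \<open>f n\<close> is close to
    \<open>L\<close>: this filter is proper because \<open>L\<close> is a cluster point, and
    \<open>f\<close> tends to \<open>L\<close> along it by construction.\<close>
  let ?U = "inf (filtercomap f (nhds L)) sequentially"
  have "?U \<noteq> bot"
  proof
    assume "?U = bot"
    then have "eventually (\<lambda>_. False) ?U" by simp
    then obtain P R where P: "eventually P (filtercomap f (nhds L))" "eventually R sequentially" "\<And>n. P n \<Longrightarrow> R n \<Longrightarrow> False"
      unfolding eventually_inf by blast
    then obtain P' where P': "eventually P' (nhds L)" "\<And>n. P' (f n) \<Longrightarrow> P n"
      unfolding eventually_filtercomap by blast
    have "eventually (\<lambda>x. \<not> P' x) ?F"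
      unfolding eventually_filtermap using P(2) by eventually_elim (use P P' in blast)
    then have "eventually (\<lambda>_. False) (inf (nhds L) ?F)"
      unfolding eventually_inf using P'(1) by blast
    then show False using L by (simp add: trivial_limit_def)
  qed
  moreover have "?U \<le> sequentially" by simp
  moreover have "((\<lambda>n. f n x) \<longlongrightarrow> L x) ?U" for x
  proof -
    have f: "filterlim f (nhds L) ?U"
      by (rule filterlim_mono[OF filterlim_filtercomap order_refl]) simp
    show ?thesis
    proof (rule topological_tendstoI)
      fix S :: "real set" assume S: "open S" "L x \<in> S"
      have "open {h :: 'x \<Rightarrow> real. h x \<in> S}"
        using open_vimage[OF S(1) continuous_on_product_coordinates[of x]] by (simp add: vimage_def)
      then show "eventually (\<lambda>n. f n x \<in> S) ?U"
        using topological_tendstoD[OF f, of "{h. h x \<in> S}"] S(2) by simp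
    qed
  qed
  ultimately show ?thesis by (rule that)
qed

text \<open>Approximation by the step functions whose level sets are \<open>{t \<le> f}\<close>.\<close>

lemma tendsto_integral_of_levels:
  fixes f :: "'x \<Rightarrow> real"
  assumes N: "\<And>n. prob_space (N n)" "\<And>n. sets (N n) = sets M" and \<mu>: "prob_space \<mu>" "sets \<mu> = sets M"
    and f [measurable]: "f \<in> borel_measurable M" and f01: "\<And>x. x \<in> space M \<Longrightarrow> 0 \<le> f x \<and> f x \<le> 1"
    and conv: "\<And>t. ((\<lambda>n. measure (N n) {x \<in> space M. t \<le> f x}) \<longlongrightarrow> measure \<mu> {x \<in> space M. t \<le> f x}) U"
  shows "((\<lambda>n. integral\<^sup>L (N n) f) \<longlongrightarrow> integral\<^sup>L \<mu> f) U"
proof (rule tendstoI)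
  fix e :: real assume e: "e > 0"
  obtain K :: nat where K: "K > 0" "1 / real K < e / 3"
    using e reals_Archimedean[of "e / 3"] by (metis divide_pos_pos inverse_eq_divide zero_less_Suc zero_less_numeral)
  define s where "s x = (\<Sum>j=1..K. indicator {x \<in> space M. real j / real K \<le> f x} x) / real K" for x
  have s: "s x \<le> f x" "f x \<le> s x + 1 / real K" if x: "x \<in> space M" for x
  proof -
    have "(\<Sum>j=1..K. indicator {x \<in> space M. real j / real K \<le> f x} x) = real (card {j\<in>{1..K}. real j \<le> real K * f x})"
      using x K by (simp add: indicator_def sum.If_cases field_simps Int_def)
    also have "{j\<in>{1..K}. real j \<le> real K * f x} = {1..nat \<lfloor>real K * f x\<rfloor>}"
    proof -
      have "real K * f x \<le> real K" using f01[OF x] by (simp add: mult_left_le)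
      then show ?thesis using f01[OF x] by (auto simp: le_nat_floor le_nat_iff le_floor_iff)
    qed
    finally have eq: "s x = real (nat \<lfloor>real K * f x\<rfloor>) / real K" by (simp add: s_def)
    have "0 \<le> real K * f x" using f01[OF x] by simp
    then have "real (nat \<lfloor>real K * f x\<rfloor>) \<le> real K * f x" "real K * f x \<le> real (nat \<lfloor>real K * f x\<rfloor>) + 1"
      by linarith+
    then show "s x \<le> f x" "f x \<le> s x + 1 / real K" using K by (simp_all add: eq field_simps)
  qed
  have approx: "integrable \<nu> s \<and> integral\<^sup>L \<nu> s = (\<Sum>j=1..K. measure \<nu> {x \<in> space M. real j / real K \<le> f x}) / real K
      \<and> \<bar>integral\<^sup>L \<nu> f - integral\<^sup>L \<nu> s\<bar> < e / 3" if \<nu>: "prob_space \<nu>" "sets \<nu> = sets M" for \<nu>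
  proof -
    interpret prob_space \<nu> by fact
    have sp: "space \<nu> = space M" using \<nu>(2) by (rule sets_eq_imp_space_eq)
    have S: "{x \<in> space M. t \<le> f x} \<in> sets \<nu>" for t unfolding \<nu>(2) by measurable
    have f' [measurable]: "f \<in> borel_measurable \<nu>" using f by (simp add: measurable_cong_sets[OF \<nu>(2) refl])
    have si: "integrable \<nu> s" unfolding s_def using S by (intro integrable_divide Bochner_Integration.integrable_sum integrable_real_indicator) (auto simp: emeasure_eq_measure)
    have "integrable \<nu> f" using f01 by (intro integrable_const_bound[where B=1] AE_I2) (auto simp: sp)
    then have "integral\<^sup>L \<nu> f - integral\<^sup>L \<nu> s = (\<integral>x. f x - s x \<partial>\<nu>)" using si by simp
    also have "\<bar>\<dots>\<bar> \<le> 1 / real K"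
    proof -
      have i: "integrable \<nu> (\<lambda>x. f x - s x)" using si \<open>integrable \<nu> f\<close> by simp
      have "(\<integral>x. f x - s x \<partial>\<nu>) \<le> 1 / real K"
        using s i by (intro integral_le_const AE_I2) (auto simp: sp algebra_simps)
      moreover have "0 \<le> (\<integral>x. f x - s x \<partial>\<nu>)"
        using s by (intro integral_nonneg_AE AE_I2) (auto simp: sp)
      ultimately show ?thesis by simp
    qed
    finally have "\<bar>integral\<^sup>L \<nu> f - integral\<^sup>L \<nu> s\<bar> < e / 3" using K by simp
    moreover have "integral\<^sup>L \<nu> s = (\<Sum>j=1..K. measure \<nu> {x \<in> space M. real j / real K \<le> f x}) / real K"
      unfolding s_def using S by (simp add: Bochner_Integration.integral_sum less_top[symmetric])
    ultimately show ?thesis using si by simp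
  qed
  have "((\<lambda>n. integral\<^sup>L (N n) s) \<longlongrightarrow> integral\<^sup>L \<mu> s) U"
    using approx[OF N] approx[OF \<mu>] conv K by (auto intro!: tendsto_intros)
  then have "eventually (\<lambda>n. dist (integral\<^sup>L (N n) s) (integral\<^sup>L \<mu> s) < e / 3) U"
    using e by (intro tendstoD) auto
  then show "eventually (\<lambda>n. dist (integral\<^sup>L (N n) f) (integral\<^sup>L \<mu> f) < e) U"
  proof eventually_elim
    case (elim n)
    then show ?case
      using approx[OF N(1,2)[of n], THEN conjunct2, THEN conjunct2] approx[OF \<mu>, THEN conjunct2, THEN conjunct2]
      unfolding dist_real_def by linarith
  qed
qed

section \<open>Local events and equicontinuity\<close>

context pair_model
begin

text \<open>A cylinder event over \<open>\<Delta>\<close>, described inside the full space so that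
  events of different volumes live on the same sigma-algebra.\<close>

definition local_set :: "'i set \<Rightarrow> ('i \<Rightarrow> 'a) set \<Rightarrow> bool" where
  "local_set \<Delta> A \<longleftrightarrow> A \<in> sets \<Omega> \<and>
     (\<forall>\<omega>\<in>space \<Omega>. \<forall>\<omega>'\<in>space \<Omega>. (\<forall>k\<in>\<Delta>. \<omega> k = \<omega>' k) \<longrightarrow> \<omega> \<in> A \<longrightarrow> \<omega>' \<in> A)"

lemma energy_local:
  assumes "\<And>k. k \<in> range_of \<Lambda> \<Longrightarrow> \<zeta> k = \<zeta>' k"
  shows "energy \<Lambda> \<zeta> = energy \<Lambda> \<zeta>'"
proof -
  have "(\<Sum>(k, l)\<in>bonds \<Lambda>. w (\<zeta> k) (\<zeta> l)) = (\<Sum>(k, l)\<in>bonds \<Lambda>. w (\<zeta>' k) (\<zeta>' l))"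
  proof (intro sum.cong refl, clarify)
    fix k l assume "(k, l) \<in> bonds \<Lambda>"
    then have "k \<in> range_of \<Lambda>" "l \<in> range_of \<Lambda>" using nb_sym by (auto simp: bonds_def range_of_def)
    then show "w (\<zeta> k) (\<zeta> l) = w (\<zeta>' k) (\<zeta>' l)" using assms by simp
  qed
  moreover have "(\<Sum>k\<in>\<Lambda>. v (\<zeta> k)) = (\<Sum>k\<in>\<Lambda>. v (\<zeta>' k))"
    using assms by (intro sum.cong) (auto simp: range_of_def)
  ultimately show ?thesis by (simp add: energy_def)
qed

text \<open>The interaction has finite range and the event looks at \<open>\<Delta>\<close> only.
  The kernel is thus itself a local function of the boundary condition, and setwise convergence on
  local events applies to it.\<close>

lemma kern_local:
  assumes x: "\<xi> \<in> space \<Omega>" "\<xi>' \<in> space \<Omega>" and eq: "\<And>k. k \<in> range_of \<Lambda> \<union> \<Delta> \<Longrightarrow> \<xi> k = \<xi>' k" and A: "local_set \<Delta> A"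
  shows "kern \<Lambda> (indicator A) \<xi> = kern \<Lambda> (indicator A) \<xi>'"
proof -
  have w: "weight \<Lambda> (override_on \<xi> \<omega> \<Lambda>) = weight \<Lambda> (override_on \<xi>' \<omega> \<Lambda>)" for \<omega>
    unfolding weight_def using eq by (subst energy_local[of _ _ "override_on \<xi>' \<omega> \<Lambda>"]) (auto simp: override_on_def)
  have i: "indicator A (override_on \<xi> \<omega> \<Lambda>) = (indicator A (override_on \<xi>' \<omega> \<Lambda>) :: ennreal)" if "\<omega> \<in> space \<Omega>" for \<omega>
  proof -
    have "override_on \<xi> \<omega> \<Lambda> \<in> space \<Omega>" "override_on \<xi>' \<omega> \<Lambda> \<in> space \<Omega>"
      "\<forall>k\<in>\<Delta>. override_on \<xi> \<omega> \<Lambda> k = override_on \<xi>' \<omega> \<Lambda> k"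
      using x that eq by (auto simp: space_Omega override_on_def)
    then have "override_on \<xi> \<omega> \<Lambda> \<in> A \<longleftrightarrow> override_on \<xi>' \<omega> \<Lambda> \<in> A"
      using A unfolding local_set_def by metis
    then show ?thesis by (simp add: indicator_def)
  qed
  show ?thesis unfolding kern_def unnorm_def w
    by (intro arg_cong2[of _ _ _ _ "(/)"] nn_integral_cong) (auto simp: i space_G)
qed

text \<open>The numerator is at most \<open>K1 * emeasure G A\<close>, as the weight is bounded and
  the event depends on resampled spins only. The denominator is at least \<open>z\<close>: the inner
  spins are confined to \<open>A0\<close>, and the boundary spins have total \<open>Q\<close> at
  most \<open>R\<close>.\<close>

lemma kern_equicontinuous:
  assumes D: "finite \<Delta>"
  shows "\<exists>K\<ge>0. \<forall>\<xi>\<in>space \<Omega>. (\<Sum>l\<in>range_of \<Delta> - \<Delta>. Q (\<xi> l)) \<le> R \<longrightarrow>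
    (\<forall>A. local_set \<Delta> A \<longrightarrow> kern \<Delta> (indicator A) \<xi> \<le> ennreal K * emeasure G A)"
proof -
  obtain A0 r where A0: "A0 \<in> sets M" "0 \<le> r" "\<And>x. x \<in> A0 \<Longrightarrow> v x \<le> r \<and> Q x \<le> r" "measure \<gamma> A0 > 0"
    using bounded_event by blast
  obtain K1 where K1: "K1 \<ge> 0" "\<And>\<zeta>. \<zeta> \<in> space \<Omega> \<Longrightarrow> weight \<Delta> \<zeta> \<le> ennreal K1" using weight_bounded[of \<Delta>] by auto
  obtain C where C: "C \<ge> 0" "\<And>x y. x \<in> space M \<Longrightarrow> y \<in> space M \<Longrightarrow> \<bar>w x y - J * Q y\<bar> \<le> 1 * Q y + C * Q x"
    using w_near[of 1] by auto
  \<comment> \<open>\<open>s\<close> bounds \<open>Q\<close> at every site involved: inner spins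
    through \<open>r\<close>, boundary spins through \<open>R\<close>. In \<open>b\<close> each
    ordered bond costs at most \<open>(1 + \<bar>J\<bar>) * s + C * s\<close>, by the comparison of
    \<open>w\<close> with \<open>J * Q\<close> at \<open>e = 1\<close>.\<close>
  define s where "s = r + \<bar>R\<bar>"
  define b where "b = real (card \<Delta>) * r + 1/2 * (real (card (bonds \<Delta>)) * ((1 + \<bar>J\<bar>) * s + C * s))"
  define z where "z = exp (- b) * measure \<gamma> A0 ^ card \<Delta>"
  have z: "z > 0" using A0 by (simp add: z_def)
  have "kern \<Delta> (indicator A) \<xi> \<le> ennreal (K1 / z) * emeasure G A"
    if x [measurable]: "\<xi> \<in> space \<Omega>" and R: "(\<Sum>l\<in>range_of \<Delta> - \<Delta>. Q (\<xi> l)) \<le> R" and A: "local_set \<Delta> A" for \<xi> A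
  proof -
    have Am [measurable]: "A \<in> sets \<Omega>" using A by (simp add: local_set_def)
    have fin: "finite (range_of \<Delta> - \<Delta>)" using finite_range_of[OF D] by simp
    have Ql: "Q (\<xi> l) \<le> s" if "l \<in> range_of \<Delta> - \<Delta>" for l
    proof -
      have "Q (\<xi> l) \<le> (\<Sum>l\<in>range_of \<Delta> - \<Delta>. Q (\<xi> l))"
        using that fin x Q_nonneg by (intro member_le_sum) (auto simp: space_Omega)
      then show ?thesis using R A0 by (simp add: s_def)
    qed
    have up: "energy \<Delta> (override_on \<xi> \<omega> \<Delta>) \<le> b" if w: "\<omega> \<in> space \<Omega>" and a: "\<forall>k\<in>\<Delta>. \<omega> k \<in> A0" for \<omega>
    proof -
      let ?\<zeta> = "override_on \<xi> \<omega> \<Delta>"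
      have zO: "?\<zeta> \<in> space \<Omega>" using x w by (rule override_in_Omega)
      then have zM: "?\<zeta> k \<in> space M" for k by (simp add: space_Omega)
      have Qz: "Q (?\<zeta> k) \<le> s" if "k \<in> range_of \<Delta>" for k
        using Ql[of k] A0(2) A0(3)[of "\<omega> k"] a that by (cases "k \<in> \<Delta>") (auto simp: s_def)
      have "(\<Sum>(k, l)\<in>bonds \<Delta>. w (?\<zeta> k) (?\<zeta> l)) \<le> real (card (bonds \<Delta>)) * ((1 + \<bar>J\<bar>) * s + C * s)"
      proof (intro sum_bounded_above, clarify)
        fix k l assume "(k, l) \<in> bonds \<Delta>"
        then have "k \<in> range_of \<Delta>" "l \<in> range_of \<Delta>" using nb_sym by (auto simp: bonds_def range_of_def)
        then have q: "Q (?\<zeta> k) \<le> s" "Q (?\<zeta> l) \<le> s" using Qz by auto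
        have "J * Q (?\<zeta> l) \<le> \<bar>J\<bar> * Q (?\<zeta> l)" using Q_nonneg[OF zM[of l]] by (intro mult_right_mono) auto
        then have "w (?\<zeta> k) (?\<zeta> l) \<le> (1 + \<bar>J\<bar>) * Q (?\<zeta> l) + C * Q (?\<zeta> k)"
          using C(2)[OF zM[of k] zM[of l]] by (simp add: algebra_simps abs_le_iff)
        also have "\<dots> \<le> (1 + \<bar>J\<bar>) * s + C * s" using q C by (intro add_mono mult_left_mono) auto
        finally show "w (?\<zeta> k) (?\<zeta> l) \<le> (1 + \<bar>J\<bar>) * s + C * s" .
      qed
      moreover have "(\<Sum>k\<in>\<Delta>. v (?\<zeta> k)) \<le> real (card \<Delta>) * r"
        using A0(3) a by (intro sum_bounded_above) auto
      ultimately show ?thesis by (simp add: energy_def b_def)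
    qed
    have low: "ennreal z \<le> unnorm \<Delta> (\<lambda>_. 1) \<xi>"
      unfolding z_def using D A0(1) x up by (rule unnorm_lower)
    have ind: "indicator A (override_on \<xi> \<omega> \<Delta>) = (indicator A \<omega> :: ennreal)" if "\<omega> \<in> space \<Omega>" for \<omega>
    proof -
      have "override_on \<xi> \<omega> \<Delta> \<in> space \<Omega>" "\<forall>k\<in>\<Delta>. override_on \<xi> \<omega> \<Delta> k = \<omega> k"
        using x that by (auto intro: override_in_Omega)
      then have "override_on \<xi> \<omega> \<Delta> \<in> A \<longleftrightarrow> \<omega> \<in> A" using A that unfolding local_set_def by metis
      then show ?thesis by (simp add: indicator_def)
    qed
    have "unnorm \<Delta> (indicator A) \<xi> \<le> (\<integral>\<^sup>+\<omega>. ennreal K1 * indicator A \<omega> \<partial>G)"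
      unfolding unnorm_def using K1(2) override_in_Omega[OF x]
      by (intro nn_integral_mono) (auto simp: ind space_G intro!: mult_right_mono)
    also have "\<dots> = ennreal K1 * emeasure G A" by (rule nn_integral_cmult_indicator) (simp add: sets_G)
    finally have "kern \<Delta> (indicator A) \<xi> \<le> ennreal K1 * emeasure G A / unnorm \<Delta> (\<lambda>_. 1) \<xi>"
      unfolding kern_def by (rule divide_right_mono_ennreal)
    also have "\<dots> \<le> ennreal K1 * emeasure G A / ennreal z"
    proof -
      obtain u where u: "unnorm \<Delta> (\<lambda>_. 1) \<xi> = ennreal u" "u \<ge> 0"
        using unnorm_finite[OF x, of \<Delta>] by (cases "unnorm \<Delta> (\<lambda>_. 1) \<xi>") auto
      then have "z \<le> u" using low by simp
      then have "inverse (unnorm \<Delta> (\<lambda>_. 1) \<xi>) \<le> inverse (ennreal z)"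
        using z by (simp add: u inverse_ennreal ennreal_leI)
      then show ?thesis unfolding divide_ennreal_def by (intro mult_left_mono) auto
    qed
    also have "\<dots> = ennreal (K1 / z) * emeasure G A"
      using z K1(1) by (simp add: divide_ennreal[symmetric] divide_ennreal_def mult_ac)
    finally show ?thesis .
  qed
  moreover have "K1 / z \<ge> 0" using K1 z by simp
  ultimately show ?thesis by blast
qed

text \<open>In the DLR equation for \<open>\<Delta>\<close>, boundary conditions with total
  \<open>Q\<close> at most \<open>R\<close> obey the kernel bound; for the others the kernel is at
  most 1, and Markov's inequality with the uniform moment bound leaves at most \<open>e\<close>.
  Hence the same \<open>K\<close> serves all boxes.\<close>

lemma gibbs_equicontinuous:
  assumes D: "finite \<Delta>" and e: "e > 0"
  shows "\<exists>K\<ge>0. \<forall>\<Lambda> A. finite \<Lambda> \<longrightarrow> \<Delta> \<subseteq> \<Lambda> \<longrightarrow> local_set \<Delta> A \<longrightarrow> measure (gibbs \<Lambda>) A \<le> K * measure G A + e"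
proof -
  obtain B where B: "B \<ge> 0" "\<And>\<Lambda> k. finite \<Lambda> \<Longrightarrow> (\<integral>\<^sup>+\<omega>. ennreal (Q (\<omega> k)) \<partial>gibbs \<Lambda>) \<le> ennreal B"
    using moment_bound by blast
  define N where "N = range_of \<Delta> - \<Delta>"
  \<comment> \<open>Chosen for \<open>card N * B / R \<le> e\<close>; the added 1 keeps
    \<open>R\<close> positive when \<open>N\<close> is empty or \<open>B = 0\<close>.\<close>
  define R where "R = (real (card N) * B + 1) / e"
  have R: "R > 0" using B e by (simp add: R_def add_nonneg_pos)
  obtain K where K: "K \<ge> 0" "\<And>\<xi> A. \<xi> \<in> space \<Omega> \<Longrightarrow> (\<Sum>l\<in>N. Q (\<xi> l)) \<le> R \<Longrightarrow> local_set \<Delta> A \<Longrightarrow>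
      kern \<Delta> (indicator A) \<xi> \<le> ennreal K * emeasure G A"
    using kern_equicontinuous[OF D, of R] unfolding N_def by blast
  have "measure (gibbs \<Lambda>) A \<le> K * measure G A + e" if L: "finite \<Lambda>" "\<Delta> \<subseteq> \<Lambda>" and A: "local_set \<Delta> A" for \<Lambda> A
  proof -
    interpret mu: prob_space "gibbs \<Lambda>" by (rule prob_space_gibbs)
    have Am [measurable]: "A \<in> sets \<Omega>" using A by (simp add: local_set_def)
    have "emeasure (gibbs \<Lambda>) A = (\<integral>\<^sup>+\<xi>. kern \<Delta> (indicator A) \<xi> \<partial>gibbs \<Lambda>)"
      using gibbs_DLR[of "indicator A" \<Delta> \<Lambda>] L by simp
    also have "\<dots> \<le> (\<integral>\<^sup>+\<xi>. ennreal K * emeasure G A + ennreal (1 / R) * (\<Sum>l\<in>N. ennreal (Q (\<xi> l))) \<partial>gibbs \<Lambda>)"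
    proof (rule nn_integral_mono)
      fix \<xi> assume "\<xi> \<in> space (gibbs \<Lambda>)"
      then have x: "\<xi> \<in> space \<Omega>" by simp
      show "kern \<Delta> (indicator A) \<xi> \<le> ennreal K * emeasure G A + ennreal (1 / R) * (\<Sum>l\<in>N. ennreal (Q (\<xi> l)))"
      proof (cases "(\<Sum>l\<in>N. Q (\<xi> l)) \<le> R")
        case True
        then show ?thesis using K(2)[OF x True A] by (simp add: add_increasing2)
      next
        case False
        have "kern \<Delta> (indicator A) \<xi> \<le> kern \<Delta> (\<lambda>_. 1) \<xi>"
          using x by (rule kern_mono) (simp add: indicator_def)
        also have "\<dots> = ennreal 1" using kern_one[OF x] by simp
        also have "\<dots> \<le> ennreal (1 / R * (\<Sum>l\<in>N. Q (\<xi> l)))" using False R by (intro ennreal_leI) (simp add: field_simps)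
        also have "\<dots> = ennreal (1 / R) * (\<Sum>l\<in>N. ennreal (Q (\<xi> l)))"
          using R x Q_nonneg by (simp add: ennreal_mult[symmetric] sum_nonneg space_Omega)
        finally show ?thesis by (simp add: add_increasing)
      qed
    qed
    also have "\<dots> = ennreal K * emeasure G A + ennreal (1 / R) * (\<Sum>l\<in>N. \<integral>\<^sup>+\<xi>. ennreal (Q (\<xi> l)) \<partial>gibbs \<Lambda>)"
      by (subst nn_integral_add) (auto simp: nn_integral_cmult nn_integral_sum mu.emeasure_space_1[simplified])
    also have "\<dots> \<le> ennreal K * emeasure G A + ennreal (1 / R) * (\<Sum>l\<in>N. ennreal B)"
      using B(2)[OF L(1)] by (intro add_left_mono mult_left_mono sum_mono) auto
    also have "\<dots> = ennreal (K * measure G A + real (card N) * B / R)"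
      using K(1) R B(1) by (simp add: G.emeasure_eq_measure ennreal_mult[symmetric] ennreal_plus[symmetric] ennreal_of_nat_eq_real_of_nat del: ennreal_plus)
    finally have "measure (gibbs \<Lambda>) A \<le> K * measure G A + real (card N) * B / R"
      unfolding mu.emeasure_eq_measure using K(1) R B(1) by (subst (asm) ennreal_le_iff) auto
    also have "real (card N) * B \<le> e * R" using e by (simp add: R_def)
    then have "real (card N) * B / R \<le> e" using R by (simp add: pos_divide_le_eq)
    finally show ?thesis by simp
  qed
  then show ?thesis using K(1) by blast
qed

end

section \<open>The limit measure and its DLR equations\<close>

context pair_model
begin

text \<open>Initial segments of an enumeration of the sites instead of cubes: finite, increasing,
  and eventually containing any given finite set.\<close>

definition box :: "nat \<Rightarrow> 'i set" where "box n = from_nat ` {..n}"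

lemma finite_box: "finite (box n)" by (simp add: box_def)

lemma eventually_box: "finite \<Delta> \<Longrightarrow> eventually (\<lambda>n. \<Delta> \<subseteq> box n) sequentially"
proof -
  assume f: "finite \<Delta>"
  have "\<Delta> \<subseteq> box n" if n: "n \<ge> Max (to_nat ` \<Delta>)" for n
  proof
    fix k assume "k \<in> \<Delta>"
    then have "to_nat k \<le> n" using n f by (meson Max_ge finite_imageI imageI le_trans)
    then show "k \<in> box n" unfolding box_def by (intro image_eqI[of _ _ "to_nat k"]) auto
  qed
  then show ?thesis by (auto simp: eventually_sequentially)
qed

abbreviation emb :: "'i set \<Rightarrow> ('i \<Rightarrow> 'a) set \<Rightarrow> ('i \<Rightarrow> 'a) set" where
  "emb I X \<equiv> prod_emb UNIV (\<lambda>_. M) I X"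

lemma local_emb: "X \<in> sets (PiM I (\<lambda>_. M)) \<Longrightarrow> local_set I (emb I X)"
proof -
  assume X: "X \<in> sets (PiM I (\<lambda>_. M))"
  have "restrict \<omega> I = restrict \<omega>' I" if "\<forall>k\<in>I. \<omega> k = \<omega>' k" for \<omega> \<omega>' :: "'i \<Rightarrow> 'a"
    using that by (auto simp: restrict_def)
  then show ?thesis using X unfolding local_set_def
    by (auto simp: prod_emb_iff space_Omega) metis
qed

text \<open>Filling the sites outside \<open>I\<close> with \<open>c\<close> completes a partial
  configuration; as the event ignores those sites, membership of the completion decides it.\<close>

lemma local_set_emb:
  assumes "local_set I A"
  obtains X where "X \<in> sets (PiM I (\<lambda>_. M))" "A = emb I X"
proof
  let ?e = "\<lambda>x. override_on (\<lambda>_. c) x I"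
  let ?X = "?e -` A \<inter> space (PiM I (\<lambda>_. M))"
  have A: "A \<in> sets \<Omega>" using assms by (simp add: local_set_def)
  have "?e \<in> measurable (PiM I (\<lambda>_. M)) \<Omega>"
  proof (rule measurable_PiM_single')
    show "(\<lambda>x. ?e x i) \<in> measurable (PiM I (\<lambda>_. M)) M" if "i \<in> UNIV" for i
      using base by (cases "i \<in> I") (auto simp: override_on_def)
    show "(\<lambda>x i. ?e x i) \<in> space (PiM I (\<lambda>_. M)) \<rightarrow> UNIV \<rightarrow>\<^sub>E space M"
      using base by (auto simp: override_on_def space_PiM PiE_def Pi_def)
  qed
  then show "?X \<in> sets (PiM I (\<lambda>_. M))" using A by (rule measurable_sets)
  have "\<omega> \<in> A \<longleftrightarrow> ?e (restrict \<omega> I) \<in> A" if w: "\<omega> \<in> space \<Omega>" for \<omega>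
  proof -
    have "?e (restrict \<omega> I) \<in> space \<Omega>" using w base by (auto simp: space_Omega override_on_def)
    moreover have "\<forall>k\<in>I. ?e (restrict \<omega> I) k = \<omega> k" by auto
    ultimately show ?thesis using assms w unfolding local_set_def by metis
  qed
  moreover have "A \<subseteq> space \<Omega>" using A by (rule sets.sets_into_space)
  ultimately show "A = emb I ?X"
    by (auto simp: prod_emb_iff space_Omega subset_eq) (auto simp: space_PiM)
qed

lemma local_levels:
  assumes f [measurable]: "f \<in> borel_measurable \<Omega>"
    and loc: "\<And>\<omega> \<omega>'. \<omega> \<in> space \<Omega> \<Longrightarrow> \<omega>' \<in> space \<Omega> \<Longrightarrow> (\<And>k. k \<in> I \<Longrightarrow> \<omega> k = \<omega>' k) \<Longrightarrow> f \<omega> = (f \<omega>' :: real)"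
  shows "local_set I {\<omega> \<in> space \<Omega>. t \<le> f \<omega>}"
proof -
  have "t \<le> f \<omega>'" if "\<omega> \<in> space \<Omega>" "\<omega>' \<in> space \<Omega>" "\<forall>k\<in>I. \<omega> k = \<omega>' k" "t \<le> f \<omega>" for \<omega> \<omega>'
    using loc[of \<omega> \<omega>'] that by simp
  moreover have "{\<omega> \<in> space \<Omega>. t \<le> f \<omega>} \<in> sets \<Omega>" by measurable
  ultimately show ?thesis unfolding local_set_def by blast
qed

text \<open>Finite additivity of the limit \<open>L\<close> is inherited. For a fixed finite
  \<open>I\<close>, continuity at the empty set follows from the domination of \<open>L\<close> by
  \<open>K * measure G + e\<close> with arbitrary \<open>e\<close>, because \<open>G\<close> is
  countably additive.\<close>

lemma limit_measure:
  fixes g :: "'a \<Rightarrow> 'p::polish_space"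
  assumes g: "g \<in> measurable M borel" and h: "h \<in> measurable borel M"
    and hg: "\<And>x. x \<in> space M \<Longrightarrow> h (g x) = x"
  obtains \<mu> U where "prob_space \<mu>" "sets \<mu> = sets \<Omega>" "U \<noteq> bot" "U \<le> sequentially"
    "\<And>I A. finite I \<Longrightarrow> local_set I A \<Longrightarrow> ((\<lambda>n. measure (gibbs (box n)) A) \<longlongrightarrow> measure \<mu> A) U"
proof -
  interpret gibbs: prob_space "gibbs \<Lambda>" for \<Lambda> by (rule prob_space_gibbs)
  obtain U L where U: "U \<noteq> bot" "U \<le> sequentially" and L: "\<And>A. ((\<lambda>n. measure (gibbs (box n)) A) \<longlongrightarrow> L A) U"
    using pointwise_cluster_point[of "\<lambda>n A. measure (gibbs (box n)) A"] by auto
  have L0: "L A \<ge> 0" for A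
    by (rule tendsto_lowerbound[OF L _ U(1)]) simp
  have Ladd: "L (A \<union> B) = L A + L B" if "A \<in> sets \<Omega>" "B \<in> sets \<Omega>" "A \<inter> B = {}" for A B
  proof -
    have "((\<lambda>n. measure (gibbs (box n)) (A \<union> B)) \<longlongrightarrow> L A + L B) U"
      using tendsto_add[OF L[of A] L[of B]] that by (simp add: gibbs.finite_measure_Union)
    then show ?thesis using tendsto_unique[OF U(1) L] by blast
  qed
  have Lsp: "L (space \<Omega>) = 1"
  proof -
    have "((\<lambda>n. measure (gibbs (box n)) (space \<Omega>)) \<longlongrightarrow> 1) U"
      using gibbs.prob_space by simp
    then show ?thesis using tendsto_unique[OF U(1) L] by blast
  qed
  have Lemp: "L {} = 0" using tendsto_unique[OF U(1) L[of "{}"]] by simp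
  \<comment> \<open>The equicontinuity bound holds for all boxes that contain
    \<open>\<Delta>\<close>, hence eventually, and a weak inequality survives the limit along
    \<open>U\<close>.\<close>
  have Lequi: "\<exists>K\<ge>0. \<forall>A. local_set \<Delta> A \<longrightarrow> L A \<le> K * measure G A + e" if D: "finite \<Delta>" "e > 0" for \<Delta> e
  proof -
    obtain K where K: "K \<ge> 0" "\<And>\<Lambda> A. finite \<Lambda> \<Longrightarrow> \<Delta> \<subseteq> \<Lambda> \<Longrightarrow> local_set \<Delta> A \<Longrightarrow> measure (gibbs \<Lambda>) A \<le> K * measure G A + e"
      using gibbs_equicontinuous[OF D] by blast
    have "L A \<le> K * measure G A + e" if A: "local_set \<Delta> A" for A
    proof (rule tendsto_upperbound[OF L _ U(1)])
      have "eventually (\<lambda>n. measure (gibbs (box n)) A \<le> K * measure G A + e) sequentially"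
        using eventually_box[OF D(1)] by eventually_elim (use K A finite_box in auto)
      then show "eventually (\<lambda>n. measure (gibbs (box n)) A \<le> K * measure G A + e) U"
        using U(2) by (simp add: le_filter_def)
    qed
    then show ?thesis using K(1) by blast
  qed
  \<comment> \<open>\<open>measure_of\<close> takes the prescribed values only if these are
    countably additive; \<open>emP\<close> establishes this for every finite
    \<open>I\<close>.\<close>
  define P where "P I = measure_of (space (PiM I (\<lambda>_. M))) (sets (PiM I (\<lambda>_. M))) (\<lambda>X. ennreal (L (emb I X)))" for I
  have setsP: "sets (P I) = sets (PiM I (\<lambda>_. M))" for I
    by (simp add: P_def sets.sigma_sets_eq sets.space_closed)
  have spaceP: "space (P I) = space (PiM I (\<lambda>_. M))" for I
    using setsP by (rule sets_eq_imp_space_eq)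
  have emP: "emeasure (P I) X = ennreal (L (emb I X))" if I: "finite I" and X: "X \<in> sets (PiM I (\<lambda>_. M))" for I X
  proof -
    have "positive (sets (PiM I (\<lambda>_. M))) (\<lambda>X. ennreal (L (emb I X)))"
      by (simp add: positive_def Lemp)
    moreover have "countably_additive (sets (PiM I (\<lambda>_. M))) (\<lambda>X. ennreal (L (emb I X)))"
    proof (rule sets.empty_continuous_imp_countably_additive)
      show "positive (sets (PiM I (\<lambda>_. M))) (\<lambda>X. ennreal (L (emb I X)))" by fact
      show "additive (sets (PiM I (\<lambda>_. M))) (\<lambda>X. ennreal (L (emb I X)))"
        unfolding additive_def
      proof (intro ballI impI)
        fix X Y assume XY: "X \<in> sets (PiM I (\<lambda>_. M))" "Y \<in> sets (PiM I (\<lambda>_. M))" "X \<inter> Y = {}"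
        have "emb I (X \<union> Y) = emb I X \<union> emb I Y" by (auto simp: prod_emb_def)
        moreover have "emb I X \<inter> emb I Y = {}" using XY by (auto simp: prod_emb_def)
        ultimately have "L (emb I (X \<union> Y)) = L (emb I X) + L (emb I Y)"
          using XY by (simp add: Ladd)
        then show "ennreal (L (emb I (X \<union> Y))) = ennreal (L (emb I X)) + ennreal (L (emb I Y))"
          by (simp add: L0)
      qed
      show "\<forall>X\<in>sets (PiM I (\<lambda>_. M)). ennreal (L (emb I X)) \<noteq> \<infinity>" by simp
      fix X assume X: "range X \<subseteq> sets (PiM I (\<lambda>_. M))" "decseq X" "(\<Inter>i. X i) = {}"
      have Xi: "X i \<in> sets (PiM I (\<lambda>_. M))" for i using X(1) by auto
      have "(\<lambda>i. measure G (emb I (X i))) \<longlonglongrightarrow> measure G (\<Inter>i. emb I (X i))"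
      proof (rule G.finite_Lim_measure_decseq)
        show "range (\<lambda>i. emb I (X i)) \<subseteq> sets G" using Xi by (auto simp: sets_G)
        show "decseq (\<lambda>i. emb I (X i))"
          using X(2) by (auto simp: decseq_def intro!: prod_emb_mono)
      qed
      moreover have "(\<Inter>i. emb I (X i)) = {}" using X(3) by (auto simp: prod_emb_def)
      ultimately have G0: "(\<lambda>i. measure G (emb I (X i))) \<longlonglongrightarrow> 0"
        by simp
      have "(\<lambda>i. L (emb I (X i))) \<longlonglongrightarrow> 0"
      proof (rule tendstoI)
        fix e :: real assume e: "e > 0"
        obtain K where K: "K \<ge> 0" "\<And>A. local_set I A \<Longrightarrow> L A \<le> K * measure G A + e / 2"
          using Lequi[OF I, of "e / 2"] e by auto
        have "(\<lambda>i. K * measure G (emb I (X i))) \<longlonglongrightarrow> K * 0" by (intro tendsto_intros G0)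
        then have "eventually (\<lambda>i. K * measure G (emb I (X i)) < e / 2) sequentially"
          using e by (intro order_tendstoD(2)[of _ "K * 0"]) auto
        then show "eventually (\<lambda>i. dist (L (emb I (X i))) 0 < e) sequentially"
        proof eventually_elim
          case (elim i)
          then show ?case using K(2)[OF local_emb[OF Xi[of i]]] L0[of "emb I (X i)"] by simp
        qed
      qed
      then show "(\<lambda>i. ennreal (L (emb I (X i)))) \<longlonglongrightarrow> 0"
        using tendsto_ennrealI by fastforce
    qed
    ultimately show ?thesis using X
      by (intro emeasure_measure_of[OF P_def sets.space_closed]) (simp_all add: setsP)
  qed
  have "projective_family UNIV P (\<lambda>_. M)"
  proof (rule projective_family.intro)
    fix I H :: "'i set" assume IH: "I \<subseteq> H" "finite H"
    have r: "(\<lambda>f. restrict f I) \<in> measurable (P H) (PiM I (\<lambda>_. M))"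
      using measurable_restrict_subset[OF IH(1)] by (simp add: measurable_cong_sets[OF setsP refl])
    have fJ: "finite I" using IH by (rule finite_subset)
    show "P I = distr (P H) (PiM I (\<lambda>_. M)) (\<lambda>f. restrict f I)"
    proof (rule measure_eqI)
      fix X assume "X \<in> sets (P I)"
      then have X: "X \<in> sets (PiM I (\<lambda>_. M))" by (simp add: setsP)
      let ?Y = "(\<lambda>f. restrict f I) -` X \<inter> space (PiM H (\<lambda>_. M))"
      have "emeasure (distr (P H) (PiM I (\<lambda>_. M)) (\<lambda>f. restrict f I)) X = emeasure (P H) ?Y"
        by (simp add: emeasure_distr[OF r X] spaceP)
      also have "\<dots> = ennreal (L (emb H ?Y))"
        using measurable_sets[OF measurable_restrict_subset[OF IH(1)] X] by (intro emP IH)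
      also have "emb H ?Y = emb I X"
        using IH(1) by (auto simp: prod_emb_iff space_PiM Int_absorb1 Int_absorb2 PiE_def)
      finally show "emeasure (P I) X = emeasure (distr (P H) (PiM I (\<lambda>_. M)) (\<lambda>f. restrict f I)) X"
        unfolding emP[OF fJ X] by (rule sym)
    qed (simp add: setsP)
  next
    fix I :: "'i set" assume I: "finite I"
    have "emeasure (P I) (space (P I)) = ennreal (L (emb I (space (PiM I (\<lambda>_. M)))))"
      unfolding spaceP by (rule emP[OF I]) simp
    also have "emb I (space (PiM I (\<lambda>_. M))) = space \<Omega>"
      by (auto simp: prod_emb_iff space_PiM PiE_iff)
    finally show "prob_space (P I)" by (intro prob_spaceI) (simp add: Lsp)
  qed
  then obtain \<mu> where \<mu>: "prob_space \<mu>" "sets \<mu> = sets \<Omega>"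
    "\<And>I X. finite I \<Longrightarrow> X \<in> sets (PiM I (\<lambda>_. M)) \<Longrightarrow> emeasure \<mu> (emb I X) = emeasure (P I) X"
    using kolmogorov_retract[OF _ g h hg, of UNIV P] by auto
  have "((\<lambda>n. measure (gibbs (box n)) A) \<longlongrightarrow> measure \<mu> A) U" if I: "finite I" and A: "local_set I A" for I A
  proof -
    obtain X where X: "X \<in> sets (PiM I (\<lambda>_. M))" "A = emb I X" using local_set_emb[OF A] .
    then have "measure \<mu> A = L A" using \<mu>(3)[OF I X(1)] emP[OF I X(1)] by (simp add: measure_def L0)
    then show ?thesis using L[of A] by simp
  qed
  with \<mu>(1,2) U show ?thesis by (rule that)
qed

theorem exists_gibbs_measure:
  fixes g :: "'a \<Rightarrow> 'p::polish_space"
  assumes g: "g \<in> measurable M borel" and h: "h \<in> measurable borel M"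
    and hg: "\<And>x. x \<in> space M \<Longrightarrow> h (g x) = x"
  obtains \<mu> B where "prob_space \<mu>" "sets \<mu> = sets \<Omega>" "B \<ge> 0"
    "\<And>\<Lambda> A. finite \<Lambda> \<Longrightarrow> A \<in> sets \<Omega> \<Longrightarrow> (\<integral>\<^sup>+\<xi>. kern \<Lambda> (indicator A) \<xi> \<partial>\<mu>) = emeasure \<mu> A"
    "\<And>k. (\<integral>\<^sup>+\<omega>. ennreal (Q (\<omega> k)) \<partial>\<mu>) \<le> ennreal B"
proof -
  obtain \<mu> U where \<mu>: "prob_space \<mu>" and s [measurable_cong]: "sets \<mu> = sets \<Omega>" and U: "U \<noteq> bot" "U \<le> sequentially"
    and conv: "\<And>I A. finite I \<Longrightarrow> local_set I A \<Longrightarrow> ((\<lambda>n. measure (gibbs (box n)) A) \<longlongrightarrow> measure \<mu> A) U"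
    using limit_measure[OF g h hg] by blast
  interpret \<mu>: prob_space \<mu> by fact
  interpret gibbs: prob_space "gibbs \<Lambda>" for \<Lambda> by (rule prob_space_gibbs)
  have sp: "space \<mu> = space \<Omega>" using s by (rule sets_eq_imp_space_eq)
  have lim: "((\<lambda>n. integral\<^sup>L (gibbs (box n)) f) \<longlongrightarrow> integral\<^sup>L \<mu> f) U"
    if I: "finite I" and f: "f \<in> borel_measurable \<Omega>" and f01: "\<And>\<omega>. \<omega> \<in> space \<Omega> \<Longrightarrow> 0 \<le> f \<omega> \<and> f \<omega> \<le> (1::real)"
    and loc: "\<And>\<omega> \<omega>'. \<omega> \<in> space \<Omega> \<Longrightarrow> \<omega>' \<in> space \<Omega> \<Longrightarrow> (\<And>k. k \<in> I \<Longrightarrow> \<omega> k = \<omega>' k) \<Longrightarrow> f \<omega> = f \<omega>'" for I f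
  proof (rule tendsto_integral_of_levels[OF prob_space_gibbs sets_gibbs \<mu> s f f01])
    show "((\<lambda>n. measure (gibbs (box n)) {\<omega> \<in> space \<Omega>. t \<le> f \<omega>}) \<longlongrightarrow> measure \<mu> {\<omega> \<in> space \<Omega>. t \<le> f \<omega>}) U" for t
      by (rule conv[OF I local_levels[OF f loc]])
  qed
  have DLR_local: "(\<integral>\<^sup>+\<xi>. kern \<Lambda> (indicator A) \<xi> \<partial>\<mu>) = emeasure \<mu> A"
    if L: "finite \<Lambda>" and I: "finite I" and A: "local_set I A" for \<Lambda> I A
  proof -
    have Am [measurable]: "A \<in> sets \<Omega>" using A by (simp add: local_set_def)
    define f where "f \<xi> = enn2real (kern \<Lambda> (indicator A) \<xi>)" for \<xi>
    have fm [measurable]: "f \<in> borel_measurable \<Omega>" unfolding f_def by measurable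
    have k1: "kern \<Lambda> (indicator A) \<xi> \<le> 1" if "\<xi> \<in> space \<Omega>" for \<xi>
      using kern_mono[of \<xi> "indicator A" "\<lambda>_. 1" \<Lambda>] kern_one[OF that, of \<Lambda>] that by (simp add: indicator_def)
    have kf: "kern \<Lambda> (indicator A) \<xi> = ennreal (f \<xi>)" if "\<xi> \<in> space \<Omega>" for \<xi>
      using k1[OF that] unfolding f_def by (cases "kern \<Lambda> (indicator A) \<xi>") (auto simp: top_unique)
    have f01: "0 \<le> f \<xi> \<and> f \<xi> \<le> 1" if "\<xi> \<in> space \<Omega>" for \<xi>
    proof
      show "0 \<le> f \<xi>" by (simp add: f_def)
      show "f \<xi> \<le> 1" using k1[OF that] unfolding kf[OF that] by simp
    qed
    have int: "(\<integral>\<^sup>+\<xi>. kern \<Lambda> (indicator A) \<xi> \<partial>N) = ennreal (integral\<^sup>L N f)"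
      if "prob_space N" and sN [measurable_cong]: "sets N = sets \<Omega>" for N
    proof -
      interpret N: prob_space N by fact
      have sp: "space N = space \<Omega>" using sN by (rule sets_eq_imp_space_eq)
      have "integrable N f" using f01 by (intro N.integrable_const_bound[where B=1] AE_I2) (auto simp: sp)
      then have "(\<integral>\<^sup>+\<xi>. ennreal (f \<xi>) \<partial>N) = ennreal (integral\<^sup>L N f)"
        using f01 by (intro nn_integral_eq_integral AE_I2) (auto simp: sp)
      then show ?thesis using kf by (subst nn_integral_cong[of N _ "\<lambda>\<xi>. ennreal (f \<xi>)"]) (auto simp: sp)
    qed
    have "((\<lambda>n. integral\<^sup>L (gibbs (box n)) f) \<longlongrightarrow> integral\<^sup>L \<mu> f) U"
    proof (rule lim)
      show "finite (range_of \<Lambda> \<union> I)" using finite_range_of[OF L] I by simp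
      show "f \<omega> = f \<omega>'" if "\<omega> \<in> space \<Omega>" "\<omega>' \<in> space \<Omega>" "\<And>k. k \<in> range_of \<Lambda> \<union> I \<Longrightarrow> \<omega> k = \<omega>' k" for \<omega> \<omega>'
        unfolding f_def using kern_local[OF that(1,2) _ A, of \<Lambda>] that(3) by simp
    qed (use f01 in auto)
    \<comment> \<open>A box that contains \<open>\<Lambda>\<close> satisfies the DLR equation
      exactly, so the integral of \<open>f\<close> is eventually the box measure of
      \<open>A\<close>.\<close>
    moreover have "eventually (\<lambda>n. integral\<^sup>L (gibbs (box n)) f = measure (gibbs (box n)) A) U"
    proof -
      have "eventually (\<lambda>n. integral\<^sup>L (gibbs (box n)) f = measure (gibbs (box n)) A) sequentially"
        using eventually_box[OF L]
      proof eventually_elim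
        case (elim n)
        have "ennreal (integral\<^sup>L (gibbs (box n)) f) = emeasure (gibbs (box n)) A"
          using gibbs_DLR[of "indicator A" \<Lambda> "box n"] elim finite_box int[OF prob_space_gibbs sets_gibbs, of "box n"] by simp
        moreover have "integral\<^sup>L (gibbs (box n)) f \<ge> 0"
          using f01 by (intro integral_nonneg_AE AE_I2) auto
        ultimately show ?case by (simp add: gibbs.emeasure_eq_measure)
      qed
      then show ?thesis using U(2) by (simp add: le_filter_def)
    qed
    ultimately have "((\<lambda>n. measure (gibbs (box n)) A) \<longlongrightarrow> integral\<^sup>L \<mu> f) U"
      by (rule Lim_transform_eventually)
    then have "integral\<^sup>L \<mu> f = measure \<mu> A" using tendsto_unique[OF U(1) _ conv[OF I A]] by blast
    then show ?thesis using int[OF \<mu> s] by (simp add: \<mu>.emeasure_eq_measure)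
  qed
  \<comment> \<open>The left-hand side is the value at \<open>A\<close> of a measure
    \<open>N\<close>, the law of a \<open>\<mu>\<close>-distributed configuration after the spins in
    \<open>\<Lambda>\<close> are redrawn from the kernel. Agreement on cylinders, which are local,
    extends to all events.\<close>
  have DLR: "(\<integral>\<^sup>+\<xi>. kern \<Lambda> (indicator A) \<xi> \<partial>\<mu>) = emeasure \<mu> A" if L: "finite \<Lambda>" and A: "A \<in> sets \<Omega>" for \<Lambda> A
  proof -
    interpret PG: pair_prob_space \<mu> G ..
    let ?o = "\<lambda>p. override_on (fst p) (snd p) \<Lambda>"
    define N where "N = distr (density (\<mu> \<Otimes>\<^sub>M G) (\<lambda>p. weight \<Lambda> (?o p) / unnorm \<Lambda> (\<lambda>_. 1) (fst p))) \<Omega> ?o"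
    have emN: "emeasure N A = (\<integral>\<^sup>+\<xi>. kern \<Lambda> (indicator A) \<xi> \<partial>\<mu>)" if A [measurable]: "A \<in> sets \<Omega>" for A
    proof -
      have "emeasure N A = (\<integral>\<^sup>+\<omega>. indicator A \<omega> \<partial>N)"
        by (rule nn_integral_indicator[symmetric]) (simp add: N_def)
      also have "\<dots> = (\<integral>\<^sup>+p. weight \<Lambda> (?o p) / unnorm \<Lambda> (\<lambda>_. 1) (fst p) * indicator A (?o p) \<partial>(\<mu> \<Otimes>\<^sub>M G))"
        unfolding N_def by (subst nn_integral_distr, measurable, subst nn_integral_density) auto
      also have "\<dots> = (\<integral>\<^sup>+\<xi>. \<integral>\<^sup>+\<omega>. weight \<Lambda> (override_on \<xi> \<omega> \<Lambda>) / unnorm \<Lambda> (\<lambda>_. 1) \<xi> * indicator A (override_on \<xi> \<omega> \<Lambda>) \<partial>G \<partial>\<mu>)"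
        by (subst G.nn_integral_fst[symmetric]) auto
      also have "\<dots> = (\<integral>\<^sup>+\<xi>. kern \<Lambda> (indicator A) \<xi> \<partial>\<mu>)"
      proof (rule nn_integral_cong)
        fix \<xi> assume "\<xi> \<in> space \<mu>"
        then have x [measurable]: "\<xi> \<in> space \<Omega>" by (simp add: sp)
        have "(\<integral>\<^sup>+\<omega>. weight \<Lambda> (override_on \<xi> \<omega> \<Lambda>) / unnorm \<Lambda> (\<lambda>_. 1) \<xi> * indicator A (override_on \<xi> \<omega> \<Lambda>) \<partial>G)
          = (\<integral>\<^sup>+\<omega>. weight \<Lambda> (override_on \<xi> \<omega> \<Lambda>) * indicator A (override_on \<xi> \<omega> \<Lambda>) / unnorm \<Lambda> (\<lambda>_. 1) \<xi> \<partial>G)"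
          by (simp add: divide_ennreal_def mult_ac)
        also have "\<dots> = kern \<Lambda> (indicator A) \<xi>"
          unfolding kern_def by (subst nn_integral_divide) (auto simp: unnorm_def)
        finally show "(\<integral>\<^sup>+\<omega>. weight \<Lambda> (override_on \<xi> \<omega> \<Lambda>) / unnorm \<Lambda> (\<lambda>_. 1) \<xi> * indicator A (override_on \<xi> \<omega> \<Lambda>) \<partial>G) = kern \<Lambda> (indicator A) \<xi>" .
      qed
      finally show ?thesis .
    qed
    have "\<mu> = N"
    proof (rule measure_eqI_PiM_infinite[OF s])
      show "sets N = sets \<Omega>" by (simp add: N_def)
      show "finite_measure \<mu>" by (rule \<mu>.finite_measure_axioms)
      fix F and I :: "'i set" assume I: "finite I" and F: "\<And>i. i \<in> I \<Longrightarrow> F i \<in> sets M"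
      have "Pi\<^sub>E I F \<in> sets (PiM I (\<lambda>_. M))" using I F by (intro sets_PiM_I_finite) auto
      then have l: "local_set I (emb I (Pi\<^sub>E I F))" by (rule local_emb)
      then have "emb I (Pi\<^sub>E I F) \<in> sets \<Omega>" by (simp add: local_set_def)
      then show "emeasure \<mu> (emb I (Pi\<^sub>E I F)) = emeasure N (emb I (Pi\<^sub>E I F))"
        by (simp only: emN DLR_local[OF L I l])
    qed
    then show ?thesis using emN[OF A] by simp
  qed
  obtain B where B: "B \<ge> 0" "\<And>\<Lambda> k. finite \<Lambda> \<Longrightarrow> (\<integral>\<^sup>+\<omega>. ennreal (Q (\<omega> k)) \<partial>gibbs \<Lambda>) \<le> ennreal B"
    using moment_bound by blast
  have mom: "(\<integral>\<^sup>+\<omega>. ennreal (Q (\<omega> k)) \<partial>\<mu>) \<le> ennreal B" for k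
  proof -
    \<comment> \<open>Convergence of integrals is available for functions with values in
      \<open>{0..1}\<close>, so \<open>Q\<close> is cut off at \<open>Suc R\<close>, a positive
      number, and divided by it. Monotone convergence removes the cut-off afterwards.\<close>
    have trunc: "(\<integral>\<^sup>+\<omega>. ennreal (min (Q (\<omega> k)) (real (Suc R))) \<partial>\<mu>) \<le> ennreal B" for R :: nat
    proof -
      let ?R = "real (Suc R)"
      define f where "f \<omega> = min (Q (\<omega> k)) ?R / ?R" for \<omega>
      have fm [measurable]: "f \<in> borel_measurable \<Omega>" unfolding f_def by measurable
      have f01: "0 \<le> f \<omega> \<and> f \<omega> \<le> 1" if "\<omega> \<in> space \<Omega>" for \<omega>
        using that Q_nonneg[of "\<omega> k"] by (simp add: f_def space_Omega pos_divide_le_eq del: of_nat_Suc)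
      have "((\<lambda>n. integral\<^sup>L (gibbs (box n)) f) \<longlongrightarrow> integral\<^sup>L \<mu> f) U"
        by (rule lim[of "{k}"]) (use f01 in \<open>auto simp: f_def[symmetric]\<close>, simp add: f_def)
      then have "integral\<^sup>L \<mu> f \<le> B / ?R"
      proof (rule tendsto_upperbound[OF _ _ U(1)], intro always_eventually allI)
        fix n
        have "ennreal (integral\<^sup>L (gibbs (box n)) f) = (\<integral>\<^sup>+\<omega>. ennreal (f \<omega>) \<partial>gibbs (box n))"
          using f01 by (intro nn_integral_eq_integral[symmetric] AE_I2 gibbs.integrable_const_bound[where B=1]) auto
        also have "\<dots> \<le> (\<integral>\<^sup>+\<omega>. ennreal (1 / ?R) * ennreal (Q (\<omega> k)) \<partial>gibbs (box n))"
        proof (intro nn_integral_mono)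
          fix \<omega> assume "\<omega> \<in> space (gibbs (box n))"
          then have "Q (\<omega> k) \<ge> 0" using Q_nonneg by (simp add: space_Omega)
          then show "ennreal (f \<omega>) \<le> ennreal (1 / ?R) * ennreal (Q (\<omega> k))"
            by (subst ennreal_mult[symmetric]) (auto simp: f_def intro!: ennreal_leI divide_right_mono simp del: of_nat_Suc)
        qed
        also have "\<dots> = ennreal (1 / ?R) * (\<integral>\<^sup>+\<omega>. ennreal (Q (\<omega> k)) \<partial>gibbs (box n))"
          by (rule nn_integral_cmult) measurable
        also have "\<dots> \<le> ennreal (1 / ?R) * ennreal B" using B(2)[OF finite_box] by (intro mult_left_mono) auto
        also have "\<dots> = ennreal (B / ?R)" using B(1) by (simp add: ennreal_mult[symmetric])
        finally show "integral\<^sup>L (gibbs (box n)) f \<le> B / ?R" using B(1) by (subst (asm) ennreal_le_iff) auto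
      qed
      have "(\<integral>\<^sup>+\<omega>. ennreal (min (Q (\<omega> k)) ?R) \<partial>\<mu>) = (\<integral>\<^sup>+\<omega>. ennreal ?R * ennreal (f \<omega>) \<partial>\<mu>)"
      proof (intro nn_integral_cong)
        fix \<omega> assume "\<omega> \<in> space \<mu>"
        then have "f \<omega> \<ge> 0" using f01 by (simp add: sp)
        then show "ennreal (min (Q (\<omega> k)) ?R) = ennreal ?R * ennreal (f \<omega>)"
          by (subst ennreal_mult[symmetric]) (simp_all add: f_def)
      qed
      also have "\<dots> = ennreal ?R * (\<integral>\<^sup>+\<omega>. ennreal (f \<omega>) \<partial>\<mu>)" by (rule nn_integral_cmult) measurable
      also have "(\<integral>\<^sup>+\<omega>. ennreal (f \<omega>) \<partial>\<mu>) = ennreal (integral\<^sup>L \<mu> f)"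
        using f01 by (intro nn_integral_eq_integral AE_I2 \<mu>.integrable_const_bound[where B=1]) (auto simp: sp)
      also have "ennreal ?R * \<dots> \<le> ennreal ?R * ennreal (B / ?R)"
        using \<open>integral\<^sup>L \<mu> f \<le> B / ?R\<close> by (intro mult_left_mono ennreal_leI) auto
      also have "\<dots> = ennreal B" using B(1) by (subst ennreal_mult[symmetric]) simp_all
      finally show ?thesis .
    qed
    have "(\<integral>\<^sup>+\<omega>. ennreal (Q (\<omega> k)) \<partial>\<mu>) = (\<integral>\<^sup>+\<omega>. (SUP R. ennreal (min (Q (\<omega> k)) (real (Suc R)))) \<partial>\<mu>)"
    proof (rule nn_integral_cong)
      fix \<omega>
      obtain R where R: "Q (\<omega> k) \<le> real R" using real_arch_simple by blast
      show "ennreal (Q (\<omega> k)) = (SUP R. ennreal (min (Q (\<omega> k)) (real (Suc R))))"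
      proof (rule antisym)
        show "ennreal (Q (\<omega> k)) \<le> (SUP R. ennreal (min (Q (\<omega> k)) (real (Suc R))))"
          by (rule SUP_upper2[of R]) (use R in \<open>auto intro!: ennreal_leI\<close>)
        show "(SUP R. ennreal (min (Q (\<omega> k)) (real (Suc R)))) \<le> ennreal (Q (\<omega> k))"
          by (rule SUP_least) (auto intro!: ennreal_leI)
      qed
    qed
    also have "\<dots> = (SUP R. \<integral>\<^sup>+\<omega>. ennreal (min (Q (\<omega> k)) (real (Suc R))) \<partial>\<mu>)"
      by (rule nn_integral_monotone_convergence_SUP) (auto simp: incseq_def le_fun_def intro!: ennreal_leI)
    also have "\<dots> \<le> ennreal B" by (intro SUP_least trunc)
    finally show ?thesis .
  qed
  show ?thesis by (rule that[OF \<mu> s B(1) DLR mom])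
qed

end

section \<open>The loop space is Polish\<close>

lemma periodic_add_int:
  fixes f :: "real \<Rightarrow> 'b"
  assumes "\<And>t. f (t + p) = f t"
  shows "f (t + of_int n * p) = f t"
proof (induction n arbitrary: t rule: int_induct[where k = 0])
  case (step1 i)
  have "f (t + of_int (i + 1) * p) = f ((t + of_int i * p) + p)" by (simp add: algebra_simps)
  then show ?case using step1 assms by simp
next
  case (step2 i)
  have "f (t + of_int (i - 1) * p) = f ((t + of_int (i - 1) * p) + p)" using assms by simp
  also have "\<dots> = f (t + of_int i * p)" by (simp add: algebra_simps)
  finally show ?case using step2 by simp
qed simp

lemma loops_iff: "f \<in> loops \<beta> \<longleftrightarrow> (\<forall>t. apply_bcontfun f (t + \<beta>) = apply_bcontfun f t)"
  by (simp add: loops_def)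

lemma closed_loops: "closed (loops \<beta>)"
proof (unfold closed_sequential_limits, intro allI impI, elim conjE)
  fix f l assume f: "\<forall>n. f n \<in> loops \<beta>" and l: "f \<longlonglongrightarrow> l"
  have pt: "(\<lambda>n. apply_bcontfun (f n) t) \<longlonglongrightarrow> apply_bcontfun l t" for t
  proof (rule tendsto_dist_iff[THEN iffD2], rule tendsto_sandwich[where f="\<lambda>_. 0" and h="\<lambda>n. dist (f n) l"])
    show "(\<lambda>n. dist (f n) l) \<longlonglongrightarrow> 0" using l tendsto_dist_iff by blast
  qed (auto simp: dist_bounded)
  have "apply_bcontfun l (t + \<beta>) = apply_bcontfun l t" for t
    using pt[of "t + \<beta>"] pt[of t] f by (intro LIMSEQ_unique[OF pt[of "t + \<beta>"]]) (simp add: loops_iff)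
  then show "l \<in> loops \<beta>" by (simp add: loops_iff)
qed

lemma continuous_on_apply: "continuous_on UNIV (\<lambda>f :: real \<Rightarrow>\<^sub>C real. apply_bcontfun f t)"
proof (unfold continuous_on_iff, intro ballI allI impI)
  fix f :: "real \<Rightarrow>\<^sub>C real" and e :: real assume "e > 0"
  then show "\<exists>d>0. \<forall>g\<in>UNIV. dist g f < d \<longrightarrow> dist (apply_bcontfun g t) (apply_bcontfun f t) < e"
    by (intro exI[of _ e]) (auto intro: le_less_trans[OF dist_bounded])
qed

text \<open>A change of time scale identifies loops of any period with loops of period 1. A type
  cannot depend on the real number \<open>\<beta>\<close>, so the Polish space is set up for period
  1 alone.\<close>

definition rescale :: "real \<Rightarrow> (real \<Rightarrow>\<^sub>C real) \<Rightarrow> (real \<Rightarrow>\<^sub>C real)" where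
  "rescale c f = Bcontfun (\<lambda>t. apply_bcontfun f (c * t))"

lemma apply_rescale [simp]: "apply_bcontfun (rescale c f) t = apply_bcontfun f (c * t)"
proof -
  have "continuous_on UNIV (\<lambda>t. apply_bcontfun f (c * t))"
    using continuous_on_compose2[OF continuous_on_apply_bcontfun[of UNIV f], of UNIV "(*) c"]
    by (auto intro!: continuous_intros)
  then have "(\<lambda>t. apply_bcontfun f (c * t)) \<in> bcontfun"
    by (rule bcontfun_normI) (rule norm_bounded)
  then show ?thesis by (simp add: rescale_def Bcontfun_inverse)
qed

lemma dist_rescale: "dist (rescale c f) (rescale c g) \<le> dist f g"
  by (rule dist_bound) (simp add: dist_bounded)

lemma rescale_inverse: "c * d = 1 \<Longrightarrow> rescale c (rescale d f) = f"
proof (rule bcontfun_eqI)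
  fix t assume "c * d = 1"
  then have "d * (c * t) = t" by (metis mult.assoc mult.commute mult_1)
  then show "apply_bcontfun (rescale c (rescale d f)) t = apply_bcontfun f t" by (simp only: apply_rescale)
qed

lemma rescale_loops: "\<beta> \<noteq> 0 \<Longrightarrow> f \<in> loops \<beta> \<Longrightarrow> rescale \<beta> f \<in> loops 1"
  by (simp add: loops_iff distrib_left)

lemma rescale_loops': "\<beta> \<noteq> 0 \<Longrightarrow> f \<in> loops 1 \<Longrightarrow> rescale (1 / \<beta>) f \<in> loops \<beta>"
  by (simp add: loops_iff add_divide_distrib)

section \<open>The Polish space of loops of period 1\<close>

typedef unit_loop = "loops 1"
proof
  show "0 \<in> loops 1" by (simp add: loops_iff)
qed

instantiation unit_loop :: metric_space
begin

definition dist_unit_loop :: "unit_loop \<Rightarrow> unit_loop \<Rightarrow> real" where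
  "dist_unit_loop x y = dist (Rep_unit_loop x) (Rep_unit_loop y)"

definition uniformity_unit_loop :: "(unit_loop \<times> unit_loop) filter" where
  "uniformity_unit_loop = (INF e\<in>{0 <..}. principal {(x, y). dist x y < e})"

definition open_unit_loop :: "unit_loop set \<Rightarrow> bool" where
  "open_unit_loop U \<longleftrightarrow> (\<forall>x\<in>U. \<forall>\<^sub>F (x', y) in uniformity. x' = x \<longrightarrow> y \<in> U)"

instance
proof
  fix x y z :: unit_loop
  show "dist x y = 0 \<longleftrightarrow> x = y" by (simp add: dist_unit_loop_def Rep_unit_loop_inject)
  show "dist x y \<le> dist x z + dist y z" unfolding dist_unit_loop_def by (rule dist_triangle2)
qed (simp_all add: uniformity_unit_loop_def open_unit_loop_def)

end

instance unit_loop :: complete_space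
proof
  fix X :: "nat \<Rightarrow> unit_loop" assume X: "Cauchy X"
  have "Cauchy (\<lambda>n. Rep_unit_loop (X n))"
    using X by (simp add: Cauchy_def dist_unit_loop_def)
  then obtain l where l: "(\<lambda>n. Rep_unit_loop (X n)) \<longlonglongrightarrow> l"
    using Cauchy_convergent convergent_def by blast
  have "l \<in> loops 1" by (rule closed_sequentially[OF closed_loops Rep_unit_loop l])
  then have "X \<longlonglongrightarrow> Abs_unit_loop l"
    using l by (simp add: lim_sequentially dist_unit_loop_def Abs_unit_loop_inverse)
  then show "convergent X" by (auto simp: convergent_def)
qed

lemma dist_unit_loop_le:
  assumes "\<And>t. 0 \<le> t \<Longrightarrow> t < 1 \<Longrightarrow> \<bar>apply_bcontfun (Rep_unit_loop f) t - apply_bcontfun (Rep_unit_loop g) t\<bar> \<le> e"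
  shows "dist f g \<le> e"
  unfolding dist_unit_loop_def
proof (rule dist_bound)
  fix t :: real
  have per: "apply_bcontfun (Rep_unit_loop f) (frac t) = apply_bcontfun (Rep_unit_loop f) t" for f
    using periodic_add_int[of "apply_bcontfun (Rep_unit_loop f)" 1 "frac t" "\<lfloor>t\<rfloor>"] Rep_unit_loop[of f]
    by (simp add: loops_iff frac_def)
  show "dist (apply_bcontfun (Rep_unit_loop f) t) (apply_bcontfun (Rep_unit_loop g) t) \<le> e"
    using assms[of "frac t"] by (simp add: per dist_real_def frac_lt_1)
qed

text \<open>
  Separability: for a given modulus of continuity, a loop is determined up to \<open>3 * e\<close> by the
  integer parts of its values, in units of \<open>e\<close>, on a finite grid.
\<close>

lemma unit_loop_separable: "\<exists>D :: unit_loop set. countable D \<and> (\<forall>x. \<forall>e>0. \<exists>y\<in>D. dist y x < e)"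
proof -
  define e where "e k = 1 / real (Suc k)" for k
  define code where "code k n f = map (\<lambda>i. \<lfloor>apply_bcontfun (Rep_unit_loop f) (real i / real (Suc n)) / e k\<rfloor>) [0..<Suc n]" for k n f
  define good where "good k n f \<longleftrightarrow> (\<forall>s\<in>{0..1}. \<forall>t\<in>{0..1}. \<bar>s - t\<bar> \<le> 1 / real (Suc n) \<longrightarrow>
    \<bar>apply_bcontfun (Rep_unit_loop f) s - apply_bcontfun (Rep_unit_loop f) t\<bar> \<le> e k)" for k n f
  \<comment> \<open>One representative for every code realised by some good loop; for other codes
    the choice is arbitrary and harmless. The arguments are two naturals and a list of integers, so
    the range is countable.\<close>
  define pick where "pick = (\<lambda>(k, n, v). SOME f. good k n f \<and> code k n f = v)"
  have e: "e k > 0" for k by (simp add: e_def)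
  have close: "dist f g \<le> 3 * e k" if fg: "good k n f" "good k n g" "code k n f = code k n g" for k n f g
  proof (rule dist_unit_loop_le)
    fix t :: real assume t: "0 \<le> t" "t < 1"
    \<comment> \<open>The grid point just to the left of \<open>t\<close>; since
      \<open>t < 1\<close>, its index is at most \<open>n\<close> and its value is part of the
      code.\<close>
    define i where "i = nat \<lfloor>t * real (Suc n)\<rfloor>"
    let ?s = "real i / real (Suc n)"
    have "t * real (Suc n) < real (Suc n)" using t by (simp del: of_nat_Suc)
    then have i: "real i \<le> t * real (Suc n)" "t * real (Suc n) < real i + 1" "i < Suc n"
      using t unfolding i_def by (auto simp: nat_less_iff floor_less_iff simp del: of_nat_Suc)
    have "t - ?s = (t * real (Suc n) - real i) / real (Suc n)" by (simp add: diff_divide_distrib del: of_nat_Suc)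
    also have "\<bar>\<dots>\<bar> = \<bar>t * real (Suc n) - real i\<bar> / real (Suc n)" by (simp add: abs_divide del: of_nat_Suc)
    also have "\<dots> \<le> 1 / real (Suc n)" using i by (intro divide_right_mono) auto
    finally have s: "?s \<in> {0..1}" "\<bar>t - ?s\<bar> \<le> 1 / real (Suc n)" using i(3) by auto
    let ?f = "apply_bcontfun (Rep_unit_loop f)" and ?g = "apply_bcontfun (Rep_unit_loop g)"
    have "\<bar>?f t - ?f ?s\<bar> \<le> e k" "\<bar>?g t - ?g ?s\<bar> \<le> e k"
      using fg s t by (auto simp: good_def)
    moreover have "\<lfloor>?f ?s / e k\<rfloor> = \<lfloor>?g ?s / e k\<rfloor>"
    proof -
      have "code k n f ! i = code k n g ! i" using fg by simp
      then show ?thesis using i(3) by (simp add: code_def del: upt_Suc)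
    qed
    then have "\<bar>?f ?s / e k - ?g ?s / e k\<bar> < 1" by linarith
    then have "\<bar>?f ?s - ?g ?s\<bar> < e k" using e[of k] by (simp add: diff_divide_distrib[symmetric] abs_divide divide_less_eq)
    ultimately show "\<bar>?f t - ?g t\<bar> \<le> 3 * e k" by linarith
  qed
  have "\<exists>y\<in>range pick. dist y x < d" if d: "d > 0" for x d
  proof -
    obtain k where k: "3 * e k < d"
      using reals_Archimedean[of "d / 3"] d by (auto simp: e_def inverse_eq_divide field_simps)
    have "uniformly_continuous_on {0..1} (apply_bcontfun (Rep_unit_loop x))"
      by (rule compact_uniformly_continuous) auto
    then obtain m where m: "m > 0" "\<And>s t. s \<in> {0..1} \<Longrightarrow> t \<in> {0..1} \<Longrightarrow> dist t s < m \<Longrightarrow>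
        dist (apply_bcontfun (Rep_unit_loop x) t) (apply_bcontfun (Rep_unit_loop x) s) < e k"
      using e[of k] unfolding uniformly_continuous_on_def by metis
    obtain n where n: "1 / real (Suc n) < m" using reals_Archimedean[OF m(1)] by (auto simp: inverse_eq_divide)
    have g: "good k n x" unfolding good_def
      using m(2) n by (force simp: dist_real_def intro!: less_imp_le)
    let ?y = "pick (k, n, code k n x)"
    have "good k n ?y \<and> code k n ?y = code k n x"
      unfolding pick_def prod.case by (rule someI[of _ x]) (simp add: g)
    then have "dist ?y x \<le> 3 * e k" using close[OF _ g] by simp
    then show ?thesis using k by (intro bexI[of _ ?y]) auto
  qed
  then show ?thesis by (intro exI[of _ "range pick"]) auto
qed

instance unit_loop :: second_countable_topology
proof
  obtain D :: "unit_loop set" where D: "countable D" "\<And>x e. e > 0 \<Longrightarrow> \<exists>y\<in>D. dist y x < e"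
    using unit_loop_separable by blast
  let ?B = "(\<lambda>(y, n). ball y (1 / real (Suc n))) ` (D \<times> UNIV)"
  have "topological_basis ?B"
  proof (rule topological_basisI)
    fix U :: "unit_loop set" and x assume U: "open U" "x \<in> U"
    then obtain r where r: "r > 0" "ball x r \<subseteq> U" using open_contains_ball by blast
    obtain n where n: "1 / real (Suc n) < r / 2" using reals_Archimedean[of "r / 2"] r by (auto simp: inverse_eq_divide)
    obtain y where y: "y \<in> D" "dist y x < 1 / real (Suc n)" using D(2)[of "1 / real (Suc n)" x] by auto
    have "ball y (1 / real (Suc n)) \<subseteq> ball x r"
    proof
      fix z assume "z \<in> ball y (1 / real (Suc n))"
      then show "z \<in> ball x r" using y n dist_triangle[of x z y] by (simp add: dist_commute)
    qed
    then show "\<exists>B'\<in>?B. x \<in> B' \<and> B' \<subseteq> U" using y r by (intro bexI[of _ "ball y (1 / real (Suc n))"]) auto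
  qed auto
  then have "open = generate_topology ?B" by (rule topological_basis_imp_subbasis)
  moreover have "countable ?B" using D(1) by auto
  ultimately show "\<exists>B :: unit_loop set set. countable B \<and> open = generate_topology B" by blast
qed

instance unit_loop :: polish_space ..

section \<open>Transport to period 1 and Borel sets of configurations\<close>

definition to_unit :: "real \<Rightarrow> (real \<Rightarrow>\<^sub>C real) \<Rightarrow> unit_loop" where
  "to_unit \<beta> f = Abs_unit_loop (rescale \<beta> f)"

definition of_unit :: "real \<Rightarrow> unit_loop \<Rightarrow> (real \<Rightarrow>\<^sub>C real)" where
  "of_unit \<beta> u = rescale (1 / \<beta>) (Rep_unit_loop u)"

abbreviation loop_space :: "real \<Rightarrow> (real \<Rightarrow>\<^sub>C real) measure" where
  "loop_space \<beta> \<equiv> restrict_space borel (loops \<beta>)"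

lemma of_unit_loops: "\<beta> \<noteq> 0 \<Longrightarrow> of_unit \<beta> u \<in> loops \<beta>"
  unfolding of_unit_def by (intro rescale_loops' Rep_unit_loop)

lemma of_to_unit: "\<beta> \<noteq> 0 \<Longrightarrow> f \<in> loops \<beta> \<Longrightarrow> of_unit \<beta> (to_unit \<beta> f) = f"
  by (simp add: of_unit_def to_unit_def Abs_unit_loop_inverse rescale_loops rescale_inverse)

lemma continuous_of_unit: "continuous_on UNIV (of_unit \<beta>)"
proof (unfold continuous_on_iff, intro ballI allI impI)
  fix u and e :: real assume "e > 0"
  then show "\<exists>d>0. \<forall>u'\<in>UNIV. dist u' u < d \<longrightarrow> dist (of_unit \<beta> u') (of_unit \<beta> u) < e"
    unfolding dist_unit_loop_def of_unit_def by (intro exI[of _ e]) (auto intro: le_less_trans[OF dist_rescale])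
qed

lemma continuous_to_unit: "\<beta> \<noteq> 0 \<Longrightarrow> continuous_on (loops \<beta>) (to_unit \<beta>)"
proof (unfold continuous_on_iff, intro ballI allI impI)
  fix f and e :: real assume b: "\<beta> \<noteq> 0" and f: "f \<in> loops \<beta>" and "e > 0"
  have "dist (to_unit \<beta> g) (to_unit \<beta> f) \<le> dist g f" if "g \<in> loops \<beta>" for g
    using that f b by (simp add: dist_unit_loop_def to_unit_def Abs_unit_loop_inverse rescale_loops dist_rescale)
  then show "\<exists>d>0. \<forall>g\<in>loops \<beta>. dist g f < d \<longrightarrow> dist (to_unit \<beta> g) (to_unit \<beta> f) < e"
    using \<open>e > 0\<close> by (intro exI[of _ e]) (auto intro: le_less_trans)
qed

lemma to_unit_measurable: "\<beta> \<noteq> 0 \<Longrightarrow> to_unit \<beta> \<in> measurable (loop_space \<beta>) borel"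
  by (intro borel_measurable_continuous_on_restrict continuous_to_unit)

lemma of_unit_measurable: "\<beta> \<noteq> 0 \<Longrightarrow> of_unit \<beta> \<in> measurable borel (loop_space \<beta>)"
  by (intro measurable_restrict_space2 borel_measurable_continuous_onI continuous_of_unit) (simp add: of_unit_loops)

lemma space_loop_space [simp]: "space (loop_space \<beta>) = loops \<beta>"
  by (simp add: space_restrict_space)

text \<open>Continuity of the coordinates gives one inclusion. For the other, an open set of the
  ambient product need not be a countable union of cylinders, as the ambient space is not separable.
  Its preimage under \<open>of_unit\<close> is open in a countable product of second countable
  spaces, where Borel sets and product sets agree.\<close>

lemma sets_config_space:
  assumes "\<beta> \<noteq> 0"
  shows "sets (config_space \<beta> :: ('d::finite) config measure) = sets (PiM UNIV (\<lambda>_. loop_space \<beta>))"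
proof
  let ?P = "PiM UNIV (\<lambda>_. loop_space \<beta>) :: 'd config measure"
  have sp: "space ?P = configs \<beta>" "space (config_space \<beta> :: 'd config measure) = configs \<beta>"
    by (auto simp: space_PiM config_space_def space_restrict_space configs_def PiE_def Pi_def)
  have "(\<lambda>\<omega>. \<omega>) \<in> measurable (config_space \<beta>) ?P"
  proof (rule measurable_PiM_single')
    fix k :: "int ^ 'd"
    have "(\<lambda>\<omega>::'d config. \<omega> k) \<in> measurable (config_space \<beta>) borel"
      unfolding config_space_def
      by (intro measurable_restrict_space1 borel_measurable_continuous_onI continuous_on_product_coordinates)
    then show "(\<lambda>\<omega>::'d config. \<omega> k) \<in> measurable (config_space \<beta>) (loop_space \<beta>)"
      by (intro measurable_restrict_space2) (auto simp: sp configs_def)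
  qed (auto simp: sp configs_def)
  then have "A \<in> sets (config_space \<beta>)" if "A \<in> sets ?P" for A
    using measurable_sets[OF _ that, of "\<lambda>\<omega>. \<omega>" "config_space \<beta>"] sets.sets_into_space[OF that]
    by (simp add: sp Int_absorb2)
  then show "sets ?P \<subseteq> sets (config_space \<beta>)" by auto
  have "(\<lambda>\<omega>. \<omega>) \<in> measurable ?P borel"
  proof (rule borel_measurableI)
    fix U :: "'d config set" assume U: "open U"
    define V where "V = (\<lambda>u k. of_unit \<beta> (u k)) -` U"
    have "continuous_on UNIV (\<lambda>(u :: int ^ 'd \<Rightarrow> unit_loop) k. of_unit \<beta> (u k))"
      by (intro continuous_on_coordinatewise_then_product continuous_on_compose2[OF continuous_of_unit]
          continuous_on_product_coordinates) auto
    then have V: "V \<in> sets borel" unfolding V_def using U by (intro borel_open open_vimage)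
    have "(\<lambda>\<omega> k. to_unit \<beta> (\<omega> k)) \<in> borel_measurable ?P"
    proof (rule measurable_coordinatewise_then_product)
      fix k :: "int ^ 'd"
      have "(\<lambda>\<omega>. \<omega> k) \<in> measurable ?P (loop_space \<beta>)" by (rule measurable_component_singleton) simp
      then show "(\<lambda>\<omega>. to_unit \<beta> (\<omega> k)) \<in> borel_measurable ?P"
        by (rule measurable_compose[OF _ to_unit_measurable[OF assms]])
    qed
    then have "(\<lambda>\<omega> k. to_unit \<beta> (\<omega> k)) -` V \<inter> space ?P \<in> sets ?P" using V by (rule measurable_sets)
    also have "(\<lambda>\<omega> k. to_unit \<beta> (\<omega> k)) -` V \<inter> space ?P = (\<lambda>\<omega>. \<omega>) -` U \<inter> space ?P"
      unfolding sp by (auto simp: V_def configs_def of_to_unit assms)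
    finally show "(\<lambda>\<omega>. \<omega>) -` U \<inter> space ?P \<in> sets ?P" .
  qed
  then have m: "(\<lambda>\<omega>. \<omega>) \<in> measurable ?P (config_space \<beta>)"
    unfolding config_space_def by (intro measurable_restrict_space2) (auto simp: sp)
  have "A \<in> sets ?P" if A: "A \<in> sets (config_space \<beta>)" for A
    using measurable_sets[OF m A] sets.sets_into_space[OF A] by (simp add: sp Int_absorb2)
  then show "sets (config_space \<beta>) \<subseteq> sets ?P" by auto
qed

section \<open>The Gaussian measure on loops\<close>

text \<open>Absolute continuity on \<open>{0..b}\<close> with density \<open>f\<close>. One notion
  serves the Schauder functions, whose densities jump, and \<open>\<psi>'\<close>, whose density is
  merely square integrable.\<close>

definition primitive_on :: "real \<Rightarrow> (real \<Rightarrow> real) \<Rightarrow> (real \<Rightarrow> real) \<Rightarrow> bool" where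
  "primitive_on b F f \<longleftrightarrow> set_integrable lborel {0..b} f \<and>
     (\<forall>t\<in>{0..b}. F t = F 0 + (LINT u:{0..t}|lborel. f u))"

lemma primitive_onD:
  assumes "primitive_on b F f"
  shows "t \<in> {0..b} \<Longrightarrow> (LINT u:{0..t}|lborel. f u) = F t - F 0"
    and "t \<in> {0..b} \<Longrightarrow> set_integrable lborel {0..t} f"
    and "set_integrable lborel {0..b} f"
proof -
  show i: "set_integrable lborel {0..b} f" using assms by (simp only: primitive_on_def)
  assume t: "t \<in> {0..b}"
  then show "set_integrable lborel {0..t} f" by (intro set_integrable_subset[OF i]) auto
  have "F t = F 0 + (LINT u:{0..t}|lborel. f u)" using assms t unfolding primitive_on_def by blast
  then show "(LINT u:{0..t}|lborel. f u) = F t - F 0" by linarith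
qed

lemma set_integrable_continuous:
  fixes f :: "real \<Rightarrow> real"
  shows "continuous_on {a..b} f \<Longrightarrow> set_integrable lborel {a..b} f"
  unfolding set_integrable_def by (rule borel_integrable_compact) auto

lemma primitive_on_continuous:
  assumes "primitive_on b F f"
  shows "continuous_on {0..b} F"
proof -
  have "f integrable_on {0..b}"
    by (rule set_borel_integral_eq_integral(1)[OF primitive_onD(3)[OF assms]])
  then have "continuous_on {0..b} (\<lambda>t. F 0 + integral {0..t} f)"
    by (intro continuous_intros indefinite_integral_continuous_1)
  moreover have "F 0 + integral {0..t} f = F t" if "t \<in> {0..b}" for t
    using set_borel_integral_eq_integral(2)[OF primitive_onD(2)[OF assms that]] primitive_onD(1)[OF assms that] by simp
  ultimately show ?thesis by (rule continuous_on_eq)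
qed

lemma primitive_on_deriv:
  assumes "\<And>t. t \<in> {0..b} \<Longrightarrow> (F has_real_derivative f t) (at t within {0..b})" "continuous_on {0..b} f"
  shows "primitive_on b F f"
proof -
  have i: "set_integrable lborel {0..t} f" if "t \<in> {0..b}" for t
    using that by (intro set_integrable_continuous continuous_on_subset[OF assms(2)]) auto
  have "F t = F 0 + (LINT u:{0..t}|lborel. f u)" if t: "t \<in> {0..b}" for t
  proof -
    have "(f has_integral F t - F 0) {0..t}"
    proof (rule fundamental_theorem_of_calculus)
      fix x assume "x \<in> {0..t}"
      then show "(F has_vector_derivative f x) (at x within {0..t})"
        using assms(1)[of x] t unfolding has_real_derivative_iff_has_vector_derivative
        by (auto elim!: has_vector_derivative_within_subset)
    qed (use t in auto)
    then show ?thesis using set_borel_integral_eq_integral(2)[OF i[OF t]] by (simp add: integral_unique)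
  qed
  moreover have "set_integrable lborel {0..b} f" by (rule set_integrable_continuous[OF assms(2)])
  ultimately show ?thesis unfolding primitive_on_def by blast
qed

lemma primitive_on_add:
  assumes "primitive_on b F f" "primitive_on b G g"
  shows "primitive_on b (\<lambda>t. F t + G t) (\<lambda>t. f t + g t)"
proof -
  have "F t + G t = F 0 + G 0 + (LINT u:{0..t}|lborel. f u + g u)" if t: "t \<in> {0..b}" for t
    using primitive_onD(1,2)[OF assms(1) t] primitive_onD(1,2)[OF assms(2) t] by simp
  moreover have "set_integrable lborel {0..b} (\<lambda>t. f t + g t)"
    using primitive_onD(3)[OF assms(1)] primitive_onD(3)[OF assms(2)] by simp
  ultimately show ?thesis unfolding primitive_on_def by blast
qed

lemma set_integrable_mult_bounded:
  fixes f g :: "real \<Rightarrow> real"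
  assumes "set_integrable lborel {0..b} f" "continuous_on {0..b} g"
  shows "set_integrable lborel {0..b} (\<lambda>t. f t * g t)"
proof -
  have "bounded (g ` {0..b})" by (intro compact_imp_bounded compact_continuous_image assms) simp
  then obtain C where "\<forall>t\<in>{0..b}. \<bar>g t\<bar> \<le> C" by (auto simp: bounded_iff)
  then have C: "\<bar>g t\<bar> \<le> C" if "t \<in> {0..b}" for t using that by blast
  have m1 [measurable]: "(\<lambda>t. indicator {0..b} t * f t) \<in> borel_measurable lborel"
    using assms(1) by (auto simp: set_integrable_def)
  have m2 [measurable]: "(\<lambda>t. indicator {0..b} t * g t) \<in> borel_measurable lborel"
    using set_integrable_continuous[OF assms(2)] by (auto simp: set_integrable_def)
  have eq: "(\<lambda>t. indicator {0..b} t * (f t * g t)) = (\<lambda>t. (indicator {0..b} t * f t) * (indicator {0..b} t * g t))"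
    by (auto simp: indicator_def fun_eq_iff)
  have "integrable lborel (\<lambda>t. indicator {0..b} t * (f t * g t))"
  proof (rule Bochner_Integration.integrable_bound)
    show "integrable lborel (\<lambda>t. C * (indicator {0..b} t * f t))"
      using assms(1) by (auto simp: set_integrable_def)
    show "(\<lambda>t. indicator {0..b} t * (f t * g t)) \<in> borel_measurable lborel" unfolding eq by measurable
    have "\<bar>f t * g t\<bar> \<le> \<bar>C * f t\<bar>" if "t \<in> {0..b}" for t
    proof -
      have "\<bar>f t\<bar> * \<bar>g t\<bar> \<le> \<bar>f t\<bar> * C" using C[OF that] by (intro mult_left_mono) auto
      also have "\<dots> \<le> \<bar>C * f t\<bar>" by (simp add: abs_mult mult.commute mult_right_mono)
      finally show ?thesis by (simp add: abs_mult)
    qed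
    then show "AE t in lborel. norm (indicator {0..b} t * (f t * g t)) \<le> norm (C * (indicator {0..b} t * f t))"
      by (auto simp: indicator_def)
  qed
  then show ?thesis by (simp add: set_integrable_def)
qed

text \<open>Fubini for \<open>g x * e y\<close> on the triangle \<open>y \<le> x\<close>:
  integrating out \<open>y\<close> leaves \<open>g * (E - E 0)\<close>, integrating out
  \<open>x\<close> leaves \<open>(G b - G) * e\<close>.\<close>

lemma integration_by_parts_primitive:
  assumes b: "0 \<le> b" and G: "primitive_on b G g" and E: "primitive_on b E e"
  shows "(LINT u:{0..b}|lborel. g u * E u) + (LINT u:{0..b}|lborel. G u * e u) = G b * E b - G 0 * E 0"
proof -
  define g' where "g' u = indicator {0..b} u * g u" for u
  define e' where "e' u = indicator {0..b} u * e u" for u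
  have ig: "integrable lborel g'" and ie: "integrable lborel e'"
    using primitive_onD(3)[OF G] primitive_onD(3)[OF E] by (simp_all add: set_integrable_def g'_def[abs_def] e'_def[abs_def])
  have [measurable]: "g' \<in> borel_measurable borel" "e' \<in> borel_measurable borel" using ig ie by auto
  define k where "k x y = g' x * e' y * indicator {y. y \<le> x} y" for x y :: real
  have km [measurable]: "(\<lambda>(x, y). k x y) \<in> borel_measurable (lborel \<Otimes>\<^sub>M lborel)"
    unfolding k_def by measurable
  have ie': "integrable lborel (\<lambda>y. k x y)" for x
  proof (rule Bochner_Integration.integrable_bound)
    show "integrable lborel (\<lambda>y. g' x * e' y)" using ie by simp
    show "AE y in lborel. norm (k x y) \<le> norm (g' x * e' y)" by (auto simp: k_def indicator_def)
  qed (auto simp: k_def)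
  have int: "integrable (lborel \<Otimes>\<^sub>M lborel) (\<lambda>(x, y). k x y)"
  proof (rule lborel_pair.Fubini_integrable)
    show "integrable lborel (\<lambda>x. \<integral>y. norm (case (x, y) of (x, y) \<Rightarrow> k x y) \<partial>lborel)"
    proof (rule Bochner_Integration.integrable_bound)
      show "integrable lborel (\<lambda>x. g' x * (\<integral>y. norm (e' y) \<partial>lborel))" using ig by simp
      show "AE x in lborel. norm (\<integral>y. norm (case (x, y) of (x, y) \<Rightarrow> k x y) \<partial>lborel) \<le> norm (g' x * (\<integral>y. norm (e' y) \<partial>lborel))"
      proof (rule AE_I2)
        fix x
        have "(\<integral>y. norm (k x y) \<partial>lborel) \<le> (\<integral>y. \<bar>g' x\<bar> * norm (e' y) \<partial>lborel)"
        proof (rule integral_mono)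
          show "integrable lborel (\<lambda>y. norm (k x y))" by (rule integrable_norm[OF ie'])
          show "integrable lborel (\<lambda>y. \<bar>g' x\<bar> * norm (e' y))" using ie by simp
        qed (auto simp: k_def indicator_def abs_mult)
        then show "norm (\<integral>y. norm (case (x, y) of (x, y) \<Rightarrow> k x y) \<partial>lborel) \<le> norm (g' x * (\<integral>y. norm (e' y) \<partial>lborel))"
          by (simp add: abs_mult)
      qed
    qed (use km in measurable)
  qed (use ie' in auto)
  have Gb: "G b = G 0 + (LINT u:{0..b}|lborel. g u)" using primitive_onD(1)[OF G, of b] b by simp
  have in1: "(\<integral>y. k x y \<partial>lborel) = indicator {0..b} x * (g x * E x) - E 0 * g' x" for x
  proof (cases "x \<in> {0..b}")
    case True
    have "(\<integral>y. k x y \<partial>lborel) = (\<integral>y. g' x * (indicator {0..x} y *\<^sub>R e y) \<partial>lborel)"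
      using True by (intro Bochner_Integration.integral_cong) (auto simp: k_def e'_def indicator_def)
    also have "\<dots> = g' x * (LINT u:{0..x}|lborel. e u)" by (simp add: set_lebesgue_integral_def)
    also have "(LINT u:{0..x}|lborel. e u) = E x - E 0" by (rule primitive_onD(1)[OF E True])
    finally show ?thesis using True by (simp add: g'_def algebra_simps)
  qed (simp add: k_def g'_def)
  have in2: "(\<integral>x. k x y \<partial>lborel) = G b * e' y - indicator {0..b} y * (G y * e y)" for y
  proof (cases "y \<in> {0..b}")
    case True
    have ib: "set_integrable lborel {0..b} g" by (rule primitive_onD(3)[OF G])
    then have iy: "set_integrable lborel {0..y} g" "set_integrable lborel {y<..b} g"
      using True by (auto elim: set_integrable_subset)
    have "{0..b} = {0..y} \<union> {y<..b}" using True by auto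
    then have "(LINT u:{0..b}|lborel. g u) = (LINT u:{0..y}|lborel. g u) + (LINT u:{y<..b}|lborel. g u)"
      using set_integral_Un[OF _ iy] by (simp add: disjoint_iff)
    then have s: "(LINT u:{y<..b}|lborel. g u) = G b - G y"
      using primitive_onD(1)[OF G True] Gb by simp
    have "(\<integral>x. k x y \<partial>lborel) = (\<integral>x. e' y * (indicator {y<..b} x *\<^sub>R g x) \<partial>lborel)"
    proof (rule integral_cong_AE)
      have "AE x in lborel. x \<noteq> y" by (rule AE_lborel_singleton)
      then show "AE x in lborel. k x y = e' y * (indicator {y<..b} x *\<^sub>R g x)"
        by (rule eventually_mono) (use True in \<open>auto simp: k_def g'_def indicator_def\<close>)
      show "(\<lambda>x. e' y * (indicator {y<..b} x *\<^sub>R g x)) \<in> borel_measurable lborel"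
        using iy(2) unfolding set_integrable_def by (intro borel_measurable_times borel_measurable_const borel_measurable_integrable)
    qed (simp add: k_def)
    also have "\<dots> = e' y * (G b - G y)" using s by (simp add: set_lebesgue_integral_def)
    finally show ?thesis using True by (simp add: e'_def algebra_simps)
  qed (simp add: k_def e'_def)
  have c1: "set_integrable lborel {0..b} (\<lambda>u. g u * E u)"
    by (intro set_integrable_mult_bounded primitive_onD(3)[OF G] primitive_on_continuous[OF E])
  have "set_integrable lborel {0..b} (\<lambda>u. e u * G u)"
    by (intro set_integrable_mult_bounded primitive_onD(3)[OF E] primitive_on_continuous[OF G])
  then have c2: "set_integrable lborel {0..b} (\<lambda>u. G u * e u)" by (simp add: mult.commute)
  have "(\<integral>x. \<integral>y. k x y \<partial>lborel \<partial>lborel) = (\<integral>y. \<integral>x. k x y \<partial>lborel \<partial>lborel)"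
    using lborel_pair.Fubini_integral[OF int] by simp
  then have "(\<integral>x. indicator {0..b} x * (g x * E x) - E 0 * g' x \<partial>lborel) = (\<integral>y. G b * e' y - indicator {0..b} y * (G y * e y) \<partial>lborel)"
    by (simp only: in1 in2)
  moreover have "(\<integral>x. indicator {0..b} x * (g x * E x) - E 0 * g' x \<partial>lborel) = (LINT u:{0..b}|lborel. g u * E u) - E 0 * (LINT u:{0..b}|lborel. g u)"
    using c1 ig unfolding g'_def[abs_def] set_integrable_def set_lebesgue_integral_def
    by (subst Bochner_Integration.integral_diff) auto
  moreover have "(\<integral>y. G b * e' y - indicator {0..b} y * (G y * e y) \<partial>lborel) = G b * (LINT u:{0..b}|lborel. e u) - (LINT u:{0..b}|lborel. G u * e u)"
    using c2 ie unfolding e'_def[abs_def] set_integrable_def set_lebesgue_integral_def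
    by (subst Bochner_Integration.integral_diff) auto
  moreover have "(LINT u:{0..b}|lborel. e u) = E b - E 0" using b by (intro primitive_onD(1)[OF E]) simp
  ultimately show ?thesis using Gb by (simp add: algebra_simps)
qed

text \<open>Circle integrals run over a half-open period, primitives over closed intervals; the end
  point is a null set.\<close>

lemma integral_half_open:
  fixes f :: "real \<Rightarrow> real"
  shows "(LINT t:{a..<b}|lborel. f t) = (LINT t:{a..b}|lborel. f t)"
  by (rule set_integral_discrete_difference[where X="{b}"]) auto

lemma integrable_half_open:
  fixes f :: "real \<Rightarrow> real"
  shows "set_integrable lborel {a..<b} f \<longleftrightarrow> set_integrable lborel {a..b} f"
  by (rule set_integrable_discrete_difference[where X="{b}"]) auto

section \<open>Periodic extension from one period\<close>

definition periodic_ext :: "real \<Rightarrow> (real \<Rightarrow> real) \<Rightarrow> real \<Rightarrow> real" where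
  "periodic_ext b f t = f (t - b * of_int \<lfloor>t / b\<rfloor>)"

definition loop_of :: "real \<Rightarrow> (real \<Rightarrow> real) \<Rightarrow> (real \<Rightarrow>\<^sub>C real)" where
  "loop_of b f = Bcontfun (periodic_ext b f)"

lemma continuous_periodic_ext:
  assumes b: "b > 0" and f: "continuous_on {0..b} f" "f b = f 0"
  shows "continuous_on UNIV (periodic_ext b f)"
proof -
  have piece: "continuous_on {of_int n * b..of_int (n + 1) * b} (periodic_ext b f)" for n
  proof (rule continuous_on_eq)
    show "continuous_on {of_int n * b..of_int (n + 1) * b} (\<lambda>t. f (t - of_int n * b))"
      by (rule continuous_on_compose2[OF f(1)]) (auto intro!: continuous_intros simp: algebra_simps)
    fix t assume t: "t \<in> {of_int n * b..of_int (n + 1) * b}"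
    show "f (t - of_int n * b) = periodic_ext b f t"
    proof (cases "t = of_int (n + 1) * b")
      case True
      then have "\<lfloor>t / b\<rfloor> = n + 1" using b by simp
      then show ?thesis using True f(2) by (simp add: periodic_ext_def algebra_simps)
    next
      case False
      then have "\<lfloor>t / b\<rfloor> = n" using t b by (intro floor_unique) (auto simp: field_simps)
      then show ?thesis by (simp add: periodic_ext_def mult.commute)
    qed
  qed
  have "isCont (periodic_ext b f) t" for t
  proof -
    define n where "n = \<lfloor>t / b\<rfloor>"
    have n: "of_int n * b \<le> t" "t < of_int (n + 1) * b"
      using b floor_correct[of "t / b"] by (simp_all add: n_def pos_le_divide_eq[symmetric] pos_divide_less_eq[symmetric])
    \<comment> \<open>\<open>t\<close> may be the left end of its period, so the preceding period is
      attached to obtain an open neighbourhood.\<close>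
    have "continuous_on ({of_int (n - 1) * b..of_int n * b} \<union> {of_int n * b..of_int (n + 1) * b}) (periodic_ext b f)"
      using piece[of "n - 1"] piece[of n] by (intro continuous_on_closed_Un) auto
    then have "continuous_on {of_int (n - 1) * b<..<of_int (n + 1) * b} (periodic_ext b f)"
      by (rule continuous_on_subset) auto
    moreover have "t \<in> {of_int (n - 1) * b<..<of_int (n + 1) * b}" using n b by (auto simp: algebra_simps)
    ultimately show ?thesis by (meson continuous_on_eq_continuous_at open_greaterThanLessThan)
  qed
  then show ?thesis by (simp add: continuous_on_eq_continuous_at)
qed

lemma periodic_ext_range:
  assumes "b > 0"
  shows "t - b * of_int \<lfloor>t / b\<rfloor> \<in> {0..<b}"
proof -
  have "of_int \<lfloor>t / b\<rfloor> * b \<le> t" "t < (of_int \<lfloor>t / b\<rfloor> + 1) * b"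
    using assms floor_correct[of "t / b"] by (simp_all add: pos_le_divide_eq[symmetric] pos_divide_less_eq[symmetric])
  then show ?thesis by (simp add: algebra_simps)
qed

lemma apply_loop_of:
  assumes b: "b > 0" and f: "continuous_on {0..b} f" "f b = f 0"
  shows "apply_bcontfun (loop_of b f) t = periodic_ext b f t"
proof -
  have "bounded (f ` {0..b})" by (intro compact_imp_bounded compact_continuous_image f) simp
  then obtain C where "\<forall>t\<in>{0..b}. norm (f t) \<le> C" by (auto simp: bounded_iff)
  then have "norm (periodic_ext b f t) \<le> C" for t
    using periodic_ext_range[OF b, of t] by (auto simp: periodic_ext_def)
  then have "periodic_ext b f \<in> bcontfun"
    by (intro bcontfun_normI continuous_periodic_ext assms)
  then show ?thesis by (simp add: loop_of_def Bcontfun_inverse)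
qed

lemma loop_of_base:
  assumes "b > 0" "continuous_on {0..b} f" "f b = f 0" "t \<in> {0..<b}"
  shows "apply_bcontfun (loop_of b f) t = f t"
proof -
  have "\<lfloor>t / b\<rfloor> = 0" using assms by (intro floor_unique) auto
  then show ?thesis using assms by (simp add: apply_loop_of periodic_ext_def)
qed

lemma loop_of_loops:
  assumes "b > 0" "continuous_on {0..b} f" "f b = f 0"
  shows "loop_of b f \<in> loops b"
proof -
  have "\<lfloor>(t + b) / b\<rfloor> = \<lfloor>t / b\<rfloor> + 1" for t using assms by (simp add: add_divide_distrib)
  then show ?thesis using assms by (simp add: loops_def apply_loop_of periodic_ext_def algebra_simps)
qed

section \<open>The periodic first-order equation\<close>

locale circle =
  fixes \<beta> \<kappa> :: real
  assumes beta: "\<beta> > 0" and kappa: "\<kappa> > 0"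
begin

text \<open>The initial value that makes the solution periodic when \<open>S 0 = 0\<close>, found by
  solving \<open>solve S \<beta> = solve S 0\<close>; the denominator is positive because
  \<open>\<kappa> * \<beta> > 0\<close>.\<close>

definition init :: "(real \<Rightarrow> real) \<Rightarrow> real" where
  "init S = (S \<beta> - \<kappa> * exp (- \<kappa> * \<beta>) * integral {0..\<beta>} (\<lambda>s. exp (\<kappa> * s) * S s)) / (1 - exp (- \<kappa> * \<beta>))"

text \<open>Variation of constants expresses the solution by the integral of
  \<open>exp (\<kappa> * s)\<close> against dS. Integration by parts turns this into
  \<open>S\<close> plus the present function, which makes sense for every continuous
  \<open>S\<close>, differentiable or not.\<close>

definition drift :: "(real \<Rightarrow> real) \<Rightarrow> real \<Rightarrow> real" where
  "drift S t = exp (- \<kappa> * t) * (init S - \<kappa> * integral {0..t} (\<lambda>s. exp (\<kappa> * s) * S s))"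

text \<open>\<open>solve S\<close> is the periodic solution \<open>X\<close> of \<open>X' + \<kappa> * X = S'\<close>.\<close>

definition solve :: "(real \<Rightarrow> real) \<Rightarrow> real \<Rightarrow> real" where
  "solve S t = S t + drift S t"

lemma exp_lt_one: "exp (- \<kappa> * \<beta>) < 1"
  using beta kappa by simp

lemma drift_deriv:
  assumes S: "continuous_on {0..\<beta>} S" and t: "t \<in> {0..\<beta>}"
  shows "(drift S has_real_derivative - \<kappa> * solve S t) (at t within {0..\<beta>})"
proof -
  have "((\<lambda>u. integral {0..u} (\<lambda>s. exp (\<kappa> * s) * S s)) has_real_derivative exp (\<kappa> * t) * S t) (at t within {0..\<beta>})"
    by (rule integral_has_real_derivative) (use t in \<open>auto intro!: continuous_intros S\<close>)
  then have "(drift S has_real_derivative exp (- \<kappa> * t) * (- \<kappa> * (exp (\<kappa> * t) * S t)) + (- \<kappa> * exp (- \<kappa> * t)) * (init S - \<kappa> * integral {0..t} (\<lambda>s. exp (\<kappa> * s) * S s))) (at t within {0..\<beta>})"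
    unfolding drift_def[abs_def] by (auto intro!: derivative_eq_intros simp: algebra_simps)
  moreover have "exp (- \<kappa> * t) * (- \<kappa> * (exp (\<kappa> * t) * S t)) = - \<kappa> * S t"
  proof -
    have "exp (- \<kappa> * t) * exp (\<kappa> * t) = 1" by (simp add: exp_add[symmetric])
    moreover have "exp (- \<kappa> * t) * (- \<kappa> * (exp (\<kappa> * t) * S t)) = - \<kappa> * ((exp (- \<kappa> * t) * exp (\<kappa> * t)) * S t)"
      by (simp only: mult_ac)
    ultimately show ?thesis by (simp only: mult_1)
  qed
  ultimately have "(drift S has_real_derivative - \<kappa> * S t + (- \<kappa> * exp (- \<kappa> * t)) * (init S - \<kappa> * integral {0..t} (\<lambda>s. exp (\<kappa> * s) * S s))) (at t within {0..\<beta>})"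
    by (simp only:)
  also have "- \<kappa> * S t + (- \<kappa> * exp (- \<kappa> * t)) * (init S - \<kappa> * integral {0..t} (\<lambda>s. exp (\<kappa> * s) * S s)) = - \<kappa> * solve S t"
    by (simp add: solve_def drift_def algebra_simps)
  finally show ?thesis .
qed

lemma continuous_solve: "continuous_on {0..\<beta>} S \<Longrightarrow> continuous_on {0..\<beta>} (solve S)"
  unfolding solve_def[abs_def]
  by (intro continuous_on_add DERIV_continuous_on[of _ "drift S" "\<lambda>t. - \<kappa> * solve S t"] drift_deriv)

lemma solve_primitive:
  assumes S: "primitive_on \<beta> S f"
  shows "primitive_on \<beta> (solve S) (\<lambda>t. f t + (- \<kappa> * solve S t))"
proof -
  have c: "continuous_on {0..\<beta>} S" by (rule primitive_on_continuous[OF S])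
  have "primitive_on \<beta> (drift S) (\<lambda>t. - \<kappa> * solve S t)"
    by (rule primitive_on_deriv[OF drift_deriv[OF c]]) (assumption, intro continuous_intros continuous_solve[OF c])
  then show ?thesis unfolding solve_def[of S, abs_def] by (intro primitive_on_add[OF S]) (simp add: solve_def)
qed

lemma solve_periodic:
  assumes "S 0 = 0"
  shows "solve S \<beta> = solve S 0"
proof -
  define I where "I = integral {0..\<beta>} (\<lambda>s. exp (\<kappa> * s) * S s)"
  define q where "q = exp (- \<kappa> * \<beta>)"
  have q: "1 - q > 0" using exp_lt_one by (simp add: q_def)
  have "init S = (S \<beta> - \<kappa> * q * I) / (1 - q)" by (simp only: init_def I_def q_def)
  then have "init S * (1 - q) = S \<beta> - \<kappa> * q * I" using q by simp
  then have "S \<beta> + q * (init S - \<kappa> * I) = init S" by (simp add: algebra_simps)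
  then show ?thesis using assms by (simp add: solve_def drift_def I_def q_def)
qed

text \<open>Stated with point values and the L1 norm of \<open>S\<close> rather than its supremum:
  these can be summed over all modes of one level without loss, since the Schauder functions of a
  level have supports that overlap at end points only.\<close>

lemma solve_bound:
  "\<exists>C\<ge>0. \<forall>S t. continuous_on {0..\<beta>} S \<longrightarrow> t \<in> {0..\<beta>} \<longrightarrow>
     \<bar>solve S t\<bar> \<le> \<bar>S t\<bar> + C * (\<bar>S \<beta>\<bar> + integral {0..\<beta>} (\<lambda>s. \<bar>S s\<bar>))"
proof -
  define K where "K = \<kappa> * exp (\<kappa> * \<beta>)"
  define q where "q = exp (- \<kappa> * \<beta>)"
  have q: "1 - q > 0" "0 \<le> q" "q \<le> 1" using exp_lt_one by (auto simp: q_def)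
  have K: "K \<ge> 0" using kappa by (simp add: K_def)
  \<comment> \<open>\<open>(1 + K) / (1 - q)\<close> comes from \<open>init S\<close>, the further
    \<open>K\<close> from the integral in \<open>drift\<close>.\<close>
  define C where "C = (1 + K) / (1 - q) + K"
  have C: "C \<ge> 0" using K q by (simp add: C_def)
  have "\<bar>solve S t\<bar> \<le> \<bar>S t\<bar> + C * (\<bar>S \<beta>\<bar> + integral {0..\<beta>} (\<lambda>s. \<bar>S s\<bar>))"
    if S: "continuous_on {0..\<beta>} S" and t: "t \<in> {0..\<beta>}" for S t
  proof -
    define A where "A = integral {0..\<beta>} (\<lambda>s. \<bar>S s\<bar>)"
    have Ai: "(\<lambda>s. \<bar>S s\<bar>) integrable_on {0..u}" if "u \<in> {0..\<beta>}" for u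
      using that by (intro integrable_continuous_interval continuous_intros continuous_on_subset[OF S]) auto
    have I: "\<kappa> * \<bar>integral {0..u} (\<lambda>s. exp (\<kappa> * s) * S s)\<bar> \<le> K * A" if u: "u \<in> {0..\<beta>}" for u
    proof -
      have "norm (integral {0..u} (\<lambda>s. exp (\<kappa> * s) * S s)) \<le> integral {0..u} (\<lambda>s. exp (\<kappa> * \<beta>) * \<bar>S s\<bar>)"
      proof (rule integral_norm_bound_integral)
        show "(\<lambda>s. exp (\<kappa> * s) * S s) integrable_on {0..u}"
          using u by (intro integrable_continuous_interval continuous_intros continuous_on_subset[OF S]) auto
        show "(\<lambda>s. exp (\<kappa> * \<beta>) * \<bar>S s\<bar>) integrable_on {0..u}"
          using integrable_on_cmult_left[OF Ai[OF u], of "exp (\<kappa> * \<beta>)"] by simp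
        fix s assume "s \<in> {0..u}"
        then show "norm (exp (\<kappa> * s) * S s) \<le> exp (\<kappa> * \<beta>) * \<bar>S s\<bar>"
          using u kappa by (auto simp: abs_mult intro!: mult_right_mono)
      qed
      also have "\<dots> = exp (\<kappa> * \<beta>) * integral {0..u} (\<lambda>s. \<bar>S s\<bar>)" by simp
      also have "\<dots> \<le> exp (\<kappa> * \<beta>) * A" unfolding A_def
        using u beta by (intro mult_left_mono integral_subset_le Ai) auto
      finally show ?thesis using kappa by (simp add: K_def mult.assoc)
    qed
    have A0: "A \<ge> 0" unfolding A_def by (intro integral_nonneg Ai) (use beta in auto)
    have "\<bar>S \<beta> - \<kappa> * q * integral {0..\<beta>} (\<lambda>s. exp (\<kappa> * s) * S s)\<bar> \<le> \<bar>S \<beta>\<bar> + q * (\<kappa> * \<bar>integral {0..\<beta>} (\<lambda>s. exp (\<kappa> * s) * S s)\<bar>)"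
      using q kappa by (intro order_trans[OF abs_triangle_ineq4]) (simp add: abs_mult)
    also have "\<dots> \<le> \<bar>S \<beta>\<bar> + 1 * (K * A)"
      using I[of \<beta>] beta q(2,3) K A0 kappa
      by (intro add_left_mono mult_mono[where a=q and c="\<kappa> * \<bar>integral {0..\<beta>} (\<lambda>s. exp (\<kappa> * s) * S s)\<bar>"]) simp_all
    finally have "\<bar>init S\<bar> \<le> (\<bar>S \<beta>\<bar> + K * A) / (1 - q)"
      using q unfolding init_def q_def[symmetric] abs_divide by (simp add: divide_right_mono)
    also have "\<dots> \<le> (1 + K) / (1 - q) * (\<bar>S \<beta>\<bar> + A)"
    proof -
      have "\<bar>S \<beta>\<bar> + K * A \<le> (1 + K) * (\<bar>S \<beta>\<bar> + A)" using K A0 by (simp add: algebra_simps)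
      then show ?thesis using q by (simp add: divide_right_mono)
    qed
    finally have i: "\<bar>init S\<bar> \<le> (1 + K) / (1 - q) * (\<bar>S \<beta>\<bar> + A)" .
    have "\<bar>drift S t\<bar> \<le> 1 * (\<bar>init S\<bar> + \<kappa> * \<bar>integral {0..t} (\<lambda>s. exp (\<kappa> * s) * S s)\<bar>)"
      unfolding drift_def abs_mult
      using t kappa by (intro mult_mono order_trans[OF abs_triangle_ineq4]) (auto simp: abs_mult)
    also have "\<dots> \<le> (1 + K) / (1 - q) * (\<bar>S \<beta>\<bar> + A) + K * A" using I[OF t] i by simp
    also have "\<dots> \<le> C * (\<bar>S \<beta>\<bar> + A)" using K A0 by (simp add: C_def algebra_simps)
    finally show ?thesis unfolding solve_def A_def[symmetric] by linarith
  qed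
  then show ?thesis using C by blast
qed

text \<open>The weak form of the factorisation into \<open>- D + \<kappa>\<close> and
  \<open>D + \<kappa>\<close>. One integration by parts moves a derivative from
  \<open>\<psi>'\<close> to \<open>E\<close>; another shows that the cross terms
  \<open>\<kappa> * (\<psi>' * E + \<psi> * e)\<close> integrate to zero by periodicity.\<close>

lemma dirichlet_form:
  assumes \<psi>: "primitive_on \<beta> \<psi> \<psi>'" and \<psi>': "primitive_on \<beta> \<psi>' g" and E: "primitive_on \<beta> E e"
    and per: "\<psi> \<beta> = \<psi> 0" "\<psi>' \<beta> = \<psi>' 0" "E \<beta> = E 0"
  shows "(LINT t:{0..\<beta>}|lborel. (- g t + \<kappa>\<^sup>2 * \<psi> t) * E t) = (LINT t:{0..\<beta>}|lborel. (\<psi>' t + \<kappa> * \<psi> t) * (e t + \<kappa> * E t))"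
proof -
  note cont = primitive_on_continuous[OF \<psi>] primitive_on_continuous[OF \<psi>'] primitive_on_continuous[OF E]
  have i1: "set_integrable lborel {0..\<beta>} (\<lambda>t. g t * E t)"
    by (intro set_integrable_mult_bounded primitive_onD(3)[OF \<psi>'] cont)
  have i2: "set_integrable lborel {0..\<beta>} (\<lambda>t. \<psi>' t * e t)" "set_integrable lborel {0..\<beta>} (\<lambda>t. \<psi> t * e t)"
    using set_integrable_mult_bounded[OF primitive_onD(3)[OF E] cont(2)] set_integrable_mult_bounded[OF primitive_onD(3)[OF E] cont(1)]
    by (simp_all add: mult.commute)
  have i3: "set_integrable lborel {0..\<beta>} (\<lambda>t. \<psi>' t * E t)" "set_integrable lborel {0..\<beta>} (\<lambda>t. \<psi> t * E t)"
    by (intro set_integrable_continuous continuous_intros cont)+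
  have p1: "(LINT t:{0..\<beta>}|lborel. g t * E t) = - (LINT t:{0..\<beta>}|lborel. \<psi>' t * e t)"
    using integration_by_parts_primitive[OF less_imp_le[OF beta] \<psi>' E] per by simp
  have p2: "(LINT t:{0..\<beta>}|lborel. \<psi>' t * E t) = - (LINT t:{0..\<beta>}|lborel. \<psi> t * e t)"
    using integration_by_parts_primitive[OF less_imp_le[OF beta] \<psi> E] per by simp
  have "(LINT t:{0..\<beta>}|lborel. (- g t + \<kappa>\<^sup>2 * \<psi> t) * E t) = (LINT t:{0..\<beta>}|lborel. \<kappa>\<^sup>2 * (\<psi> t * E t) - g t * E t)"
    by (intro set_lebesgue_integral_cong) (auto simp: algebra_simps)
  also have "\<dots> = \<kappa>\<^sup>2 * (LINT t:{0..\<beta>}|lborel. \<psi> t * E t) + (LINT t:{0..\<beta>}|lborel. \<psi>' t * e t)"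
    using i1 i3 p1 by (subst set_integral_diff) auto
  also have "\<dots> = (LINT t:{0..\<beta>}|lborel. (\<psi>' t * e t + \<kappa> * (\<psi>' t * E t)) + (\<kappa> * (\<psi> t * e t) + \<kappa>\<^sup>2 * (\<psi> t * E t)))"
    using i2 i3 p2 by (simp add: set_integral_add)
  also have "\<dots> = (LINT t:{0..\<beta>}|lborel. (\<psi>' t + \<kappa> * \<psi> t) * (e t + \<kappa> * E t))"
    by (intro set_lebesgue_integral_cong) (auto simp: algebra_simps power2_eq_square)
  finally show ?thesis .
qed

section \<open>Haar and Schauder functions\<close>

definition width :: "nat \<Rightarrow> real" where "width n = \<beta> / 2 ^ n"

lemma width_pos: "width n > 0" using beta by (simp add: width_def)

text \<open>
  Level \<open>0\<close> is the constant function; level \<open>l > 0\<close> lives on the dyadic intervals of length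
  \<open>width (l - 1)\<close>. In both cases \<open>j\<close> ranges over \<open>{..<2 ^ (l - 1)}\<close>, by truncated subtraction.
\<close>

definition haar :: "nat \<Rightarrow> nat \<Rightarrow> real \<Rightarrow> real" where
  "haar l j u = (if l = 0 then 1 / sqrt \<beta> else
     (indicator {real j * width (l - 1)..<real j * width (l - 1) + width l} u
      - indicator {real j * width (l - 1) + width l..<real j * width (l - 1) + 2 * width l} u) / sqrt (width (l - 1)))"

text \<open>A primitive of the indicator of \<open>{a..<b}\<close>. The difference of two adjacent
  ramps, as in \<open>schauder\<close>, is a tent over a dyadic interval.\<close>

definition ramp :: "real \<Rightarrow> real \<Rightarrow> real \<Rightarrow> real" where
  "ramp a b t = max 0 (min t b - a)"

definition schauder :: "nat \<Rightarrow> nat \<Rightarrow> real \<Rightarrow> real" where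
  "schauder l j t = (if l = 0 then t / sqrt \<beta> else
     (ramp (real j * width (l - 1)) (real j * width (l - 1) + width l) t
      - ramp (real j * width (l - 1) + width l) (real j * width (l - 1) + 2 * width l) t) / sqrt (width (l - 1)))"

lemma ramp_integral:
  assumes "0 \<le> a" "a \<le> b" "0 \<le> t"
  shows "(LINT u:{0..t}|lborel. indicator {a..<b} u) = ramp a b t"
proof -
  have "(LINT u:{0..t}|lborel. indicator {a..<b} u) = measure lborel ({0..t} \<inter> {a..<b})"
    by (simp add: set_lebesgue_integral_def indicator_inter_arith[symmetric])
  also have "\<dots> = ramp a b t"
  proof (cases "t < b")
    case True
    then have "{0..t} \<inter> {a..<b} = {a..t}" using assms by auto
    then show ?thesis using True by (simp add: ramp_def max_def)
  next
    case False
    then have "{0..t} \<inter> {a..<b} = {a..<b}" using assms by auto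
    then show ?thesis using False assms by (simp add: ramp_def)
  qed
  finally show ?thesis .
qed

lemma ind_integrable: "set_integrable lborel {0..t} (indicator {a..<b} :: real \<Rightarrow> real)"
proof -
  have "integrable lborel (indicator ({0..t} \<inter> {a..<b}) :: real \<Rightarrow> real)"
    by (rule integrable_real_indicator) (auto intro!: emeasure_lborel_Icc_eq[THEN ord_eq_less_trans] 
      le_less_trans[OF emeasure_mono[of _ "{0..t}"]] simp: emeasure_lborel_Icc_eq)
  then show ?thesis by (simp add: set_integrable_def indicator_inter_arith[symmetric])
qed

lemma schauder_primitive: "primitive_on \<beta> (schauder l j) (haar l j)"
proof (cases "l = 0")
  case True
  then have eq: "schauder l j = (\<lambda>t. t / sqrt \<beta>)" "haar l j = (\<lambda>t. 1 / sqrt \<beta>)"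
    by (auto simp: schauder_def haar_def fun_eq_iff)
  show ?thesis unfolding eq by (intro primitive_on_deriv DERIV_cdivide DERIV_ident continuous_intros)
next
  case False
  let ?a = "real j * width (l - 1)"
  have a: "0 \<le> ?a" using width_pos[of "l - 1"] by simp
  have w: "width l > 0" by (rule width_pos)
  have S0: "schauder l j 0 = 0" using False a w by (simp add: schauder_def ramp_def)
  have "schauder l j t = schauder l j 0 + (LINT u:{0..t}|lborel. haar l j u)" if t: "t \<in> {0..\<beta>}" for t
  proof -
    have "(LINT u:{0..t}|lborel. haar l j u) = (ramp ?a (?a + width l) t - ramp (?a + width l) (?a + 2 * width l) t) / sqrt (width (l - 1))"
      using False t a w by (simp add: haar_def set_integral_diff(2)[OF ind_integrable ind_integrable] ramp_integral)
    then show ?thesis using False S0 by (simp add: schauder_def)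
  qed
  moreover have "set_integrable lborel {0..\<beta>} (haar l j)"
  proof -
    have "set_integrable lborel {0..\<beta>} (\<lambda>u. (indicator {?a..<?a + width l} u - indicator {?a + width l..<?a + 2 * width l} u) / sqrt (width (l - 1)))"
      by (intro set_integrable_divide set_integral_diff(1) ind_integrable)
    then show ?thesis using False by (simp add: haar_def[abs_def])
  qed
  ultimately show ?thesis unfolding primitive_on_def by blast
qed

lemma schauder_zero: "schauder l j 0 = 0"
proof -
  have "0 \<le> real j * width (l - 1)" "width l > 0" using width_pos[of "l - 1"] width_pos[of l] by auto
  then show ?thesis by (simp add: schauder_def ramp_def)
qed

text \<open>For \<open>l > 0\<close> at most one tent of the level is nonzero at time
  \<open>t\<close>, and the crude height bound \<open>h / sqrt h\<close> is
  \<open>sqrt (2 * width l)\<close>, as \<open>h = 2 * width l\<close>. So the sum decays like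
  \<open>2^(-l/2)\<close> despite its \<open>2^(l-1)\<close> terms.\<close>

lemma schauder_sum:
  assumes t: "t \<in> {0..\<beta>}"
  shows "(\<Sum>j<2 ^ (l - 1). \<bar>schauder l j t\<bar>) \<le> sqrt (2 * width l)"
proof (cases l)
  case 0
  have "t / sqrt \<beta> \<le> sqrt \<beta>" using t beta by (simp add: divide_le_eq)
  also have "\<dots> \<le> sqrt (2 * \<beta>)" using beta by simp
  finally show ?thesis using 0 t beta by (simp add: schauder_def width_def lessThan_Suc)
next
  case (Suc n)
  define h where "h = width n"
  have h: "h > 0" "width l = h / 2" using width_pos[of n] by (auto simp: h_def width_def Suc)
  define j0 where "j0 = nat \<lfloor>t / h\<rfloor>"
  have each: "\<bar>schauder l j t\<bar> \<le> (if j = j0 then sqrt h else 0)" for j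
  proof -
    let ?a = "real j * h"
    have S: "schauder l j t = (ramp ?a (?a + h / 2) t - ramp (?a + h / 2) (?a + h) t) / sqrt h"
    proof -
      have "l \<noteq> 0" "l - 1 = n" using Suc by auto
      then show ?thesis by (simp add: schauder_def h(2) h_def[symmetric])
    qed
    show ?thesis
    proof (cases "?a < t \<and> t < ?a + h")
      case True
      then have "\<lfloor>t / h\<rfloor> = int j" using h by (intro floor_unique) (auto simp: field_simps)
      then have "j = j0" by (simp add: j0_def)
      moreover have "\<bar>ramp ?a (?a + h / 2) t - ramp (?a + h / 2) (?a + h) t\<bar> \<le> h"
        using True h by (auto simp: ramp_def max_def min_def abs_le_iff)
      then have "\<bar>schauder l j t\<bar> \<le> h / sqrt h" unfolding S using h by (simp add: abs_divide divide_right_mono)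
      ultimately show ?thesis using h by (simp add: real_div_sqrt)
    next
      case False
      then have "ramp ?a (?a + h / 2) t - ramp (?a + h / 2) (?a + h) t = 0"
        using h by (auto simp: ramp_def max_def min_def)
      then show ?thesis unfolding S using h by simp
    qed
  qed
  have "(\<Sum>j<2 ^ (l - 1). \<bar>schauder l j t\<bar>) \<le> (\<Sum>j<2 ^ (l - 1). if j = j0 then sqrt h else 0)"
    by (intro sum_mono each)
  also have "\<dots> \<le> sqrt h" using h by (simp add: sum.delta)
  also have "sqrt h = sqrt (2 * width l)" unfolding h(2) by simp
  finally show ?thesis .
qed

end

section \<open>Parseval's identity for Haar coefficients\<close>

lemma sum_pairs: "(\<Sum>i<2 * n. f i) = (\<Sum>j<n. f (2 * j) + f (Suc (2 * j)) :: real)"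
  by (induction n) (auto simp: algebra_simps)

text \<open>The difference equals the integral of \<open>(h - x)^2\<close> with \<open>x\<close> the
  mean of \<open>h\<close>, and \<open>h\<close> stays within \<open>e\<close> of its mean.\<close>

lemma interval_variance:
  fixes h :: "real \<Rightarrow> real"
  assumes cd: "c < d" and h: "continuous_on {c..d} h"
    and osc: "\<And>s t. s \<in> {c..d} \<Longrightarrow> t \<in> {c..d} \<Longrightarrow> \<bar>h s - h t\<bar> \<le> e"
  shows "\<bar>(LINT t:{c..d}|lborel. (h t)\<^sup>2) - (LINT t:{c..d}|lborel. h t)\<^sup>2 / (d - c)\<bar> \<le> e\<^sup>2 * (d - c)"
proof -
  define w where "w = d - c"
  have w: "w > 0" using cd by (simp add: w_def)
  define a where "a = (LINT t:{c..d}|lborel. h t)"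
  define x where "x = a / w"
  have i: "set_integrable lborel {c..d} h" "set_integrable lborel {c..d} (\<lambda>t. (h t)\<^sup>2)"
    "set_integrable lborel {c..d} (\<lambda>t. (h t - x)\<^sup>2)" for x
    by (intro set_integrable_continuous continuous_intros h)+
  have k: "set_integrable lborel {c..d} (\<lambda>_. z)" "(LINT t:{c..d}|lborel. z) = z * w" for z :: real
    using cd by (auto intro!: set_integrable_continuous simp: set_integral_const w_def)
  have near: "\<bar>h t - x\<bar> \<le> e" if t: "t \<in> {c..d}" for t
  proof -
    have "a \<le> (LINT s:{c..d}|lborel. h t + e)" unfolding a_def
      using osc t by (intro set_integral_mono i k) (fastforce simp: abs_le_iff)
    moreover have "(LINT s:{c..d}|lborel. h t - e) \<le> a" unfolding a_def
      using osc t by (intro set_integral_mono i k) (fastforce simp: abs_le_iff)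
    ultimately have "a \<le> (h t + e) * w" "(h t - e) * w \<le> a" by (simp_all add: k)
    then have "x \<le> h t + e" "h t - e \<le> x" using w by (simp_all add: x_def pos_divide_le_eq pos_le_divide_eq)
    then show ?thesis by (simp add: abs_le_iff)
  qed
  have "(LINT t:{c..d}|lborel. (h t - x)\<^sup>2) = (LINT t:{c..d}|lborel. ((h t)\<^sup>2 + x\<^sup>2) - (2 * x) * h t)"
    by (intro set_lebesgue_integral_cong) (auto simp: power2_diff)
  also have "\<dots> = (LINT t:{c..d}|lborel. (h t)\<^sup>2) + x\<^sup>2 * w - 2 * x * a"
    using i k by (simp add: a_def)
  also have "\<dots> = (LINT t:{c..d}|lborel. (h t)\<^sup>2) - a\<^sup>2 / w"
    using w by (simp add: x_def power2_eq_square field_simps)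
  finally have eq: "(LINT t:{c..d}|lborel. (h t)\<^sup>2) - a\<^sup>2 / w = (LINT t:{c..d}|lborel. (h t - x)\<^sup>2)" by simp
  have "(h t - x)\<^sup>2 \<le> e\<^sup>2" if "t \<in> {c..d}" for t
    using near[OF that] by (simp add: power2_le_iff_abs_le[OF order_trans[OF abs_ge_zero]])
  then have "(LINT t:{c..d}|lborel. (h t - x)\<^sup>2) \<le> (LINT t:{c..d}|lborel. e\<^sup>2)"
    by (intro set_integral_mono i k)
  moreover have "0 \<le> (LINT t:{c..d}|lborel. (h t - x)\<^sup>2)"
    unfolding set_lebesgue_integral_def by (intro integral_nonneg_AE AE_I2) (auto simp: indicator_def)
  ultimately show ?thesis using eq by (simp add: k w_def[symmetric] a_def[symmetric])
qed

context circle
begin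

definition coef :: "(real \<Rightarrow> real) \<Rightarrow> nat \<Rightarrow> nat \<Rightarrow> real" where
  "coef h l j = (LINT t:{0..\<beta>}|lborel. h t * haar l j t)"

definition cell :: "(real \<Rightarrow> real) \<Rightarrow> nat \<Rightarrow> nat \<Rightarrow> real" where
  "cell h n j = (LINT t:{real j * width n..<real (Suc j) * width n}|lborel. h t)"

text \<open>The squared L2 norm of the step function that averages \<open>h\<close> over the dyadic
  cells of generation \<open>n\<close>.\<close>

definition energy_upto :: "(real \<Rightarrow> real) \<Rightarrow> nat \<Rightarrow> real" where
  "energy_upto h n = (\<Sum>j<2 ^ n. (cell h n j)\<^sup>2 / width n)"

lemma width_half: "width (Suc n) = width n / 2"
  by (simp add: width_def)

lemma cell_bounds:
  assumes "j < 2 ^ n"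
  shows "0 \<le> real j * width n" "real (Suc j) * width n \<le> \<beta>" "real j * width n < real (Suc j) * width n"
proof -
  show "0 \<le> real j * width n" "real j * width n < real (Suc j) * width n" using width_pos[of n] by simp_all
  have "real (Suc j) \<le> 2 ^ n" using assms by (metis Suc_leI of_nat_le_iff of_nat_numeral of_nat_power)
  then have "real (Suc j) * width n \<le> 2 ^ n * width n" using width_pos[of n] by (intro mult_right_mono) auto
  then show "real (Suc j) * width n \<le> \<beta>" by (simp add: width_def)
qed

lemma cell_subset:
  assumes "j < 2 ^ n"
  shows "{real j * width n..real (Suc j) * width n} \<subseteq> {0..\<beta>}" "{real j * width n..<real (Suc j) * width n} \<subseteq> {0..\<beta>}"
  using cell_bounds[OF assms] by (auto simp del: of_nat_Suc)

context
  fixes h :: "real \<Rightarrow> real"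
  assumes h: "continuous_on {0..\<beta>} h"
begin

lemma h_integrable: "A \<in> sets borel \<Longrightarrow> A \<subseteq> {0..\<beta>} \<Longrightarrow> set_integrable lborel A h"
  by (rule set_integrable_subset[OF set_integrable_continuous[OF h]]) auto

lemma cell_split:
  assumes "j < 2 ^ n"
  shows "cell h n j = cell h (Suc n) (2 * j) + cell h (Suc n) (Suc (2 * j))"
proof -
  let ?A = "{real (2 * j) * width (Suc n)..<real (Suc (2 * j)) * width (Suc n)}"
  let ?B = "{real (Suc (2 * j)) * width (Suc n)..<real (Suc (Suc (2 * j))) * width (Suc n)}"
  have eq: "{real j * width n..<real (Suc j) * width n} = ?A \<union> ?B"
    using width_pos[of n] by (auto simp: width_half field_simps)
  have sub: "{real j * width n..<real (Suc j) * width n} \<subseteq> {0..\<beta>}"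
    by (rule cell_subset(2)[OF assms])
  show ?thesis unfolding cell_def eq
    using sub unfolding eq by (intro set_integral_Un h_integrable) auto
qed

lemma coef_eq:
  assumes "j < 2 ^ n"
  shows "coef h (Suc n) j = (cell h (Suc n) (2 * j) - cell h (Suc n) (Suc (2 * j))) / sqrt (width n)"
proof -
  let ?A = "{real (2 * j) * width (Suc n)..<real (Suc (2 * j)) * width (Suc n)}"
  let ?B = "{real (Suc (2 * j)) * width (Suc n)..<real (Suc (Suc (2 * j))) * width (Suc n)}"
  have "{real j * width n..<real (Suc j) * width n} = ?A \<union> ?B"
    using width_pos[of n] by (auto simp: width_half field_simps)
  then have sub: "?A \<subseteq> {0..\<beta>}" "?B \<subseteq> {0..\<beta>}"
    using cell_subset(2)[OF assms] by blast+
  have hr: "haar (Suc n) j u = (indicator ?A u - indicator ?B u) / sqrt (width n)" for u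
    by (simp add: haar_def width_half algebra_simps)
  have ind: "set_integrable lborel {0..\<beta>} (\<lambda>t. h t * indicator A t)" "(LINT t:{0..\<beta>}|lborel. h t * indicator A t) = (LINT t:A|lborel. h t)"
    if "A \<subseteq> {0..\<beta>}" "A \<in> sets borel" for A
  proof -
    have *: "indicator {0..\<beta>} t *\<^sub>R (h t * indicator A t) = indicator A t *\<^sub>R h t" for t
      using that by (auto simp: indicator_def)
    show "set_integrable lborel {0..\<beta>} (\<lambda>t. h t * indicator A t)" "(LINT t:{0..\<beta>}|lborel. h t * indicator A t) = (LINT t:A|lborel. h t)"
      using h_integrable[OF that(2,1)] unfolding set_integrable_def set_lebesgue_integral_def * by auto
  qed
  have "coef h (Suc n) j = (LINT t:{0..\<beta>}|lborel. (h t * indicator ?A t - h t * indicator ?B t) / sqrt (width n))"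
    unfolding coef_def hr by (intro set_lebesgue_integral_cong) (auto simp: algebra_simps)
  also have "\<dots> = ((LINT t:?A|lborel. h t) - (LINT t:?B|lborel. h t)) / sqrt (width n)"
    using ind[OF sub(1)] ind[OF sub(2)] by simp
  finally show ?thesis by (simp only: cell_def)
qed

text \<open>The parallelogram identity on each cell: the sum and the difference of the two half-cell
  integrals are \<open>cell h n j\<close> and \<open>sqrt (width n) * coef h (Suc n) j\<close>.
  Telescoping then takes the place of an orthogonality argument.\<close>

lemma energy_upto_Suc: "energy_upto h (Suc n) = energy_upto h n + (\<Sum>j<2 ^ n. (coef h (Suc n) j)\<^sup>2)"
proof -
  have "energy_upto h (Suc n) = (\<Sum>j<2 ^ n. (cell h (Suc n) (2 * j))\<^sup>2 / width (Suc n) + (cell h (Suc n) (Suc (2 * j)))\<^sup>2 / width (Suc n))"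
    unfolding energy_upto_def power_Suc by (rule sum_pairs)
  also have "\<dots> = (\<Sum>j<2 ^ n. (cell h n j)\<^sup>2 / width n + (coef h (Suc n) j)\<^sup>2)"
  proof (intro sum.cong refl)
    fix j :: nat assume "j \<in> {..<2 ^ n}"
    then have j: "j < 2 ^ n" by simp
    have w: "width n > 0" by (rule width_pos)
    have *: "x\<^sup>2 / (w / 2) + y\<^sup>2 / (w / 2) = (x + y)\<^sup>2 / w + ((x - y) / sqrt w)\<^sup>2" if "w > 0" for x y w :: real
      using that by (simp add: power_divide power2_sum power2_diff add_divide_distrib[symmetric])
    show "(cell h (Suc n) (2 * j))\<^sup>2 / width (Suc n) + (cell h (Suc n) (Suc (2 * j)))\<^sup>2 / width (Suc n) = (cell h n j)\<^sup>2 / width n + (coef h (Suc n) j)\<^sup>2"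
      unfolding cell_split[OF j] coef_eq[OF j] width_half by (rule *[OF w])
  qed
  also have "\<dots> = energy_upto h n + (\<Sum>j<2 ^ n. (coef h (Suc n) j)\<^sup>2)"
    by (simp add: sum.distrib energy_upto_def)
  finally show ?thesis .
qed

lemma energy_upto_eq: "energy_upto h n = (\<Sum>l\<le>n. \<Sum>j<2 ^ (l - 1). (coef h l j)\<^sup>2)"
proof (induction n)
  case 0
  have "coef h 0 0 = cell h 0 0 / sqrt \<beta>"
    by (simp add: coef_def cell_def haar_def width_def integral_half_open)
  then show ?case using beta by (simp add: energy_upto_def width_def power_divide lessThan_Suc)
next
  case (Suc n)
  then show ?case by (simp add: energy_upto_Suc)
qed

lemma cells_integral:
  assumes f: "continuous_on {0..\<beta>} f" and "k \<le> 2 ^ n"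
  shows "(LINT t:{0..<real k * width n}|lborel. f t) = (\<Sum>j<k. (LINT t:{real j * width n..<real (Suc j) * width n}|lborel. f t :: real))"
  using assms(2)
proof (induction k)
  case (Suc k)
  have k: "k < 2 ^ n" using Suc.prems by simp
  have eq: "{0..<real (Suc k) * width n} = {0..<real k * width n} \<union> {real k * width n..<real (Suc k) * width n}"
    using cell_bounds[OF k] by (intro ivl_disj_un_two(3)[symmetric]) auto
  have sub: "{0..<real (Suc k) * width n} \<subseteq> {0..\<beta>}"
    using cell_bounds[OF k] by (auto simp del: of_nat_Suc)
  have "(LINT t:{0..<real (Suc k) * width n}|lborel. f t) = (LINT t:{0..<real k * width n}|lborel. f t) + (LINT t:{real k * width n..<real (Suc k) * width n}|lborel. f t)"
    unfolding eq
  proof (rule set_integral_Un)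
    show "set_integrable lborel {0..<real k * width n} f" "set_integrable lborel {real k * width n..<real (Suc k) * width n} f"
      using sub unfolding eq by (auto intro!: set_integrable_subset[OF set_integrable_continuous[OF f]])
  qed auto
  then show ?case using Suc by simp
qed (simp add: set_lebesgue_integral_def)

text \<open>The partial sums are the energies of the cell averages. Once the cells are short enough
  for \<open>h\<close> to oscillate by at most \<open>d\<close>, each cell misses its share of the
  integral by at most \<open>d^2 * width n\<close>, in total
  \<open>d^2 * \<beta> < e\<close>.\<close>

lemma parseval: "(\<lambda>n. \<Sum>l\<le>n. \<Sum>j<2 ^ (l - 1). (coef h l j)\<^sup>2) \<longlonglongrightarrow> (LINT t:{0..\<beta>}|lborel. (h t)\<^sup>2)"
proof (rule tendstoI)
  fix e :: real assume e: "e > 0"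
  define d where "d = sqrt (e / (2 * \<beta>))"
  have d: "d > 0" "d\<^sup>2 * \<beta> < e" using e beta by (auto simp: d_def)
  have "uniformly_continuous_on {0..\<beta>} h" by (rule compact_uniformly_continuous[OF h]) simp
  then obtain r where r: "r > 0" "\<And>s t. s \<in> {0..\<beta>} \<Longrightarrow> t \<in> {0..\<beta>} \<Longrightarrow> dist t s < r \<Longrightarrow> dist (h t) (h s) < d"
    using d unfolding uniformly_continuous_on_def by metis
  have "(\<lambda>n. \<beta> * (1 / 2) ^ n) \<longlonglongrightarrow> \<beta> * 0" by (intro tendsto_intros LIMSEQ_power_zero) simp
  then have "eventually (\<lambda>n. \<beta> * (1 / 2) ^ n < r) sequentially"
    using r by (intro order_tendstoD(2)[of _ "\<beta> * 0"]) auto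
  then show "eventually (\<lambda>n. dist (\<Sum>l\<le>n. \<Sum>j<2 ^ (l - 1). (coef h l j)\<^sup>2) (LINT t:{0..\<beta>}|lborel. (h t)\<^sup>2) < e) sequentially"
  proof eventually_elim
    case (elim n)
    have w: "width n > 0" "width n < r" "2 ^ n * width n = \<beta>"
      using elim width_pos[of n] by (auto simp: width_def power_one_over)
    have h2: "continuous_on {0..\<beta>} (\<lambda>t. (h t)\<^sup>2)" by (intro continuous_intros h)
    let ?I = "\<lambda>j. {real j * width n..real (Suc j) * width n}"
    have "(LINT t:{0..\<beta>}|lborel. (h t)\<^sup>2) = (\<Sum>j<2 ^ n. (LINT t:?I j|lborel. (h t)\<^sup>2))"
      using cells_integral[OF h2, of "2 ^ n" n] w by (simp add: integral_half_open)
    then have "\<bar>energy_upto h n - (LINT t:{0..\<beta>}|lborel. (h t)\<^sup>2)\<bar> = \<bar>\<Sum>j<2 ^ n. (LINT t:?I j|lborel. h t)\<^sup>2 / width n - (LINT t:?I j|lborel. (h t)\<^sup>2)\<bar>"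
      by (simp add: energy_upto_def cell_def integral_half_open sum_subtractf)
    also have "\<dots> \<le> (\<Sum>j<(2::nat) ^ n. d\<^sup>2 * width n)"
    proof (rule order_trans[OF sum_abs sum_mono])
      fix j :: nat assume "j \<in> {..<2 ^ n}"
      then have sub: "?I j \<subseteq> {0..\<beta>}" using cell_subset[of j n] by simp
      have len: "real (Suc j) * width n - real j * width n = width n" by (simp add: algebra_simps)
      have "\<bar>(LINT t:?I j|lborel. (h t)\<^sup>2) - (LINT t:?I j|lborel. h t)\<^sup>2 / (real (Suc j) * width n - real j * width n)\<bar>
          \<le> d\<^sup>2 * (real (Suc j) * width n - real j * width n)"
      proof (rule interval_variance)
        show "continuous_on (?I j) h" by (rule continuous_on_subset[OF h sub])
        show "real j * width n < real (Suc j) * width n" using w by simp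
        fix s t assume st: "s \<in> ?I j" "t \<in> ?I j"
        then have "dist s t \<le> width n" using len by (auto simp: dist_real_def abs_le_iff)
        moreover have "s \<in> {0..\<beta>}" "t \<in> {0..\<beta>}" using st sub by blast+
        ultimately have "dist (h s) (h t) < d" using w by (intro r(2)) auto
        then show "\<bar>h s - h t\<bar> \<le> d" by (simp add: dist_real_def)
      qed
      then show "\<bar>(LINT t:?I j|lborel. h t)\<^sup>2 / width n - (LINT t:?I j|lborel. (h t)\<^sup>2)\<bar> \<le> d\<^sup>2 * width n"
        unfolding len by (simp add: abs_minus_commute)
    qed
    also have "\<dots> = d\<^sup>2 * \<beta>" using w by (simp add: mult.left_commute)
    finally show ?case using d by (simp add: dist_real_def energy_upto_eq)
  qed
qed

end

end

text \<open>Completeness and the norm are already in place; the joint class is what the comparison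
  test for loop-valued series asks for.\<close>

instance bcontfun :: (metric_space, banach) banach ..

lemma apply_bcontfun_sum: "apply_bcontfun (\<Sum>a\<in>A. f a) t = (\<Sum>a\<in>A. apply_bcontfun (f a :: real \<Rightarrow>\<^sub>C real) t)"
  by (induction A rule: infinite_finite_induct) auto

lemma loops_scaleR: "f \<in> loops b \<Longrightarrow> c *\<^sub>R f \<in> loops b"
  by (simp add: loops_iff)

lemma loops_sum: "(\<And>a. a \<in> A \<Longrightarrow> f a \<in> loops b) \<Longrightarrow> (\<Sum>a\<in>A. f a) \<in> loops b"
  by (simp add: loops_iff apply_bcontfun_sum)

section \<open>Pairing loops with integrable functions\<close>

lemma loop_L2_integrable:
  assumes "\<phi> \<in> loop_L2 b"
  shows "set_integrable lborel {0..b} \<phi>"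
proof -
  have m [measurable]: "\<phi> \<in> borel_measurable borel" and i: "set_integrable lborel {0..b} (\<lambda>t. (\<phi> t)\<^sup>2)"
    using assms by (auto simp: loop_L2_def integrable_half_open)
  have "set_integrable lborel {0..b} (\<lambda>t. 1 + (\<phi> t)\<^sup>2)"
    by (rule set_integral_add(1)[OF set_integrable_continuous i]) simp
  then show ?thesis
  proof (rule set_integrable_bound)
    show "set_borel_measurable lborel {0..b} \<phi>" unfolding set_borel_measurable_def by measurable
    have "\<bar>x\<bar> \<le> 1 + x\<^sup>2" for x :: real
    proof -
      have "0 \<le> (\<bar>x\<bar> - 1)\<^sup>2" by simp
      then have "2 * \<bar>x\<bar> \<le> 1 + x\<^sup>2" by (simp add: power2_diff)
      then show ?thesis using abs_ge_zero[of x] by linarith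
    qed
    then show "AE x in lborel. x \<in> {0..b} \<longrightarrow> norm (\<phi> x) \<le> norm (1 + (\<phi> x)\<^sup>2)"
      by (auto simp: abs_of_nonneg add_nonneg_nonneg)
  qed
qed

context
  fixes b :: real and \<phi> :: "real \<Rightarrow> real"
  assumes \<phi>: "set_integrable lborel {0..b} \<phi>"
begin

lemma loop_inner_integrable: "set_integrable lborel {0..b} (\<lambda>t. \<phi> t * apply_bcontfun \<omega> t)"
  by (intro set_integrable_mult_bounded \<phi>) simp

lemma loop_inner_scale: "loop_inner b \<phi> (apply_bcontfun (c *\<^sub>R \<omega>)) = c * loop_inner b \<phi> (apply_bcontfun \<omega>)"
  by (simp add: loop_inner_def mult.left_commute)

lemma loop_inner_sum:
  "finite A \<Longrightarrow> loop_inner b \<phi> (apply_bcontfun (\<Sum>a\<in>A. f a)) = (\<Sum>a\<in>A. loop_inner b \<phi> (apply_bcontfun (f a)))"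
proof (induction A rule: finite_induct)
  case (insert x F)
  then show ?case using loop_inner_integrable
    by (simp add: loop_inner_def integral_half_open distrib_left set_integral_add)
qed (simp add: loop_inner_def)

text \<open>Hoelder's inequality between the L1 norm of \<open>\<phi>\<close> and the sup-norm; the
  pairing is therefore continuous and Borel on loops.\<close>

lemma loop_inner_dist:
  "\<bar>loop_inner b \<phi> (apply_bcontfun \<omega>) - loop_inner b \<phi> (apply_bcontfun \<omega>')\<bar> \<le> (LINT t:{0..b}|lborel. \<bar>\<phi> t\<bar>) * dist \<omega> \<omega>'"
proof -
  have "loop_inner b \<phi> (apply_bcontfun \<omega>) - loop_inner b \<phi> (apply_bcontfun \<omega>') = (LINT t:{0..b}|lborel. \<phi> t * apply_bcontfun \<omega> t - \<phi> t * apply_bcontfun \<omega>' t)"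
    using loop_inner_integrable by (simp add: loop_inner_def integral_half_open)
  also have "\<bar>\<dots>\<bar> \<le> (LINT t:{0..b}|lborel. \<bar>\<phi> t\<bar> * dist \<omega> \<omega>')"
    unfolding set_lebesgue_integral_def real_norm_def[symmetric]
  proof (rule Bochner_Integration.integral_norm_bound_integral)
    show "integrable lborel (\<lambda>t. indicat_real {0..b} t *\<^sub>R (\<phi> t * apply_bcontfun \<omega> t - \<phi> t * apply_bcontfun \<omega>' t))"
      using set_integral_diff(1)[OF loop_inner_integrable loop_inner_integrable] by (simp add: set_integrable_def)
    have "set_integrable lborel {0..b} (\<lambda>t. norm (\<phi> t) * dist \<omega> \<omega>')"
      using set_integrable_abs[OF \<phi>] by simp
    then show "integrable lborel (\<lambda>t. indicat_real {0..b} t *\<^sub>R (norm (\<phi> t) * dist \<omega> \<omega>'))"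
      by (simp add: set_integrable_def)
    fix t
    have "\<bar>\<phi> t * apply_bcontfun \<omega> t - \<phi> t * apply_bcontfun \<omega>' t\<bar> = \<bar>\<phi> t\<bar> * dist (apply_bcontfun \<omega> t) (apply_bcontfun \<omega>' t)"
      by (simp add: right_diff_distrib[symmetric] abs_mult dist_real_def)
    also have "\<dots> \<le> \<bar>\<phi> t\<bar> * dist \<omega> \<omega>'" by (intro mult_left_mono dist_bounded) auto
    finally show "norm (indicat_real {0..b} t *\<^sub>R (\<phi> t * apply_bcontfun \<omega> t - \<phi> t * apply_bcontfun \<omega>' t)) \<le> indicat_real {0..b} t *\<^sub>R (norm (\<phi> t) * dist \<omega> \<omega>')"
      by (simp add: indicator_def)
  qed
  finally show ?thesis by simp
qed

lemma loop_inner_tendsto: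
  assumes "X \<longlonglongrightarrow> \<omega>"
  shows "(\<lambda>n. loop_inner b \<phi> (apply_bcontfun (X n))) \<longlonglongrightarrow> loop_inner b \<phi> (apply_bcontfun \<omega>)"
proof (rule tendsto_dist_iff[THEN iffD2])
  let ?C = "LINT t:{0..b}|lborel. \<bar>\<phi> t\<bar>"
  have "(\<lambda>n. dist (X n) \<omega>) \<longlonglongrightarrow> 0" using assms by (rule tendsto_dist_iff[THEN iffD1])
  then have "(\<lambda>n. ?C * dist (X n) \<omega>) \<longlonglongrightarrow> ?C * 0" by (rule tendsto_mult_left)
  then have lim: "(\<lambda>n. ?C * dist (X n) \<omega>) \<longlonglongrightarrow> 0" by (simp only: mult_zero_right)
  show "(\<lambda>n. dist (loop_inner b \<phi> (apply_bcontfun (X n))) (loop_inner b \<phi> (apply_bcontfun \<omega>))) \<longlonglongrightarrow> 0"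
    by (rule tendsto_sandwich[OF _ _ tendsto_const lim])
      (simp_all only: dist_real_def loop_inner_dist abs_ge_zero eventually_True)
qed

lemma loop_inner_continuous: "continuous_on UNIV (\<lambda>\<omega>. loop_inner b \<phi> (apply_bcontfun \<omega>))"
  unfolding continuous_on_sequentially using loop_inner_tendsto by (auto simp: o_def)

lemma loop_inner_measurable: "(\<lambda>\<omega>. loop_inner b \<phi> (apply_bcontfun \<omega>)) \<in> borel_measurable borel"
  by (rule borel_measurable_continuous_onI[OF loop_inner_continuous])

end

section \<open>The random Haar series\<close>

locale loop_series = circle +
  fixes m :: real
  assumes mass: "m > 0"
begin

text \<open>The image of \<open>haar l j\<close> under the inverse of
  \<open>sqrt m * (D + \<kappa>)\<close> on periodic functions.\<close>

definition mode :: "nat \<Rightarrow> nat \<Rightarrow> (real \<Rightarrow>\<^sub>C real)" where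
  "mode l j = (1 / sqrt m) *\<^sub>R loop_of \<beta> (solve (schauder l j))"

definition level :: "(nat \<times> nat \<Rightarrow> real) \<Rightarrow> nat \<Rightarrow> (real \<Rightarrow>\<^sub>C real)" where
  "level z l = (\<Sum>j<2 ^ (l - 1). z (l, j) *\<^sub>R mode l j)"

lemma continuous_schauder: "continuous_on {0..\<beta>} (schauder l j)"
  by (rule primitive_on_continuous[OF schauder_primitive])

lemma solve_schauder:
  shows continuous_solve_schauder: "continuous_on {0..\<beta>} (solve (schauder l j))"
    and solve_schauder_periodic: "solve (schauder l j) \<beta> = solve (schauder l j) 0"
  by (intro continuous_solve continuous_schauder, intro solve_periodic schauder_zero)

lemma mode_loops: "mode l j \<in> loops \<beta>"
  unfolding mode_def by (intro loops_scaleR loop_of_loops beta solve_schauder)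

lemma level_loops: "level z l \<in> loops \<beta>"
  unfolding level_def by (intro loops_sum loops_scaleR mode_loops)

text \<open>Adding up the norms of the \<open>2 ^ (l - 1)\<close> modes would lose this factor, so
  the sum over \<open>j\<close> is estimated at each time before the supremum is taken.
  \<open>schauder_sum\<close> controls the values at that time and at \<open>\<beta>\<close> and,
  after an exchange of sum and integral, the L1 norms.\<close>

lemma level_bound:
  "\<exists>C\<ge>0. \<forall>z l b. (\<forall>j<2 ^ (l - 1). \<bar>z (l, j)\<bar> \<le> b) \<longrightarrow> norm (level z l) \<le> C * sqrt (width l) * b"
proof -
  obtain C where C: "C \<ge> 0" "\<And>S t. continuous_on {0..\<beta>} S \<Longrightarrow> t \<in> {0..\<beta>} \<Longrightarrow>
     \<bar>solve S t\<bar> \<le> \<bar>S t\<bar> + C * (\<bar>S \<beta>\<bar> + integral {0..\<beta>} (\<lambda>s. \<bar>S s\<bar>))"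
    using solve_bound by blast
  define D where "D = (1 + C * (1 + \<beta>)) * sqrt 2 / sqrt m"
  have D: "D \<ge> 0" using C beta mass by (simp add: D_def)
  have "norm (level z l) \<le> D * sqrt (width l) * b" if z: "\<forall>j<2 ^ (l - 1). \<bar>z (l, j)\<bar> \<le> b" for z l b
  proof (rule norm_bound)
    fix t
    define u where "u = t - \<beta> * of_int \<lfloor>t / \<beta>\<rfloor>"
    have u: "u \<in> {0..\<beta>}" using periodic_ext_range[OF beta, of t] by (auto simp: u_def)
    let ?J = "{..<2 ^ (l - 1) :: nat}"
    let ?S = "\<lambda>j. schauder l j"
    define r where "r = sqrt (2 * width l)"
    have r: "r \<ge> 0" "r = sqrt 2 * sqrt (width l)" using width_pos[of l] by (auto simp: r_def real_sqrt_mult)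
    have b0: "b \<ge> 0" using z[rule_format, of 0] by (simp add: order_trans[OF abs_ge_zero])
    have ap: "apply_bcontfun (mode l j) t = solve (?S j) u / sqrt m" for j
      by (simp add: mode_def apply_loop_of[OF beta solve_schauder] periodic_ext_def u_def)
    have Si: "(\<lambda>s. \<bar>?S j s\<bar>) integrable_on {0..\<beta>}" for j
      by (intro integrable_continuous_interval continuous_intros continuous_schauder)
    have "(\<Sum>j\<in>?J. integral {0..\<beta>} (\<lambda>s. \<bar>?S j s\<bar>)) = integral {0..\<beta>} (\<lambda>s. \<Sum>j\<in>?J. \<bar>?S j s\<bar>)"
      using Si by (intro integral_sum[symmetric]) auto
    also have "\<dots> \<le> integral {0..\<beta>} (\<lambda>s. r)"
      using schauder_sum Si by (intro integral_le integrable_sum) (auto simp: r_def)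
    also have "\<dots> = \<beta> * r" using beta by simp
    finally have int: "(\<Sum>j\<in>?J. integral {0..\<beta>} (\<lambda>s. \<bar>?S j s\<bar>)) \<le> \<beta> * r" .
    have "(\<Sum>j\<in>?J. \<bar>solve (?S j) u\<bar>) \<le> (\<Sum>j\<in>?J. \<bar>?S j u\<bar> + C * (\<bar>?S j \<beta>\<bar> + integral {0..\<beta>} (\<lambda>s. \<bar>?S j s\<bar>)))"
      by (intro sum_mono C continuous_schauder u)
    also have "\<dots> = (\<Sum>j\<in>?J. \<bar>?S j u\<bar>) + C * ((\<Sum>j\<in>?J. \<bar>?S j \<beta>\<bar>) + (\<Sum>j\<in>?J. integral {0..\<beta>} (\<lambda>s. \<bar>?S j s\<bar>)))"
      by (simp add: sum.distrib sum_distrib_left distrib_left)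
    also have "\<dots> \<le> r + C * (r + \<beta> * r)"
      using schauder_sum[OF u, of l] schauder_sum[of \<beta> l] beta int C
      by (intro add_mono mult_left_mono) (auto simp: r_def)
    also have "\<dots> = (1 + C * (1 + \<beta>)) * r" by (simp add: algebra_simps)
    finally have s: "(\<Sum>j\<in>?J. \<bar>solve (?S j) u\<bar>) \<le> (1 + C * (1 + \<beta>)) * r" .
    have "\<bar>apply_bcontfun (level z l) t\<bar> = \<bar>\<Sum>j\<in>?J. z (l, j) * (solve (?S j) u / sqrt m)\<bar>"
      by (simp add: level_def apply_bcontfun_sum ap)
    also have "\<dots> \<le> (\<Sum>j\<in>?J. b * (\<bar>solve (?S j) u\<bar> / sqrt m))"
    proof (rule order_trans[OF sum_abs sum_mono])
      fix j assume "j \<in> ?J"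
      then have "\<bar>z (l, j)\<bar> \<le> b" using z by simp
      then show "\<bar>z (l, j) * (solve (?S j) u / sqrt m)\<bar> \<le> b * (\<bar>solve (?S j) u\<bar> / sqrt m)"
        using mass by (simp add: abs_mult abs_divide mult_right_mono divide_right_mono)
    qed
    also have "\<dots> = b * ((\<Sum>j\<in>?J. \<bar>solve (?S j) u\<bar>) / sqrt m)"
      by (simp add: sum_distrib_left sum_divide_distrib)
    also have "\<dots> \<le> b * ((1 + C * (1 + \<beta>)) * r / sqrt m)"
      using b0 s mass by (intro mult_left_mono divide_right_mono) auto
    also have "\<dots> = D * sqrt (width l) * b" by (simp add: D_def r(2))
    finally show "norm (apply_bcontfun (level z l) t) \<le> D * sqrt (width l) * b" by simp
  qed
  then show ?thesis using D by blast
qed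

text \<open>
  The weights \<open>3 ^ - l\<close> beat the number \<open>2 ^ (l - 1)\<close> of modes, so this sum is almost surely
  finite; then \<open>\<bar>z (l, j)\<bar> \<le> K * 3 ^ (l / 4)\<close>, which still loses against the norm
  \<open>2 ^ (- l / 2)\<close> of the level.
\<close>

definition moment4 :: "(nat \<times> nat \<Rightarrow> real) \<Rightarrow> ennreal" where
  "moment4 z = (\<Sum>l. ennreal ((1 / 3) ^ l) * (\<Sum>j<2 ^ (l - 1). ennreal ((z (l, j)) ^ 4)))"

lemma summable_level:
  assumes "moment4 z < \<infinity>"
  shows "summable (level z)"
proof -
  obtain K where K: "moment4 z = ennreal K" "K \<ge> 0" using assms by (cases "moment4 z") auto
  obtain C where C: "C \<ge> 0" "\<And>l b. \<forall>j<2 ^ (l - 1). \<bar>z (l, j)\<bar> \<le> b \<Longrightarrow> norm (level z l) \<le> C * sqrt (width l) * b"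
    using level_bound by blast
  \<comment> \<open>Growth \<open>root 4 3\<close> of the coefficients per level against decay
    \<open>1 / sqrt 2\<close> from the width; the ratio is below 1 because 3 < 4.\<close>
  define q where "q = root 4 3 / sqrt 2"
  have "(root 4 3) ^ 4 < sqrt 2 ^ 4"
  proof -
    have "sqrt 2 ^ (2 * 2) = ((sqrt 2)\<^sup>2)\<^sup>2" by (rule power_mult)
    then show ?thesis by simp
  qed
  then have "root 4 3 < sqrt 2" by (rule power_less_imp_less_base) simp
  then have q: "0 \<le> q" "q < 1" by (auto simp: q_def)
  have bd: "norm (level z l) \<le> C * sqrt \<beta> * root 4 K * q ^ l" for l
  proof -
    have "\<bar>z (l, j)\<bar> \<le> root 4 (K * 3 ^ l)" if j: "j < 2 ^ (l - 1)" for j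
    proof -
      have "ennreal ((1 / 3) ^ l) * ennreal (z (l, j) ^ 4) \<le> ennreal ((1 / 3) ^ l) * (\<Sum>j<2 ^ (l - 1). ennreal ((z (l, j)) ^ 4))"
        using j by (intro mult_left_mono member_le_sum) auto
      also have "\<dots> \<le> moment4 z" unfolding moment4_def
        by (rule sum_le_suminf[of _ "{l}", simplified]) auto
      finally have "ennreal ((1 / 3) ^ l * z (l, j) ^ 4) \<le> ennreal K" by (simp add: K ennreal_mult)
      then have "(1 / 3) ^ l * z (l, j) ^ 4 \<le> K" using K by simp
      then have "\<bar>z (l, j)\<bar> ^ 4 \<le> K * 3 ^ l" by (simp add: power_one_over field_simps)
      then have "root 4 (\<bar>z (l, j)\<bar> ^ 4) \<le> root 4 (K * 3 ^ l)" by (intro real_root_le_mono) auto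
      then show ?thesis by (subst (asm) real_root_power_cancel) auto
    qed
    then have "norm (level z l) \<le> C * sqrt (width l) * root 4 (K * 3 ^ l)" by (intro C) auto
    also have "\<dots> = C * sqrt \<beta> * root 4 K * q ^ l"
      by (simp add: width_def real_sqrt_divide real_sqrt_power real_root_mult real_root_power q_def power_divide)
    finally show ?thesis .
  qed
  have "summable (\<lambda>l. C * sqrt \<beta> * root 4 K * q ^ l)" using q by (intro summable_mult summable_geometric) simp
  then show ?thesis
    by (rule summable_comparison_test[rotated]) (use bd in auto)
qed

abbreviation noise :: "(nat \<times> nat \<Rightarrow> real) measure" where
  "noise \<equiv> PiM UNIV (\<lambda>_. std_normal_distribution)"

lemma prob_noise: "prob_space noise"
  by (intro prob_space_PiM prob_space_normal_density) simp

lemma sets_noise: "sets noise = sets borel"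
proof -
  have "sets noise = sets (PiM UNIV (\<lambda>_. borel))" by (intro sets_PiM_cong) auto
  then show ?thesis by (simp add: sets_PiM_equal_borel)
qed

lemma noise_component: "(\<integral>\<^sup>+z. f (z i) \<partial>noise) = (\<integral>\<^sup>+x. f x \<partial>std_normal_distribution)"
  if [measurable]: "f \<in> borel_measurable borel"
proof -
  interpret PP: product_prob_space "\<lambda>_::nat \<times> nat. std_normal_distribution" UNIV
    by (intro product_prob_spaceI prob_space_normal_density) simp
  have "(\<integral>\<^sup>+x. f x \<partial>std_normal_distribution) = (\<integral>\<^sup>+x. f x \<partial>distr noise std_normal_distribution (\<lambda>z. z i))"
    using PP.PiM_component[of i] by simp
  also have "\<dots> = (\<integral>\<^sup>+z. f (z i) \<partial>noise)" by (rule nn_integral_distr) auto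
  finally show ?thesis by simp
qed

lemma moment4_measurable [measurable]: "moment4 \<in> borel_measurable noise"
  unfolding moment4_def by measurable

text \<open>With \<open>c\<close> the fourth moment of a standard normal variable, level
  \<open>l\<close> has expectation \<open>2 ^ (l - 1) * c / 3 ^ l\<close>, which is at most
  \<open>c * (2 / 3) ^ l\<close>.\<close>

lemma moment4_finite: "AE z in noise. moment4 z < \<infinity>"
proof -
  define c where "c = (\<integral>\<^sup>+x. ennreal (x ^ 4) \<partial>std_normal_distribution)"
  have "has_bochner_integral lborel (\<lambda>x. std_normal_density x * x ^ (2 * 2)) (fact (2 * 2) / (2 ^ 2 * fact 2))"
    by (rule std_normal_moment_even)
  then have "integrable lborel (\<lambda>x. std_normal_density x * x ^ 4)"
    by (auto simp: has_bochner_integral_iff)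
  then have "(\<integral>\<^sup>+x. ennreal (std_normal_density x * x ^ 4) \<partial>lborel) < \<infinity>"
    by (subst nn_integral_eq_integral) auto
  moreover have "c = (\<integral>\<^sup>+x. ennreal (std_normal_density x * x ^ 4) \<partial>lborel)"
    unfolding c_def by (subst nn_integral_density) (auto simp: ennreal_mult)
  ultimately have "c < \<infinity>" by simp
  then obtain c' where c': "c = ennreal c'" "c' \<ge> 0" by (cases c) auto
  have "(\<integral>\<^sup>+z. moment4 z \<partial>noise) = (\<Sum>l. ennreal ((1 / 3) ^ l) * (\<Sum>j<(2::nat) ^ (l - 1). c))"
    unfolding moment4_def
    by (subst nn_integral_suminf) (auto simp: nn_integral_cmult nn_integral_sum noise_component[of "\<lambda>x. ennreal (x ^ 4)"] c_def simp del: sum_ennreal)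
  also have "\<dots> \<le> (\<Sum>l. ennreal (c' * (2 / 3) ^ l))"
  proof (rule suminf_le)
    fix l :: nat
    have "ennreal ((1 / 3) ^ l) * (\<Sum>j<(2::nat) ^ (l - 1). c) = ennreal ((1 / 3) ^ l * (2 ^ (l - 1) * c'))"
      using c' by (simp add: ennreal_mult ennreal_of_nat_eq_real_of_nat flip: ennreal_power)
    also have "\<dots> \<le> ennreal ((1 / 3) ^ l * (2 ^ l * c'))"
      using c' by (intro ennreal_leI mult_left_mono mult_right_mono power_increasing) auto
    also have "(1 / 3) ^ l * (2 ^ l * c') = c' * (2 / 3) ^ l" by (simp add: power_divide)
    finally show "ennreal ((1 / 3) ^ l) * (\<Sum>j<(2::nat) ^ (l - 1). c) \<le> ennreal (c' * (2 / 3) ^ l)" .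
  qed auto
  also have "\<dots> < \<infinity>"
    using c' by (subst suminf_ennreal2) (auto intro!: summable_mult summable_geometric)
  finally show ?thesis
    using nn_integral_PInf_AE[of moment4 noise] by (auto simp: less_top)
qed

text \<open>The value 0 where \<open>moment4\<close> is infinite makes convergence and membership in
  \<open>loops \<beta>\<close> hold for every \<open>z\<close>, not only almost surely.\<close>

definition partial_sum :: "nat \<Rightarrow> (nat \<times> nat \<Rightarrow> real) \<Rightarrow> (real \<Rightarrow>\<^sub>C real)" where
  "partial_sum n z = (if moment4 z < \<infinity> then \<Sum>l<n. level z l else 0)"

definition random_loop :: "(nat \<times> nat \<Rightarrow> real) \<Rightarrow> (real \<Rightarrow>\<^sub>C real)" where
  "random_loop z = (if moment4 z < \<infinity> then suminf (level z) else 0)"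

lemma partial_sum_tendsto: "(\<lambda>n. partial_sum n z) \<longlonglongrightarrow> random_loop z"
  using summable_LIMSEQ[OF summable_level, of z] by (auto simp: partial_sum_def random_loop_def)

lemma random_loop_loops: "random_loop z \<in> loops \<beta>"
proof (rule closed_sequentially[OF closed_loops _ partial_sum_tendsto])
  show "partial_sum n z \<in> loops \<beta>" for n
    by (simp add: partial_sum_def loops_sum level_loops) (simp add: loops_iff)
qed

lemma partial_sum_measurable: "partial_sum n \<in> borel_measurable noise"
proof -
  have "continuous_on UNIV (\<lambda>z. \<Sum>l<n. level z l)"
    unfolding level_def by (intro continuous_intros continuous_on_product_coordinates)
  then have "(\<lambda>z. \<Sum>l<n. level z l) \<in> borel_measurable borel" by (rule borel_measurable_continuous_onI)
  then have "(\<lambda>z. \<Sum>l<n. level z l) \<in> borel_measurable noise"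
    by (simp add: measurable_cong_sets[OF sets_noise refl])
  moreover have "{z \<in> space noise. moment4 z < \<infinity>} \<in> sets noise" by measurable
  ultimately show ?thesis unfolding partial_sum_def by (intro measurable_If) auto
qed

lemma random_loop_measurable: "random_loop \<in> measurable noise (loop_space \<beta>)"
proof (rule measurable_restrict_space2)
  show "random_loop \<in> borel_measurable noise"
    by (rule borel_measurable_LIMSEQ_metric[OF partial_sum_measurable partial_sum_tendsto])
qed (auto simp: random_loop_loops)

lemma char_finite:
  assumes "finite I"
  shows "(\<integral>z. iexp (\<Sum>i\<in>I. c i * z i) \<partial>noise) = complex_of_real (exp (- (\<Sum>i\<in>I. (c i)\<^sup>2) / 2))"
proof -
  interpret PP: product_prob_space "\<lambda>_::nat \<times> nat. std_normal_distribution" UNIV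
    by (intro product_prob_spaceI prob_space_normal_density) simp
  have fm: "finite_measure std_normal_distribution"
    by (intro prob_space.finite_measure prob_space_normal_density) simp
  have "(\<integral>z. iexp (\<Sum>i\<in>I. c i * z i) \<partial>noise) = (\<integral>z. (\<Prod>i\<in>I. iexp (c i * restrict z I i)) \<partial>noise)"
    using assms by (intro Bochner_Integration.integral_cong) (auto simp: sum_distrib_left exp_sum)
  also have "\<dots> = (\<integral>z. (\<Prod>i\<in>I. iexp (c i * z i)) \<partial>distr noise (PiM I (\<lambda>_. std_normal_distribution)) (\<lambda>z. restrict z I))"
    by (subst integral_distr) (auto intro!: measurable_restrict_subset)
  also have "\<dots> = (\<integral>z. (\<Prod>i\<in>I. iexp (c i * z i)) \<partial>(PiM I (\<lambda>_. std_normal_distribution)))"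
    using assms by (subst PP.distr_PiM_restrict_finite) auto
  also have "\<dots> = (\<Prod>i\<in>I. \<integral>x. iexp (c i * x) \<partial>std_normal_distribution)"
    using assms by (intro PP.product_integral_prod finite_measure.integrable_const_bound[OF fm, where B=1]) auto
  also have "\<dots> = (\<Prod>i\<in>I. complex_of_real (exp (- (c i)\<^sup>2 / 2)))"
    using char_std_normal_distribution by (intro prod.cong refl) (simp add: char_def fun_eq_iff)
  also have "\<dots> = complex_of_real (exp (- (\<Sum>i\<in>I. (c i)\<^sup>2) / 2))"
    using assms by (simp add: exp_sum[symmetric] of_real_prod[symmetric] sum_negf sum_divide_distrib del: of_real_exp)
  finally show ?thesis .
qed

text \<open>On a partial sum the pairing is a finite combination of independent standard normal
  variables, with variance the partial sum in \<open>lim\<close>. The pairing is continuous, so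
  bounded convergence carries the characteristic functional to the limit loop.\<close>

lemma char_random_loop:
  assumes \<phi>: "set_integrable lborel {0..\<beta>} \<phi>"
    and lim: "(\<lambda>n. \<Sum>l<n. \<Sum>j<2 ^ (l - 1). (loop_inner \<beta> \<phi> (apply_bcontfun (mode l j)))\<^sup>2) \<longlonglongrightarrow> s"
  shows "(\<integral>z. iexp (loop_inner \<beta> \<phi> (apply_bcontfun (random_loop z))) \<partial>noise) = complex_of_real (exp (- s / 2))"
proof -
  interpret noise: prob_space noise by (rule prob_noise)
  define F where "F \<omega> = loop_inner \<beta> \<phi> (apply_bcontfun \<omega>)" for \<omega>
  have F: "F \<in> borel_measurable borel" unfolding F_def by (rule loop_inner_measurable[OF \<phi>])
  have Fs: "F (x *\<^sub>R \<omega>) = x * F \<omega>" for x \<omega> unfolding F_def by (rule loop_inner_scale[OF \<phi>])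
  have Fsum: "F (\<Sum>a\<in>A. f a) = (\<Sum>a\<in>A. F (f a))" if "finite A" for A :: "nat set" and f
    unfolding F_def by (rule loop_inner_sum[OF \<phi> that])
  define c where "c i = F (mode (fst i) (snd i))" for i
  define I where "I n = Sigma {..<n} (\<lambda>l. {..<2 ^ (l - 1) :: nat})" for n :: nat
  have fin: "finite (I n)" for n by (simp add: I_def)
  have Fp: "F (partial_sum n z) = (\<Sum>i\<in>I n. c i * z i)" if "moment4 z < \<infinity>" for n z
  proof -
    have "F (partial_sum n z) = (\<Sum>l<n. \<Sum>j<2 ^ (l - 1). z (l, j) * F (mode l j))"
      using that by (simp add: partial_sum_def level_def Fsum Fs)
    also have "\<dots> = (\<Sum>i\<in>I n. c i * z i)"
      unfolding I_def c_def by (subst sum.Sigma) (auto simp: split_def mult.commute)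
    finally show ?thesis .
  qed
  have Sc: "(\<Sum>i\<in>I n. (c i)\<^sup>2) = (\<Sum>l<n. \<Sum>j<2 ^ (l - 1). (F (mode l j))\<^sup>2)" for n
    unfolding I_def c_def by (subst sum.Sigma) (auto simp: split_def)
  have eq: "(\<integral>z. iexp (F (partial_sum n z)) \<partial>noise) = complex_of_real (exp (- (\<Sum>i\<in>I n. (c i)\<^sup>2) / 2))" for n
  proof -
    have "(\<integral>z. iexp (F (partial_sum n z)) \<partial>noise) = (\<integral>z. iexp (\<Sum>i\<in>I n. c i * z i) \<partial>noise)"
    proof (rule integral_cong_AE)
      show "AE z in noise. iexp (F (partial_sum n z)) = iexp (\<Sum>i\<in>I n. c i * z i)"
        using moment4_finite by (rule eventually_mono) (simp add: Fp)
      show "(\<lambda>z. iexp (F (partial_sum n z))) \<in> borel_measurable noise"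
        using measurable_compose[OF partial_sum_measurable F] by measurable
    qed measurable
    also have "\<dots> = complex_of_real (exp (- (\<Sum>i\<in>I n. (c i)\<^sup>2) / 2))" by (rule char_finite[OF fin])
    finally show ?thesis .
  qed
  have "(\<lambda>n. \<integral>z. iexp (F (partial_sum n z)) \<partial>noise) \<longlonglongrightarrow> (\<integral>z. iexp (F (random_loop z)) \<partial>noise)"
  proof (rule integral_dominated_convergence[where w="\<lambda>_. 1"])
    show "(\<lambda>z. iexp (F (random_loop z))) \<in> borel_measurable noise"
      using measurable_compose[OF borel_measurable_LIMSEQ_metric[OF partial_sum_measurable partial_sum_tendsto] F] by measurable
    show "(\<lambda>z. iexp (F (partial_sum n z))) \<in> borel_measurable noise" for n
      using measurable_compose[OF partial_sum_measurable F] by measurable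
    show "AE z in noise. (\<lambda>n. iexp (F (partial_sum n z))) \<longlonglongrightarrow> iexp (F (random_loop z))"
      unfolding F_def by (intro AE_I2 tendsto_intros loop_inner_tendsto[OF \<phi>] partial_sum_tendsto)
  qed auto
  moreover have "(\<lambda>n. \<integral>z. iexp (F (partial_sum n z)) \<partial>noise) \<longlonglongrightarrow> complex_of_real (exp (- s / 2))"
    unfolding eq Sc using lim unfolding F_def[symmetric] by (intro tendsto_intros) auto
  ultimately show ?thesis unfolding F_def[symmetric] by (rule LIMSEQ_unique)
qed

end

section \<open>Identification of the covariance\<close>

context loop_series
begin

context
  fixes a :: real and \<psi> \<phi> :: "real \<Rightarrow> real"
  assumes a: "\<kappa>\<^sup>2 = a\<^sup>2 / m" and op: "loop_operator m a \<beta> \<psi> \<phi>"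
begin

lemma operator_primitives:
  obtains g \<psi>' where "primitive_on \<beta> \<psi> \<psi>'" "primitive_on \<beta> \<psi>' g" "\<psi> \<beta> = \<psi> 0" "\<psi>' \<beta> = \<psi>' 0"
    "\<And>t. \<phi> t = m * (- g t + \<kappa>\<^sup>2 * \<psi> t)"
proof -
  obtain g where g: "loop_laplacian \<beta> \<psi> g" and ph: "\<phi> = (\<lambda>t. - m * g t + a\<^sup>2 * \<psi> t)"
    using op by (auto simp: loop_operator_def)
  from g obtain \<psi>' where per: "\<And>t. \<psi> (t + \<beta>) = \<psi> t" and g2: "g \<in> loop_L2 \<beta>"
    and d: "\<And>t. (\<psi> has_real_derivative \<psi>' t) (at t)"
    and p: "\<And>s t. s \<le> t \<Longrightarrow> \<psi>' t - \<psi>' s = (LINT u:{s..t}|lborel. g u)"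
    unfolding loop_laplacian_def by blast
  have "\<psi>' t = \<psi>' 0 + (LINT u:{0..t}|lborel. g u)" if "t \<in> {0..\<beta>}" for t
    using p[of 0 t] that by (simp add: diff_eq_eq)
  then have p1: "primitive_on \<beta> \<psi>' g"
    unfolding primitive_on_def using loop_L2_integrable[OF g2] by blast
  have p2: "primitive_on \<beta> \<psi> \<psi>'"
    by (rule primitive_on_deriv[OF _ primitive_on_continuous[OF p1]]) (rule has_field_derivative_at_within[OF d])
  \<comment> \<open>Differentiating the periodicity of \<open>\<psi>\<close> at 0 gives the periodic
    boundary values of \<open>\<psi>'\<close>.\<close>
  have "((\<lambda>t. \<psi> (t + \<beta>)) has_real_derivative \<psi>' (0 + \<beta>)) (at 0)"
    using d[of "0 + \<beta>"] by (simp only: DERIV_shift)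
  then have "\<psi>' \<beta> = \<psi>' 0" using DERIV_unique[OF _ d[of 0]] by (simp add: per)
  moreover have "\<phi> t = m * (- g t + \<kappa>\<^sup>2 * \<psi> t)" for t
    using mass unfolding ph a by (simp add: algebra_simps)
  ultimately show ?thesis using that[OF p2 p1] per[of 0] by simp
qed

text \<open>Put \<open>h = \<psi>' + \<kappa> * \<psi>\<close>. Since \<open>D + \<kappa>\<close>
  sends \<open>solve (schauder l j)\<close> back to \<open>haar l j\<close>, the Dirichlet form
  turns the pairing of \<open>\<phi>\<close> with a mode into \<open>sqrt m\<close> times a Haar
  coefficient of \<open>h\<close>, and \<open>loop_inner \<beta> \<psi> \<phi>\<close> into
  \<open>m\<close> times the integral of \<open>h^2\<close>. The claim is then Parseval's
  identity.\<close>

lemma mode_coefficients: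
  "(\<lambda>n. \<Sum>l<n. \<Sum>j<2 ^ (l - 1). (loop_inner \<beta> \<phi> (apply_bcontfun (mode l j)))\<^sup>2) \<longlonglongrightarrow> loop_inner \<beta> \<psi> \<phi>"
proof -
  obtain g \<psi>' where p: "primitive_on \<beta> \<psi> \<psi>'" "primitive_on \<beta> \<psi>' g" "\<psi> \<beta> = \<psi> 0" "\<psi>' \<beta> = \<psi>' 0"
    and ph: "\<And>t. \<phi> t = m * (- g t + \<kappa>\<^sup>2 * \<psi> t)" using operator_primitives by blast
  define h where "h t = \<psi>' t + \<kappa> * \<psi> t" for t
  have h: "continuous_on {0..\<beta>} h"
    unfolding h_def by (intro continuous_intros primitive_on_continuous[OF p(1)] primitive_on_continuous[OF p(2)])
  have c: "loop_inner \<beta> \<phi> (apply_bcontfun (mode l j)) = sqrt m * coef h l j" for l j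
  proof -
    let ?S = "schauder l j"
    have "loop_inner \<beta> \<phi> (apply_bcontfun (mode l j)) = (LINT t:{0..<\<beta>}|lborel. (m / sqrt m) * ((- g t + \<kappa>\<^sup>2 * \<psi> t) * solve ?S t))"
      unfolding loop_inner_def
      by (intro set_lebesgue_integral_cong) (auto simp: ph mode_def loop_of_base[OF beta solve_schauder])
    also have "\<dots> = (m / sqrt m) * (LINT t:{0..\<beta>}|lborel. (- g t + \<kappa>\<^sup>2 * \<psi> t) * solve ?S t)"
      by (simp add: integral_half_open)
    also have "(LINT t:{0..\<beta>}|lborel. (- g t + \<kappa>\<^sup>2 * \<psi> t) * solve ?S t)
        = (LINT t:{0..\<beta>}|lborel. (\<psi>' t + \<kappa> * \<psi> t) * ((haar l j t + (- \<kappa> * solve ?S t)) + \<kappa> * solve ?S t))"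
      by (rule dirichlet_form[OF p(1,2) solve_primitive[OF schauder_primitive] p(3,4) solve_schauder_periodic])
    also have "\<dots> = coef h l j"
      unfolding coef_def h_def by (intro set_lebesgue_integral_cong) auto
    finally show ?thesis using mass by (simp add: real_div_sqrt)
  qed
  have "loop_inner \<beta> \<psi> \<phi> = (LINT t:{0..<\<beta>}|lborel. m * ((- g t + \<kappa>\<^sup>2 * \<psi> t) * \<psi> t))"
    unfolding loop_inner_def by (intro set_lebesgue_integral_cong) (auto simp: ph)
  also have "\<dots> = m * (LINT t:{0..\<beta>}|lborel. (- g t + \<kappa>\<^sup>2 * \<psi> t) * \<psi> t)"
    by (simp add: integral_half_open)
  also have "(LINT t:{0..\<beta>}|lborel. (- g t + \<kappa>\<^sup>2 * \<psi> t) * \<psi> t) = (LINT t:{0..\<beta>}|lborel. (\<psi>' t + \<kappa> * \<psi> t) * (\<psi>' t + \<kappa> * \<psi> t))"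
    by (rule dirichlet_form[OF p(1,2,1,3,4,3)])
  finally have e: "loop_inner \<beta> \<psi> \<phi> = m * (LINT t:{0..\<beta>}|lborel. (h t)\<^sup>2)"
    by (simp add: h_def power2_eq_square)
  have "(\<lambda>n. m * (\<Sum>l\<le>n. \<Sum>j<2 ^ (l - 1). (coef h l j)\<^sup>2)) \<longlonglongrightarrow> m * (LINT t:{0..\<beta>}|lborel. (h t)\<^sup>2)"
    by (intro tendsto_intros parseval[OF h])
  \<comment> \<open>Parseval sums over \<open>l \<le> n\<close>, the series over
    \<open>l < n\<close>; hence the shift by one.\<close>
  then have "(\<lambda>n. \<Sum>l<Suc n. \<Sum>j<2 ^ (l - 1). (loop_inner \<beta> \<phi> (apply_bcontfun (mode l j)))\<^sup>2) \<longlonglongrightarrow> loop_inner \<beta> \<psi> \<phi>"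
    unfolding c e using mass by (simp add: power_mult_distrib sum_distrib_left lessThan_Suc_atMost del: sum.lessThan_Suc)
  then show ?thesis by (rule filterlim_sequentially_Suc[THEN iffD1])
qed

end

lemma random_loop_distribution:
  assumes a: "\<kappa>\<^sup>2 = a\<^sup>2 / m"
  shows "is_loop_gaussian m a \<beta> (distr noise (loop_space \<beta>) random_loop)"
  unfolding is_loop_gaussian_def
proof (intro conjI ballI allI impI)
  show "prob_space (distr noise (loop_space \<beta>) random_loop)"
    by (rule prob_space.prob_space_distr[OF prob_noise random_loop_measurable])
  show "sets (distr noise (loop_space \<beta>) random_loop) = sets (loop_space \<beta>)" by simp
  fix \<phi> \<psi> assume \<phi>: "\<phi> \<in> loop_L2 \<beta>" and op: "loop_operator m a \<beta> \<psi> \<phi>"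
  note i = loop_L2_integrable[OF \<phi>]
  have [measurable]: "(\<lambda>\<omega>. loop_inner \<beta> \<phi> (apply_bcontfun \<omega>)) \<in> borel_measurable (loop_space \<beta>)"
    by (rule measurable_restrict_space1[OF loop_inner_measurable[OF i]])
  have "(\<integral>\<omega>. iexp (loop_inner \<beta> \<phi> (apply_bcontfun \<omega>)) \<partial>distr noise (loop_space \<beta>) random_loop) = (\<integral>z. iexp (loop_inner \<beta> \<phi> (apply_bcontfun (random_loop z))) \<partial>noise)"
    by (rule integral_distr[OF random_loop_measurable]) measurable
  also have "\<dots> = complex_of_real (exp (- loop_inner \<beta> \<psi> \<phi> / 2))"
    by (rule char_random_loop[OF i mode_coefficients[OF a op]])
  finally show "(\<integral>\<omega>. iexp (loop_inner \<beta> \<phi> (apply_bcontfun \<omega>)) \<partial>distr noise (loop_space \<beta>) random_loop) = complex_of_real (exp (- loop_inner \<beta> \<psi> \<phi> / 2))" .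
qed

end

lemma loop_gaussian:
  assumes "\<beta> > 0" "m > 0" "a\<^sup>2 > 0"
  shows "is_loop_gaussian m a \<beta> (loop_gaussian m a \<beta>)"
proof -
  interpret loop_series \<beta> "sqrt (a\<^sup>2 / m)" m
    using assms by unfold_locales auto
  have "(sqrt (a\<^sup>2 / m))\<^sup>2 = a\<^sup>2 / m" using assms by simp
  then have "is_loop_gaussian m a \<beta> (distr noise (loop_space \<beta>) random_loop)" by (rule random_loop_distribution)
  then show ?thesis unfolding loop_gaussian_def by (rule someI)
qed

section \<open>The quantum lattice model\<close>

text \<open>Rounding the time down to the grid with spacing \<open>1 / Suc n\<close> leaves
  countably many times, at each of which evaluation is continuous in the loop; continuity in time
  gives the limit. Joint measurability is what makes time integrals measurable in the loops.\<close>

lemma apply_measurable: "(\<lambda>p. apply_bcontfun (fst p) (snd p)) \<in> borel_measurable (loop_space \<beta> \<Otimes>\<^sub>M borel)"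
proof (rule borel_measurable_LIMSEQ_metric)
  let ?r = "\<lambda>n t. of_int \<lfloor>real (Suc n) * t\<rfloor> / real (Suc n)"
  fix n
  have "(\<lambda>p. apply_bcontfun (fst p) (of_int i / real (Suc n))) \<in> borel_measurable (loop_space \<beta> \<Otimes>\<^sub>M borel)" for i :: int
    by (rule measurable_compose[OF measurable_fst measurable_restrict_space1[OF borel_measurable_continuous_onI[OF continuous_on_apply]]])
  then show "(\<lambda>p. apply_bcontfun (fst p) (?r n (snd p))) \<in> borel_measurable (loop_space \<beta> \<Otimes>\<^sub>M borel)"
    by (rule measurable_compose_countable) measurable
next
  fix p :: "(real \<Rightarrow>\<^sub>C real) \<times> real"
  let ?t = "snd p"
  have "(\<lambda>n. of_int \<lfloor>real (Suc n) * ?t\<rfloor> / real (Suc n)) \<longlonglongrightarrow> ?t"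
  proof (rule tendsto_sandwich)
    have "(\<lambda>n. ?t - 1 / real (Suc n)) \<longlonglongrightarrow> ?t - 0"
      by (intro tendsto_intros LIMSEQ_inverse_real_of_nat[unfolded inverse_eq_divide])
    then show "(\<lambda>n. ?t - 1 / real (Suc n)) \<longlonglongrightarrow> ?t" by (simp only: diff_zero)
    show "(\<lambda>n. ?t) \<longlonglongrightarrow> ?t" by simp
    have b: "?t - 1 / real (Suc n) \<le> of_int \<lfloor>real (Suc n) * ?t\<rfloor> / real (Suc n)" "of_int \<lfloor>real (Suc n) * ?t\<rfloor> / real (Suc n) \<le> ?t" for n
    proof -
      have "real (Suc n) * ?t - 1 \<le> of_int \<lfloor>real (Suc n) * ?t\<rfloor>" "of_int \<lfloor>real (Suc n) * ?t\<rfloor> \<le> real (Suc n) * ?t" by linarith+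
      then have "(real (Suc n) * ?t - 1) / real (Suc n) \<le> of_int \<lfloor>real (Suc n) * ?t\<rfloor> / real (Suc n)"
        "of_int \<lfloor>real (Suc n) * ?t\<rfloor> / real (Suc n) \<le> real (Suc n) * ?t / real (Suc n)"
        by (intro divide_right_mono; simp)+
      then show "?t - 1 / real (Suc n) \<le> of_int \<lfloor>real (Suc n) * ?t\<rfloor> / real (Suc n)" "of_int \<lfloor>real (Suc n) * ?t\<rfloor> / real (Suc n) \<le> ?t"
        by (simp_all add: diff_divide_distrib del: of_nat_Suc)
    qed
    show "eventually (\<lambda>n. ?t - 1 / real (Suc n) \<le> of_int \<lfloor>real (Suc n) * ?t\<rfloor> / real (Suc n)) sequentially"
      using b(1) by (intro always_eventually allI)
    show "eventually (\<lambda>n. of_int \<lfloor>real (Suc n) * ?t\<rfloor> / real (Suc n) \<le> ?t) sequentially"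
      using b(2) by (intro always_eventually allI)
  qed
  moreover have "isCont (apply_bcontfun (fst p)) ?t"
    by (rule continuous_on_interior[OF continuous_on_apply_bcontfun[of UNIV]]) simp
  ultimately show "(\<lambda>n. apply_bcontfun (fst p) (of_int \<lfloor>real (Suc n) * ?t\<rfloor> / real (Suc n))) \<longlonglongrightarrow> apply_bcontfun (fst p) ?t"
    by (rule isCont_tendsto_compose[rotated])
qed

lemma apply_measurable' [measurable (raw)]:
  assumes "f \<in> measurable N (loop_space \<beta>)" "g \<in> borel_measurable N"
  shows "(\<lambda>x. apply_bcontfun (f x) (g x)) \<in> borel_measurable N"
  using measurable_compose[OF measurable_Pair[OF assms] apply_measurable] by simp

lemma set_integrable_loop:
  fixes F :: "real \<Rightarrow> real"
  shows "continuous_on {0..b} F \<Longrightarrow> set_integrable lborel {0..<b} F"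
  by (simp add: integrable_half_open set_integrable_continuous)

lemma set_integral_finite_sum:
  fixes f :: "'i \<Rightarrow> real \<Rightarrow> real"
  assumes "finite A" "\<And>a. a \<in> A \<Longrightarrow> set_integrable lborel B (f a)"
  shows "set_integrable lborel B (\<lambda>t. \<Sum>a\<in>A. f a t)"
    "(LINT t:B|lborel. \<Sum>a\<in>A. f a t) = (\<Sum>a\<in>A. LINT t:B|lborel. f a t)"
proof -
  have "set_integrable lborel B (\<lambda>t. \<Sum>a\<in>A. f a t) \<and> (LINT t:B|lborel. \<Sum>a\<in>A. f a t) = (\<Sum>a\<in>A. LINT t:B|lborel. f a t)"
    using assms
  proof (induction A rule: finite_induct)
    case (insert x F)
    then show ?case by (simp add: set_integral_add)
  qed (simp add: set_integrable_def set_lebesgue_integral_def)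
  then show "set_integrable lborel B (\<lambda>t. \<Sum>a\<in>A. f a t)"
    "(LINT t:B|lborel. \<Sum>a\<in>A. f a t) = (\<Sum>a\<in>A. LINT t:B|lborel. f a t)" by auto
qed

section \<open>Geometry of the lattice\<close>

lemma component_le_lattice_norm: "\<bar>real_of_int (k $ i)\<bar> \<le> lattice_norm k"
  using component_le_norm_cart[of "\<chi> i. real_of_int (k $ i)" i] by (simp add: lattice_norm_def)

lemma finite_int_box: "finite {k :: int ^ 'd :: finite. \<forall>i. k $ i \<in> {c i - n..c i + n}}"
proof -
  have "{k :: int ^ 'd. \<forall>i. k $ i \<in> {c i - n..c i + n}} \<subseteq> vec_lambda ` PiE UNIV (\<lambda>i. {c i - n..c i + n})"
  proof
    fix k :: "int ^ 'd" assume "k \<in> {k. \<forall>i. k $ i \<in> {c i - n..c i + n}}"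
    then show "k \<in> vec_lambda ` PiE UNIV (\<lambda>i. {c i - n..c i + n})"
      by (intro image_eqI[of _ _ "vec_nth k"]) auto
  qed
  moreover have "finite (vec_lambda ` PiE UNIV (\<lambda>i. {c i - n..c i + n}) :: (int ^ 'd) set)"
    by (intro finite_imageI finite_PiE) auto
  ultimately show ?thesis by (rule finite_subset)
qed

lemma lattice_norm_minus: "lattice_norm (k - l) = lattice_norm (l - k)"
proof -
  have "(\<chi> i. real_of_int ((k - l) $ i)) = - (\<chi> i. real_of_int ((l - k) $ i))" by (simp add: vec_eq_iff)
  then show ?thesis unfolding lattice_norm_def by (metis norm_minus_cancel)
qed

lemma nearest_sym: "nearest k l \<longleftrightarrow> nearest l k"
  by (simp add: nearest_def lattice_norm_minus)

lemma nearest_irrefl: "\<not> nearest k k"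
proof -
  have "(\<chi> i. real_of_int ((k - k) $ i)) = 0" by (simp add: vec_eq_iff)
  then show ?thesis by (simp add: nearest_def lattice_norm_def)
qed

lemma finite_nearest: "finite {l. nearest k (l :: int ^ 'd :: finite)}"
proof (rule finite_subset[OF _ finite_int_box[of "\<lambda>i. k $ i" 1]], clarify)
  fix l i assume "nearest k l"
  then have "\<bar>real_of_int ((k - l) $ i)\<bar> \<le> 1"
    using component_le_lattice_norm[of "k - l" i] by (simp add: nearest_def)
  then show "l $ i \<in> {k $ i - 1..k $ i + 1}" by (simp add: abs_le_iff)
qed

text \<open>Translation invariance; it supplies the bound \<open>\<nu>\<close>, uniform over the
  sites, of the abstract model.\<close>

lemma card_nearest:
  fixes k :: "int ^ 'd :: finite"
  shows "card {l. nearest k l} = card {l :: int ^ 'd. nearest 0 l}"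
proof -
  have "{l. nearest k l} = (\<lambda>l. l + k) ` {l. nearest 0 l}"
  proof (intro set_eqI iffI)
    fix l assume "l \<in> {l. nearest k l}"
    then have "nearest 0 (l - k)" by (simp add: nearest_def)
    then show "l \<in> (\<lambda>l. l + k) ` {l. nearest 0 l}" by (intro image_eqI[of _ _ "l - k"]) auto
  qed (auto simp: nearest_def)
  then have "card {l. nearest k l} = card ((\<lambda>l. l + k) ` {l. nearest 0 l})" by (rule arg_cong)
  also have "\<dots> = card {l :: int ^ 'd. nearest 0 l}" by (rule card_image) (simp add: inj_on_def)
  finally show ?thesis .
qed

lemma sum_geometric_int:
  assumes "0 \<le> r" "r < 1"
  shows "(\<Sum>t\<in>{- int N..int N}. r ^ nat \<bar>t\<bar>) \<le> 2 / (1 - r :: real)"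
proof -
  have "(\<Sum>t\<in>{- int N..int N}. r ^ nat \<bar>t\<bar>) \<le> (\<Sum>t\<in>int ` {..N} \<union> (\<lambda>n. - int n) ` {..N}. r ^ nat \<bar>t\<bar>)"
  proof (rule sum_mono2)
    show "{- int N..int N} \<subseteq> int ` {..N} \<union> (\<lambda>n. - int n) ` {..N}"
    proof
      fix t assume t: "t \<in> {- int N..int N}"
      show "t \<in> int ` {..N} \<union> (\<lambda>n. - int n) ` {..N}"
      proof (cases "t \<ge> 0")
        case True
        then show ?thesis using t by (intro UnI1 image_eqI[of _ _ "nat t"]) auto
      next
        case False
        then show ?thesis using t by (intro UnI2 image_eqI[of _ _ "nat (- t)"]) auto
      qed
    qed
  qed (use assms in auto)
  also have "\<dots> \<le> (\<Sum>t\<in>int ` {..N}. r ^ nat \<bar>t\<bar>) + (\<Sum>t\<in>(\<lambda>n. - int n) ` {..N}. r ^ nat \<bar>t\<bar>)"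
    by (subst sum_Un) (use assms in \<open>auto intro!: sum_nonneg\<close>)
  also have "\<dots> = 2 * (\<Sum>n\<le>N. r ^ n)"
    by (subst (1 2) sum.reindex) (auto simp: inj_on_def)
  also have "(\<Sum>n\<le>N. r ^ n) \<le> 1 / (1 - r)"
  proof -
    have "(\<Sum>n\<le>N. r ^ n) \<le> (\<Sum>n. r ^ n)" using assms by (intro sum_le_suminf summable_geometric) auto
    then show ?thesis using assms by (simp add: suminf_geometric)
  qed
  finally show ?thesis by simp
qed

text \<open>The Euclidean norm is at least the l1 norm divided by the dimension, so a finite sum is
  dominated by a product of one-dimensional geometric sums.\<close>

lemma exp_lattice_norm_sum:
  assumes d: "\<delta> > 0"
  shows "\<exists>S\<ge>0. \<forall>F :: (int ^ 'd :: finite) set. finite F \<longrightarrow> (\<Sum>k\<in>F. exp (- \<delta> * lattice_norm k)) \<le> S"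
proof -
  define D where "D = real CARD('d)"
  have D: "D > 0" by (simp add: D_def)
  define r where "r = exp (- \<delta> / D)"
  have r: "0 \<le> r" "r < 1" using d D by (auto simp: r_def)
  have pt: "exp (- \<delta> * lattice_norm k) \<le> (\<Prod>i\<in>UNIV. r ^ nat \<bar>k $ i\<bar>)" for k :: "int ^ 'd"
  proof -
    have "(\<Sum>i\<in>UNIV. \<bar>real_of_int (k $ i)\<bar>) \<le> (\<Sum>i\<in>(UNIV :: 'd set). lattice_norm k)"
      by (intro sum_mono component_le_lattice_norm)
    then have "(\<Sum>i\<in>UNIV. \<bar>real_of_int (k $ i)\<bar>) \<le> D * lattice_norm k" by (simp add: D_def)
    then have "\<delta> / D * (\<Sum>i\<in>UNIV. \<bar>real_of_int (k $ i)\<bar>) \<le> \<delta> / D * (D * lattice_norm k)"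
      using d D by (intro mult_left_mono) auto
    also have "\<dots> = \<delta> * lattice_norm k" using D by simp
    finally have "exp (- \<delta> * lattice_norm k) \<le> exp (- (\<delta> / D * (\<Sum>i\<in>UNIV. \<bar>real_of_int (k $ i)\<bar>)))" by simp
    also have "\<dots> = (\<Prod>i\<in>UNIV. exp (- (\<delta> / D * \<bar>real_of_int (k $ i)\<bar>)))"
      by (simp add: exp_sum[symmetric] sum_distrib_left sum_negf)
    also have "\<dots> = (\<Prod>i\<in>UNIV. r ^ nat \<bar>k $ i\<bar>)"
      by (intro prod.cong refl) (simp add: r_def exp_of_nat_mult[symmetric] mult.commute)
    finally show ?thesis .
  qed
  have "(\<Sum>k\<in>F. exp (- \<delta> * lattice_norm k)) \<le> (2 / (1 - r)) ^ CARD('d)" if F: "finite F" for F :: "(int ^ 'd) set"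
  proof -
    define N where "N = Max (insert 0 ((\<lambda>(k, i). nat \<bar>k $ i\<bar>) ` (F \<times> UNIV)))"
    have N: "nat \<bar>k $ i\<bar> \<le> N" if "k \<in> F" for k i
      unfolding N_def using F that by (intro Max_ge) (auto intro!: image_eqI[of _ _ "(k, i)"])
    let ?P = "PiE (UNIV :: 'd set) (\<lambda>_. {- int N..int N})"
    have fP: "finite ?P" by (intro finite_PiE) auto
    have sub: "F \<subseteq> vec_lambda ` ?P"
    proof
      fix k assume k: "k \<in> F"
      have "vec_nth k i \<in> {- int N..int N}" for i using N[OF k, of i] by auto
      then show "k \<in> vec_lambda ` ?P" by (intro image_eqI[of _ _ "vec_nth k"]) auto
    qed
    have "(\<Sum>k\<in>F. exp (- \<delta> * lattice_norm k)) \<le> (\<Sum>k\<in>F. \<Prod>i\<in>UNIV. r ^ nat \<bar>k $ i\<bar>)" by (intro sum_mono pt)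
    also have "\<dots> \<le> (\<Sum>k\<in>vec_lambda ` ?P. \<Prod>i\<in>UNIV. r ^ nat \<bar>k $ i\<bar>)"
      using sub fP r by (intro sum_mono2) (auto intro!: prod_nonneg)
    also have "\<dots> = (\<Sum>x\<in>?P. \<Prod>i\<in>UNIV. r ^ nat \<bar>x i\<bar>)"
      by (subst sum.reindex) (auto simp: inj_on_def vec_lambda_inject)
    also have "\<dots> = (\<Prod>i\<in>(UNIV :: 'd set). \<Sum>t\<in>{- int N..int N}. r ^ nat \<bar>t\<bar>)"
      by (rule prod_sum_PiE[symmetric]) auto
    also have "\<dots> \<le> (\<Prod>i\<in>(UNIV :: 'd set). 2 / (1 - r))"
      using r by (intro prod_mono conjI sum_nonneg sum_geometric_int) auto
    finally show ?thesis by simp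
  qed
  moreover have "(2 / (1 - r)) ^ CARD('d) \<ge> 0" using r by simp
  ultimately show ?thesis by blast
qed

section \<open>Growth of the potential and the size of the coupling\<close>

lemma growth_superquadratic:
  assumes "growth_condition V"
  shows "\<exists>C. \<forall>q. l * q\<^sup>2 - C \<le> V q"
proof -
  obtain P K C :: real where P: "P > 2" "K > 0"
    and V: "\<And>q n. n \<in> {0, 1, 2 :: nat} \<Longrightarrow> inverse K * \<bar>q\<bar> powr (P - real n) - C \<le> sgn q ^ n * (deriv ^^ n) V q"
    using assms unfolding growth_condition_def by blast
  define L where "L = \<bar>l\<bar> * K"
  have L: "L \<ge> 0" using P by (simp add: L_def)
  \<comment> \<open>Beyond \<open>R\<close> the factor \<open>\<bar>q\<bar> powr (P - 2)\<close> is
    at least \<open>\<bar>l\<bar> * K\<close>, so the leading term beats \<open>l * q^2\<close>;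
    below \<open>R\<close> the constant \<open>\<bar>l\<bar> * R^2\<close> covers it. The maximum
    with 1 keeps \<open>q\<close> away from 0 in the first case.\<close>
  define R where "R = max 1 (L powr (1 / (P - 2)))"
  have "l * q\<^sup>2 - (C + \<bar>l\<bar> * R\<^sup>2) \<le> V q" for q
  proof -
    have Vq: "inverse K * \<bar>q\<bar> powr P - C \<le> V q" using V[of 0 q] by simp
    have lq: "l * q\<^sup>2 \<le> \<bar>l\<bar> * q\<^sup>2" by (intro mult_right_mono) auto
    show ?thesis
    proof (cases "\<bar>q\<bar> \<ge> R")
      case True
      have "R \<ge> 1" by (simp add: R_def)
      then have q: "\<bar>q\<bar> > 0" using True by linarith
      have "L = (L powr (1 / (P - 2))) powr (P - 2)" using P L by (cases "L = 0") (auto simp: powr_powr)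
      also have "\<dots> \<le> \<bar>q\<bar> powr (P - 2)" using True P by (intro powr_mono2) (auto simp: R_def)
      finally have "L * q\<^sup>2 \<le> \<bar>q\<bar> powr (P - 2) * \<bar>q\<bar> powr 2"
        using q by (simp add: mult_right_mono)
      also have "\<dots> = \<bar>q\<bar> powr ((P - 2) + 2)" by (rule powr_add[symmetric])
      also have "\<dots> = \<bar>q\<bar> powr P" by simp
      finally have "inverse K * (L * q\<^sup>2) \<le> inverse K * \<bar>q\<bar> powr P" using P by (intro mult_left_mono) auto
      moreover have "inverse K * (L * q\<^sup>2) = \<bar>l\<bar> * q\<^sup>2" using P by (simp add: L_def)
      moreover have "0 \<le> \<bar>l\<bar> * R\<^sup>2" by simp
      ultimately show ?thesis using Vq lq by linarith
    next
      case False
      have "0 \<le> inverse K * \<bar>q\<bar> powr P" using P by simp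
      moreover have "\<bar>q\<bar>\<^sup>2 \<le> R\<^sup>2" using False by (intro power_mono) auto
      then have "\<bar>l\<bar> * q\<^sup>2 \<le> \<bar>l\<bar> * R\<^sup>2" by (intro mult_left_mono) auto
      ultimately show ?thesis using Vq lq by linarith
    qed
  qed
  then show ?thesis by blast
qed

lemma C2_continuous: "C2_function V \<Longrightarrow> continuous_on A V"
  unfolding C2_function_def
  by (meson continuous_at_imp_continuous_on differentiable_imp_continuous_within)

text \<open>After expansion the terms \<open>J * y^2\<close> cancel. The cross term is handled by
  Young's inequality, obtained from the square of
  \<open>e * \<bar>y\<bar> - J * \<bar>x\<bar>\<close> divided by \<open>e\<close>; this is the
  origin of \<open>J + J^2 / e\<close>.\<close>

lemma pair_interaction_near:
  fixes J e x y :: real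
  assumes "J > 0" "e > 0"
  shows "\<bar>pair_interaction J x y - J * y\<^sup>2\<bar> \<le> e * y\<^sup>2 + (J + J\<^sup>2 / e) * x\<^sup>2"
proof -
  have "0 \<le> (e * \<bar>y\<bar> - J * \<bar>x\<bar>)\<^sup>2 / e" using assms by simp
  also have "\<dots> = e * y\<^sup>2 - 2 * J * (\<bar>x\<bar> * \<bar>y\<bar>) + J\<^sup>2 / e * x\<^sup>2"
    using assms by (simp add: power2_diff power_mult_distrib field_simps power2_eq_square)
  finally have c: "2 * J * (\<bar>x\<bar> * \<bar>y\<bar>) \<le> e * y\<^sup>2 + J\<^sup>2 / e * x\<^sup>2" by simp
  have "pair_interaction J x y - J * y\<^sup>2 = J * x\<^sup>2 - 2 * J * (x * y)"
    by (simp add: pair_interaction_def power2_diff algebra_simps)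
  also have "\<bar>\<dots>\<bar> \<le> J * x\<^sup>2 + 2 * J * (\<bar>x\<bar> * \<bar>y\<bar>)"
    using assms by (intro order_trans[OF abs_triangle_ineq4]) (simp add: abs_mult)
  finally show ?thesis using c by (simp add: algebra_simps)
qed

section \<open>Quantum loops as an instance of the abstract model\<close>

locale loop_model =
  fixes \<beta> m a J :: real and V :: "real \<Rightarrow> real" and dim :: "'d :: finite itself"
  assumes beta: "\<beta> > 0" and mass: "m > 0" and a2: "a\<^sup>2 > 0" and J: "J > 0"
    and V_C2: "C2_function V" and V_growth: "growth_condition V"
begin

definition self :: "(real \<Rightarrow>\<^sub>C real) \<Rightarrow> real" where
  "self f = (LINT t:{0..<\<beta>}|lborel. V (apply_bcontfun f t))"

definition couple :: "(real \<Rightarrow>\<^sub>C real) \<Rightarrow> (real \<Rightarrow>\<^sub>C real) \<Rightarrow> real" where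
  "couple f g = (LINT t:{0..<\<beta>}|lborel. pair_interaction J (apply_bcontfun f t) (apply_bcontfun g t))"

definition sq :: "(real \<Rightarrow>\<^sub>C real) \<Rightarrow> real" where
  "sq f = loop_inner \<beta> (apply_bcontfun f) (apply_bcontfun f)"

lemma continuous_V: "continuous_on A V" using V_C2 by (rule C2_continuous)

lemma V_measurable [measurable]: "V \<in> borel_measurable borel"
  by (rule borel_measurable_continuous_onI[OF continuous_V])

lemma int_self: "set_integrable lborel {0..<\<beta>} (\<lambda>t. V (apply_bcontfun f t))"
  by (intro set_integrable_loop continuous_on_compose2[OF continuous_V[of UNIV] continuous_on_apply_bcontfun]) auto

lemma int_couple: "set_integrable lborel {0..<\<beta>} (\<lambda>t. pair_interaction J (apply_bcontfun f t) (apply_bcontfun g t))"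
  unfolding pair_interaction_def by (intro set_integrable_loop continuous_intros) auto

lemma int_sq: "set_integrable lborel {0..<\<beta>} (\<lambda>t. (apply_bcontfun (f :: real \<Rightarrow>\<^sub>C real) t)\<^sup>2)"
  by (intro set_integrable_loop continuous_intros) auto

lemma int_const: "set_integrable lborel {0..<\<beta>} (\<lambda>_. z)" "(LINT t:{0..<\<beta>}|lborel. z) = z * \<beta>" for z :: real
  using beta by (auto intro!: set_integrable_loop simp: set_integral_const)

lemma sq_eq: "sq f = (LINT t:{0..<\<beta>}|lborel. (apply_bcontfun f t)\<^sup>2)"
  by (simp add: sq_def loop_inner_def power2_eq_square)

lemma sq_nonneg: "sq f \<ge> 0"
  unfolding sq_eq set_lebesgue_integral_def by (intro integral_nonneg_AE AE_I2) (auto simp: indicator_def)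

lemma self_superquadratic: "\<exists>C. \<forall>f. l * sq f - C \<le> self f"
proof -
  obtain C where C: "\<And>q. l * q\<^sup>2 - C \<le> V q" using growth_superquadratic[OF V_growth] by blast
  have "l * sq f - C * \<beta> \<le> self f" for f
  proof -
    have "l * sq f - C * \<beta> = (LINT t:{0..<\<beta>}|lborel. l * (apply_bcontfun f t)\<^sup>2 - C)"
      using int_sq[of f] by (simp add: sq_eq set_integral_diff(2) int_const)
    also have "\<dots> \<le> self f" unfolding self_def
      using int_sq[of f] by (intro set_integral_mono int_self set_integral_diff(1) int_const C) auto
    finally show ?thesis .
  qed
  then show ?thesis by blast
qed

lemma couple_near:
  assumes "e > 0"
  shows "\<bar>couple f g - J * sq g\<bar> \<le> e * sq g + (J + J\<^sup>2 / e) * sq f"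
proof -
  let ?f = "apply_bcontfun f" and ?g = "apply_bcontfun g"
  let ?C = "J + J\<^sup>2 / e"
  have i: "set_integrable lborel {0..<\<beta>} (\<lambda>t. pair_interaction J (?f t) (?g t) - J * (?g t)\<^sup>2)"
    using int_sq[of g] by (intro set_integral_diff(1) int_couple) auto
  have i2: "set_integrable lborel {0..<\<beta>} (\<lambda>t. e * (?g t)\<^sup>2 + ?C * (?f t)\<^sup>2)"
    using int_sq[of g] int_sq[of f] by (intro set_integral_add(1)) auto
  have "couple f g - J * sq g = (LINT t:{0..<\<beta>}|lborel. pair_interaction J (?f t) (?g t) - J * (?g t)\<^sup>2)"
    using int_couple[of f g] int_sq[of g] by (simp add: couple_def sq_eq set_integral_diff(2))
  also have "\<bar>\<dots>\<bar> \<le> (LINT t:{0..<\<beta>}|lborel. \<bar>pair_interaction J (?f t) (?g t) - J * (?g t)\<^sup>2\<bar>)"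
    using set_integral_norm_bound[OF i] by simp
  also have "\<dots> \<le> (LINT t:{0..<\<beta>}|lborel. e * (?g t)\<^sup>2 + ?C * (?f t)\<^sup>2)"
    using set_integrable_abs[OF i] i2 by (rule set_integral_mono) (rule pair_interaction_near[OF J assms])
  also have "\<dots> = e * sq g + ?C * sq f"
    using int_sq[of g] int_sq[of f] by (simp add: sq_eq set_integral_add(2))
  finally show ?thesis .
qed

lemma gaussian_prob: "prob_space (loop_gaussian m a \<beta>)"
  and gaussian_sets: "sets (loop_gaussian m a \<beta>) = sets (loop_space \<beta>)"
  using loop_gaussian[OF beta mass a2] by (auto simp: is_loop_gaussian_def)

abbreviation nbs :: "int ^ 'd \<Rightarrow> (int ^ 'd) set" where "nbs k \<equiv> {l. nearest k l}"

text \<open>The boundary condition is the zero loop; the number of neighbours is raised by 1 so that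
  its positivity is immediate.\<close>

sublocale pair_model "loop_space \<beta>" "loop_gaussian m a \<beta>" sq self couple nbs 0 J
  "real (card (nbs 0)) + 1"
proof (rule pair_model.intro)
  show "prob_space (loop_gaussian m a \<beta>)" by (rule gaussian_prob)
  show "sets (loop_gaussian m a \<beta>) = sets (loop_space \<beta>)" by (rule gaussian_sets)
  show "0 \<in> space (loop_space \<beta>)" by (simp add: loops_iff)
  show "sq \<in> borel_measurable (loop_space \<beta>)"
    unfolding sq_eq[abs_def] set_lebesgue_integral_def by measurable
  show "self \<in> borel_measurable (loop_space \<beta>)"
    unfolding self_def[abs_def] set_lebesgue_integral_def by measurable
  show "(\<lambda>(x, y). couple x y) \<in> borel_measurable (loop_space \<beta> \<Otimes>\<^sub>M loop_space \<beta>)"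
    unfolding couple_def[abs_def] set_lebesgue_integral_def split_def pair_interaction_def by measurable
  show "0 \<le> sq x" for x by (rule sq_nonneg)
  show "0 \<le> couple x y" for x y
    unfolding couple_def pair_interaction_def set_lebesgue_integral_def
    using J by (intro integral_nonneg_AE AE_I2) (auto simp: indicator_def)
  show "couple x y = couple y x" for x y
    by (simp add: couple_def pair_interaction_def power2_commute)
  show "\<exists>C. \<forall>x\<in>space (loop_space \<beta>). l * sq x - C \<le> self x" for l
    using self_superquadratic[of l] by blast
  show "\<exists>C\<ge>0. \<forall>x\<in>space (loop_space \<beta>). \<forall>y\<in>space (loop_space \<beta>). \<bar>couple x y - J * sq y\<bar> \<le> e * sq y + C * sq x"
    if e: "e > 0" for e
    using couple_near[OF e] J e by (intro exI[of _ "J + J\<^sup>2 / e"]) auto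
  show "finite (nbs k)" for k by (rule finite_nearest)
  show "k \<in> nbs l \<longleftrightarrow> l \<in> nbs k" for k l using nearest_sym by auto
  show "real (card (nbs k)) \<le> real (card (nbs 0)) + 1" for k
    using card_nearest[of k] by simp
  show "real (card (nbs 0)) + 1 > 0" by simp
  show "k \<notin> nbs k" for k using nearest_irrefl by simp
qed

text \<open>A boundary bond occurs once with coefficient 1 in \<open>local_energy\<close>, and in
  both orientations with coefficient 1/2 in \<open>energy\<close>; inner bonds are counted alike.
  Symmetry of the coupling makes the orientations equal.\<close>

lemma local_energy_eq:
  assumes L: "finite \<Lambda>"
  shows "local_energy \<beta> J V \<Lambda> \<omega> \<xi> = energy \<Lambda> (override_on \<xi> \<omega> \<Lambda>)"
proof -
  define \<zeta> where "\<zeta> = override_on \<xi> \<omega> \<Lambda>"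
  let ?A = "{(k, k'). k \<in> \<Lambda> \<and> k' \<in> \<Lambda> \<and> nearest k k'}"
  let ?B = "{(k, k'). k \<in> \<Lambda> \<and> k' \<notin> \<Lambda> \<and> nearest k k'}"
  let ?B' = "prod.swap ` ?B"
  have bonds: "bonds \<Lambda> = (?A \<union> ?B) \<union> ?B'"
    by (auto simp: bonds_def image_iff dest: nearest_sym[THEN iffD1])
  have fb: "finite (bonds \<Lambda>)" by (rule finite_bonds[OF L])
  have fin: "finite ?A" "finite ?B" "finite ?B'" using fb unfolding bonds by simp_all
  have eqA: "(\<Sum>(k, k')\<in>?A. pair_interaction J (\<omega> k t) (\<omega> k' t)) = (\<Sum>p\<in>?A. pair_interaction J (\<zeta> (fst p) t) (\<zeta> (snd p) t))" for t
    by (intro sum.cong) (auto simp: \<zeta>_def)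
  have eqB: "(\<Sum>(k, k')\<in>?B. pair_interaction J (\<omega> k t) (\<xi> k' t)) = (\<Sum>p\<in>?B. pair_interaction J (\<zeta> (fst p) t) (\<zeta> (snd p) t))" for t
    by (intro sum.cong) (auto simp: \<zeta>_def)
  have eqV: "(\<Sum>k\<in>\<Lambda>. V (\<omega> k t)) = (\<Sum>k\<in>\<Lambda>. V (\<zeta> k t))" for t
    by (intro sum.cong) (auto simp: \<zeta>_def)
  let ?w = "\<lambda>p. couple (\<zeta> (fst p)) (\<zeta> (snd p))"
  note iV = set_integral_finite_sum[OF L int_self[of "\<zeta> k" for k]]
  note iA = set_integral_finite_sum[OF fin(1) int_couple[of "\<zeta> (fst p)" "\<zeta> (snd p)" for p]]
  note iB = set_integral_finite_sum[OF fin(2) int_couple[of "\<zeta> (fst p)" "\<zeta> (snd p)" for p]]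
  have iA': "set_integrable lborel {0..<\<beta>} (\<lambda>t. 1/2 * (\<Sum>p\<in>?A. pair_interaction J (\<zeta> (fst p) t) (\<zeta> (snd p) t)))"
    by (rule set_integrable_mult_right) (rule iA(1))
  have "local_energy \<beta> J V \<Lambda> \<omega> \<xi> = (\<Sum>k\<in>\<Lambda>. self (\<zeta> k)) + 1/2 * (\<Sum>p\<in>?A. ?w p) + (\<Sum>p\<in>?B. ?w p)"
  proof -
    have "local_energy \<beta> J V \<Lambda> \<omega> \<xi> = (LINT t:{0..<\<beta>}|lborel. ((\<Sum>k\<in>\<Lambda>. V (\<zeta> k t)) + 1/2 * (\<Sum>p\<in>?A. pair_interaction J (\<zeta> (fst p) t) (\<zeta> (snd p) t)))
        + (\<Sum>p\<in>?B. pair_interaction J (\<zeta> (fst p) t) (\<zeta> (snd p) t)))"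
      unfolding local_energy_def eqA eqB eqV ..
    also have "\<dots> = (LINT t:{0..<\<beta>}|lborel. \<Sum>k\<in>\<Lambda>. V (\<zeta> k t)) + (LINT t:{0..<\<beta>}|lborel. 1/2 * (\<Sum>p\<in>?A. pair_interaction J (\<zeta> (fst p) t) (\<zeta> (snd p) t)))
        + (LINT t:{0..<\<beta>}|lborel. \<Sum>p\<in>?B. pair_interaction J (\<zeta> (fst p) t) (\<zeta> (snd p) t))"
      by (simp only: set_integral_add(2)[OF set_integral_add(1)[OF iV(1) iA'] iB(1)] set_integral_add(2)[OF iV(1) iA'])
    also have "(LINT t:{0..<\<beta>}|lborel. 1/2 * (\<Sum>p\<in>?A. pair_interaction J (\<zeta> (fst p) t) (\<zeta> (snd p) t)))
        = 1/2 * (LINT t:{0..<\<beta>}|lborel. \<Sum>p\<in>?A. pair_interaction J (\<zeta> (fst p) t) (\<zeta> (snd p) t))"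
      by (rule set_integral_mult_right)
    finally show ?thesis unfolding iV(2) iA(2) iB(2) by (simp only: self_def couple_def)
  qed
  also have "(\<Sum>p\<in>?B. ?w p) = 1/2 * ((\<Sum>p\<in>?B. ?w p) + (\<Sum>p\<in>?B'. ?w p))"
  proof -
    have "(\<Sum>p\<in>?B'. ?w p) = (\<Sum>p\<in>?B. ?w p)"
      by (subst sum.reindex) (auto simp: couple_def pair_interaction_def power2_commute intro!: sum.cong)
    then show ?thesis by simp
  qed
  also have "(\<Sum>k\<in>\<Lambda>. self (\<zeta> k)) + 1/2 * (\<Sum>p\<in>?A. ?w p) + 1/2 * ((\<Sum>p\<in>?B. ?w p) + (\<Sum>p\<in>?B'. ?w p))
      = (\<Sum>k\<in>\<Lambda>. self (\<zeta> k)) + 1/2 * (((\<Sum>p\<in>?A. ?w p) + (\<Sum>p\<in>?B. ?w p)) + (\<Sum>p\<in>?B'. ?w p))"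
    by (simp add: algebra_simps)
  also have "((\<Sum>p\<in>?A. ?w p) + (\<Sum>p\<in>?B. ?w p)) + (\<Sum>p\<in>?B'. ?w p) = (\<Sum>p\<in>bonds \<Lambda>. ?w p)"
  proof -
    have "(\<Sum>p\<in>bonds \<Lambda>. ?w p) = (\<Sum>p\<in>?A \<union> ?B. ?w p) + (\<Sum>p\<in>?B'. ?w p)"
      unfolding bonds using fin by (intro sum.union_disjoint) auto
    also have "(\<Sum>p\<in>?A \<union> ?B. ?w p) = (\<Sum>p\<in>?A. ?w p) + (\<Sum>p\<in>?B. ?w p)"
      using fin by (intro sum.union_disjoint) auto
    finally show ?thesis by simp
  qed
  finally show ?thesis by (simp add: energy_def \<zeta>_def[symmetric] split_def)
qed

section \<open>The local specification as an abstract kernel\<close>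

lemma override_product_measurable:
  assumes x: "\<xi> \<in> space \<Omega>"
  shows "(\<lambda>\<omega>. override_on \<xi> \<omega> \<Lambda>) \<in> measurable (PiM \<Lambda> (\<lambda>_. loop_gaussian m a \<beta>)) \<Omega>"
proof (rule measurable_PiM_single')
  let ?P = "PiM \<Lambda> (\<lambda>_. loop_gaussian m a \<beta>) :: (int ^ 'd \<Rightarrow> (real \<Rightarrow>\<^sub>C real)) measure"
  have xl: "\<xi> k \<in> loops \<beta>" for k using x by (simp add: space_Omega)
  show "(\<lambda>\<omega>. override_on \<xi> \<omega> \<Lambda> k) \<in> measurable ?P (loop_space \<beta>)" if "k \<in> UNIV" for k
  proof (cases "k \<in> \<Lambda>")
    case True
    have "(\<lambda>\<omega>. \<omega> k) \<in> measurable ?P (loop_gaussian m a \<beta>)" using True by (rule measurable_component_singleton)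
    then show ?thesis using True by (simp add: override_on_def measurable_cong_sets[OF refl gaussian_sets])
  qed (simp add: override_on_def xl)
  show "(\<lambda>\<omega> k. override_on \<xi> \<omega> \<Lambda> k) \<in> space ?P \<rightarrow> UNIV \<rightarrow>\<^sub>E space (loop_space \<beta>)"
    using xl space_gamma by (auto simp: override_on_def space_PiM PiE_def Pi_def)
qed

text \<open>The finite product is the image of the full product under restriction to
  \<open>\<Lambda>\<close>, and \<open>override_on\<close> reads no other coordinate.\<close>

lemma nn_integral_finite_product:
  assumes F [measurable]: "F \<in> borel_measurable \<Omega>" and L: "finite \<Lambda>" and x: "\<xi> \<in> space \<Omega>"
  shows "(\<integral>\<^sup>+\<omega>. F (override_on \<xi> \<omega> \<Lambda>) \<partial>PiM \<Lambda> (\<lambda>_. loop_gaussian m a \<beta>)) = (\<integral>\<^sup>+\<omega>. F (override_on \<xi> \<omega> \<Lambda>) \<partial>G)"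
proof -
  interpret PP: product_prob_space "\<lambda>_. loop_gaussian m a \<beta>" "UNIV :: (int ^ 'd) set"
    by (intro product_prob_spaceI gaussian_prob)
  let ?P = "PiM \<Lambda> (\<lambda>_. loop_gaussian m a \<beta>) :: (int ^ 'd \<Rightarrow> (real \<Rightarrow>\<^sub>C real)) measure"
  note m = measurable_compose[OF override_product_measurable[OF x, of \<Lambda>] F]
  have "(\<integral>\<^sup>+\<omega>. F (override_on \<xi> \<omega> \<Lambda>) \<partial>?P) = (\<integral>\<^sup>+\<omega>. F (override_on \<xi> \<omega> \<Lambda>) \<partial>distr G ?P (\<lambda>\<omega>. restrict \<omega> \<Lambda>))"
    using L by (subst PP.distr_PiM_restrict_finite) auto
  also have "\<dots> = (\<integral>\<^sup>+\<omega>. F (override_on \<xi> (restrict \<omega> \<Lambda>) \<Lambda>) \<partial>G)"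
    by (rule nn_integral_distr[OF measurable_restrict_subset]) (use m in simp_all)
  also have "\<dots> = (\<integral>\<^sup>+\<omega>. F (override_on \<xi> \<omega> \<Lambda>) \<partial>G)"
  proof -
    have "override_on \<xi> (restrict \<omega> \<Lambda>) \<Lambda> = override_on \<xi> \<omega> \<Lambda>" for \<omega>
      by (auto simp: override_on_def fun_eq_iff)
    then show ?thesis by simp
  qed
  finally show ?thesis .
qed

lemma local_spec_eq:
  assumes L: "finite \<Lambda>" and D [measurable]: "D \<in> sets \<Omega>" and x: "\<xi> \<in> space \<Omega>"
  shows "ennreal (local_spec \<beta> m a J V \<Lambda> D \<xi>) = kern \<Lambda> (indicator D) \<xi>" "local_spec \<beta> m a J V \<Lambda> D \<xi> \<ge> 0"
proof -
  let ?P = "PiM \<Lambda> (\<lambda>_. loop_gaussian m a \<beta>) :: (int ^ 'd \<Rightarrow> (real \<Rightarrow>\<^sub>C real)) measure"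
  have num: "ennreal (\<integral>\<omega>. exp (- local_energy \<beta> J V \<Lambda> \<omega> \<xi>) * indicator A (override_on \<xi> \<omega> \<Lambda>) \<partial>?P) = unnorm \<Lambda> (indicator A) \<xi>"
    if A [measurable]: "A \<in> sets \<Omega>" for A
  proof -
    define F where "F \<zeta> = exp (- energy \<Lambda> \<zeta>) * indicator A \<zeta>" for \<zeta>
    have [measurable]: "F \<in> borel_measurable \<Omega>" unfolding F_def by measurable
    have F0: "F \<zeta> \<ge> 0" for \<zeta> by (simp add: F_def)
    have "(\<integral>\<^sup>+\<omega>. ennreal (F (override_on \<xi> \<omega> \<Lambda>)) \<partial>?P) = (\<integral>\<^sup>+\<omega>. ennreal (F (override_on \<xi> \<omega> \<Lambda>)) \<partial>G)"
      by (rule nn_integral_finite_product[OF _ L x]) measurable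
    also have "\<dots> = unnorm \<Lambda> (indicator A) \<xi>"
      unfolding unnorm_def by (intro nn_integral_cong) (auto simp: F_def weight_def indicator_def)
    finally have eq: "(\<integral>\<^sup>+\<omega>. ennreal (F (override_on \<xi> \<omega> \<Lambda>)) \<partial>?P) = unnorm \<Lambda> (indicator A) \<xi>" .
    have "unnorm \<Lambda> (indicator A) \<xi> \<le> unnorm \<Lambda> (\<lambda>_. 1) \<xi>"
      unfolding unnorm_def by (intro nn_integral_mono mult_left_mono) (auto simp: indicator_def)
    also have "\<dots> < \<infinity>" by (rule unnorm_finite[OF x])
    finally have fin: "unnorm \<Lambda> (indicator A) \<xi> < \<infinity>" .
    have "(\<integral>\<omega>. F (override_on \<xi> \<omega> \<Lambda>) \<partial>?P) = enn2real (unnorm \<Lambda> (indicator A) \<xi>)"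
      unfolding eq[symmetric]
      by (rule integral_eq_nn_integral[OF measurable_compose[OF override_product_measurable[OF x]]]) (measurable, simp add: F0)
    then show ?thesis using fin by (simp add: F_def local_energy_eq[OF L])
  qed
  have pf: "ennreal (partition_function \<beta> m a J V \<Lambda> \<xi>) = unnorm \<Lambda> (\<lambda>_. 1) \<xi>"
  proof -
    \<comment> \<open>The partition function is treated as the numerator for the whole space, which
      contains every overridden configuration.\<close>
    have "override_on \<xi> \<omega> \<Lambda> \<in> space \<Omega>" if "\<omega> \<in> space ?P" for \<omega>
      using that x space_gamma by (auto simp: space_PiM override_on_def PiE_iff)
    then have "partition_function \<beta> m a J V \<Lambda> \<xi> = (\<integral>\<omega>. exp (- local_energy \<beta> J V \<Lambda> \<omega> \<xi>) * indicator (space \<Omega>) (override_on \<xi> \<omega> \<Lambda>) \<partial>?P)"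
      unfolding partition_function_def by (intro Bochner_Integration.integral_cong) auto
    then have "ennreal (partition_function \<beta> m a J V \<Lambda> \<xi>) = unnorm \<Lambda> (indicator (space \<Omega>)) \<xi>"
      using num[of "space \<Omega>"] by simp
    also have "\<dots> = unnorm \<Lambda> (\<lambda>_. 1) \<xi>"
      unfolding unnorm_def using override_in_Omega[OF x] by (intro nn_integral_cong) (auto simp: space_G)
    finally show ?thesis .
  qed
  have "0 < ennreal (partition_function \<beta> m a J V \<Lambda> \<xi>)" unfolding pf by (rule unnorm_pos[OF x])
  then have Z: "partition_function \<beta> m a J V \<Lambda> \<xi> > 0" "unnorm \<Lambda> (\<lambda>_. 1) \<xi> = ennreal (partition_function \<beta> m a J V \<Lambda> \<xi>)"
    by (simp only: ennreal_less_zero_iff) (rule pf[symmetric])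
  have N0: "(\<integral>\<omega>. exp (- local_energy \<beta> J V \<Lambda> \<omega> \<xi>) * indicator D (override_on \<xi> \<omega> \<Lambda>) \<partial>?P) \<ge> 0"
    by (intro integral_nonneg_AE AE_I2) auto
  then show "local_spec \<beta> m a J V \<Lambda> D \<xi> \<ge> 0"
    using Z by (simp add: local_spec_def)
  show "ennreal (local_spec \<beta> m a J V \<Lambda> D \<xi>) = kern \<Lambda> (indicator D) \<xi>"
    unfolding kern_def num[OF D, symmetric] Z(2) local_spec_def
    using Z(1) N0 by (simp add: divide_ennreal divide_inverse mult.commute)
qed

section \<open>Temperedness\<close>

definition weighted :: "real \<Rightarrow> (int ^ 'd \<Rightarrow> (real \<Rightarrow>\<^sub>C real)) \<Rightarrow> ennreal" where
  "weighted \<delta> \<omega> = (SUP n. \<Sum>k\<in>box n. ennreal (exp (- \<delta> * lattice_norm k) * sq (\<omega> k)))"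

lemma weighted_measurable [measurable]: "weighted \<delta> \<in> borel_measurable \<Omega>"
  unfolding weighted_def by measurable

lemma box_mono: "n \<le> n' \<Longrightarrow> box n \<subseteq> box n'"
  by (auto simp: box_def)

text \<open>For nonnegative terms summability means bounded finite sums, and every finite set of
  sites lies in some box. The countable supremum has the advantage of being visibly
  measurable.\<close>

lemma summable_weighted:
  "(\<lambda>k. exp (- \<delta> * lattice_norm k) * sq (\<omega> k)) summable_on UNIV \<longleftrightarrow> weighted \<delta> \<omega> < \<infinity>"
proof
  let ?f = "\<lambda>k. exp (- \<delta> * lattice_norm k) * sq (\<omega> k)"
  have f0: "?f k \<ge> 0" for k using sq_nonneg by simp
  show "weighted \<delta> \<omega> < \<infinity>" if s: "?f summable_on UNIV"
  proof -
    have "weighted \<delta> \<omega> \<le> ennreal (infsum ?f UNIV)"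
      unfolding weighted_def
    proof (rule SUP_least)
      fix n
      have "sum ?f (box n) \<le> infsum ?f UNIV" by (rule finite_sum_le_infsum[OF s finite_box]) (use f0 in auto)
      then show "(\<Sum>k\<in>box n. ennreal (?f k)) \<le> ennreal (infsum ?f UNIV)" using f0 by (simp add: ennreal_leI)
    qed
    then show ?thesis by (rule le_less_trans) simp
  qed
  show "?f summable_on UNIV" if fin: "weighted \<delta> \<omega> < \<infinity>"
  proof -
    obtain K where K: "weighted \<delta> \<omega> = ennreal K" "K \<ge> 0" using fin by (cases "weighted \<delta> \<omega>") auto
    have "sum ?f F \<le> K" if F: "finite F" for F
    proof -
      obtain n where n: "F \<subseteq> box n" using eventually_box[OF F] by (auto simp: eventually_sequentially)
      have "sum ?f F \<le> sum ?f (box n)" using n finite_box f0 by (intro sum_mono2) auto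
      moreover have "ennreal (sum ?f (box n)) \<le> ennreal K"
        using f0 unfolding K(1)[symmetric] weighted_def by (subst sum_ennreal[symmetric]) (auto intro!: SUP_upper)
      ultimately show ?thesis using K(2) by simp
    qed
    then show ?thesis using f0 by (intro nonneg_bdd_above_summable_on) (auto simp: bdd_above_def)
  qed
qed

lemma configs_Omega: "configs \<beta> = space \<Omega>"
  by (auto simp: configs_def space_PiM PiE_def Pi_def)

text \<open>Summability for one \<open>\<delta>\<close> implies it for all larger ones, so the
  values \<open>1 / (n + 2)\<close>, which lie strictly between 0 and 1 and tend to 0, suffice. With
  countably many conditions the set is measurable.\<close>

lemma tempered_eq: "tempered_configs \<beta> = {\<omega> \<in> space \<Omega>. \<forall>n::nat. weighted (1 / real (n + 2)) \<omega> < \<infinity>}"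
proof (intro set_eqI iffI)
  fix \<omega> :: "int ^ 'd \<Rightarrow> (real \<Rightarrow>\<^sub>C real)" assume w: "\<omega> \<in> tempered_configs \<beta>"
  have "weighted (1 / real (n + 2)) \<omega> < \<infinity>" for n :: nat
  proof -
    have "0 < 1 / real (n + 2)" "1 / real (n + 2) < 1" by simp_all
    then show ?thesis using w unfolding summable_weighted[symmetric] tempered_configs_def sq_def by blast
  qed
  then show "\<omega> \<in> {\<omega> \<in> space \<Omega>. \<forall>n::nat. weighted (1 / real (n + 2)) \<omega> < \<infinity>}"
    using w by (simp add: tempered_configs_def configs_Omega)
next
  fix \<omega> :: "int ^ 'd \<Rightarrow> (real \<Rightarrow>\<^sub>C real)" assume w: "\<omega> \<in> {\<omega> \<in> space \<Omega>. \<forall>n::nat. weighted (1 / real (n + 2)) \<omega> < \<infinity>}"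
  have "(\<lambda>k. exp (- \<delta> * lattice_norm k) * sq (\<omega> k)) summable_on UNIV" if d: "0 < \<delta>" for \<delta>
  proof -
    obtain n :: nat where "1 / real (Suc n) < \<delta>" using reals_Archimedean[OF d] by (auto simp: inverse_eq_divide)
    moreover have "1 / real (n + 2) \<le> 1 / real (Suc n)" by (intro divide_left_mono) auto
    ultimately have n: "1 / real (n + 2) \<le> \<delta>" by linarith
    have s: "(\<lambda>k. exp (- (1 / real (n + 2)) * lattice_norm k) * sq (\<omega> k)) summable_on UNIV"
      using w unfolding summable_weighted by simp
    show ?thesis
    proof (rule summable_on_comparison_test[OF s])
      fix k :: "int ^ 'd"
      have "1 / real (n + 2) * lattice_norm k \<le> \<delta> * lattice_norm k"
        using n by (intro mult_right_mono) (auto simp: lattice_norm_def)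
      then show "exp (- \<delta> * lattice_norm k) * sq (\<omega> k) \<le> exp (- (1 / real (n + 2)) * lattice_norm k) * sq (\<omega> k)"
        using sq_nonneg by (intro mult_right_mono) auto
    qed (use sq_nonneg in auto)
  qed
  then show "\<omega> \<in> tempered_configs \<beta>" using w by (simp add: tempered_configs_def configs_Omega sq_def)
qed

theorem tempered_nonempty: "tempered_gibbs_measures \<beta> m a J V \<noteq> ({} :: ('d config measure) set)"
proof -
  have b0: "\<beta> \<noteq> 0" using beta by simp
  obtain \<mu> B where \<mu>: "prob_space \<mu>" "sets \<mu> = sets \<Omega>" and B: "B \<ge> 0"
    and DLR: "\<And>\<Lambda> A. finite \<Lambda> \<Longrightarrow> A \<in> sets \<Omega> \<Longrightarrow> (\<integral>\<^sup>+\<xi>. kern \<Lambda> (indicator A) \<xi> \<partial>\<mu>) = emeasure \<mu> A"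
    and mom: "\<And>k. (\<integral>\<^sup>+\<omega>. ennreal (sq (\<omega> k)) \<partial>\<mu>) \<le> ennreal B"
    using exists_gibbs_measure[OF to_unit_measurable[OF b0] of_unit_measurable[OF b0]] of_to_unit[OF b0]
    by (metis space_loop_space)
  interpret \<mu>: prob_space \<mu> by fact
  have sp: "space \<mu> = space \<Omega>" using \<mu>(2) by (rule sets_eq_imp_space_eq)
  note [measurable_cong] = \<mu>(2)
  have cs: "sets (config_space \<beta> :: 'd config measure) = sets \<Omega>" by (rule sets_config_space[OF b0])
  have "(\<integral>\<omega>. local_spec \<beta> m a J V \<Lambda> D \<omega> \<partial>\<mu>) = measure \<mu> D" if L: "finite \<Lambda>" and D [measurable]: "D \<in> sets \<Omega>" for \<Lambda> D
  proof -
    have "(\<integral>\<omega>. local_spec \<beta> m a J V \<Lambda> D \<omega> \<partial>\<mu>) = (\<integral>\<omega>. enn2real (kern \<Lambda> (indicator D) \<omega>) \<partial>\<mu>)"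
      using local_spec_eq[OF L D] by (intro Bochner_Integration.integral_cong refl) (simp add: sp flip: local_spec_eq(1)[OF L D])
    also have "\<dots> = enn2real (\<integral>\<^sup>+\<omega>. ennreal (enn2real (kern \<Lambda> (indicator D) \<omega>)) \<partial>\<mu>)"
      by (rule integral_eq_nn_integral) auto
    also have "(\<integral>\<^sup>+\<omega>. ennreal (enn2real (kern \<Lambda> (indicator D) \<omega>)) \<partial>\<mu>) = (\<integral>\<^sup>+\<omega>. kern \<Lambda> (indicator D) \<omega> \<partial>\<mu>)"
      using local_spec_eq(2)[OF L D] by (intro nn_integral_cong) (simp add: sp flip: local_spec_eq(1)[OF L D])
    also have "\<dots> = emeasure \<mu> D" by (rule DLR[OF L D])
    finally show ?thesis by (simp add: measure_def)
  qed
  then have eg: "\<mu> \<in> euclidean_gibbs_measures \<beta> m a J V"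
    using \<mu> by (simp add: euclidean_gibbs_measures_def cs)
  \<comment> \<open>The weights have finite total mass \<open>S\<close> and the second moments are
    at most \<open>B\<close>, so the weighted sum has expectation at most \<open>S * B\<close> and
    is almost surely finite.\<close>
  have AEw: "AE \<omega> in \<mu>. weighted \<delta> \<omega> < \<infinity>" if d: "\<delta> > 0" for \<delta>
  proof -
    obtain S where S: "S \<ge> 0" "\<And>F :: (int ^ 'd) set. finite F \<Longrightarrow> (\<Sum>k\<in>F. exp (- \<delta> * lattice_norm k)) \<le> S"
      using exp_lattice_norm_sum[OF d] by blast
    have "(\<integral>\<^sup>+\<omega>. weighted \<delta> \<omega> \<partial>\<mu>) = (SUP n. \<integral>\<^sup>+\<omega>. (\<Sum>k\<in>box n. ennreal (exp (- \<delta> * lattice_norm k) * sq (\<omega> k))) \<partial>\<mu>)"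
      unfolding weighted_def
    proof (rule nn_integral_monotone_convergence_SUP)
      show "incseq (\<lambda>n \<omega>. \<Sum>k\<in>box n. ennreal (exp (- \<delta> * lattice_norm k) * sq (\<omega> k)))"
        unfolding incseq_def le_fun_def by (intro allI impI sum_mono2 finite_box box_mono) auto
    qed measurable
    also have "\<dots> \<le> ennreal (S * B)"
    proof (rule SUP_least)
      fix n
      have "(\<integral>\<^sup>+\<omega>. (\<Sum>k\<in>box n. ennreal (exp (- \<delta> * lattice_norm k) * sq (\<omega> k))) \<partial>\<mu>)
          = (\<Sum>k\<in>box n. ennreal (exp (- \<delta> * lattice_norm k)) * (\<integral>\<^sup>+\<omega>. ennreal (sq (\<omega> k)) \<partial>\<mu>))"
        using sq_nonneg by (simp add: nn_integral_sum nn_integral_cmult ennreal_mult del: sum_ennreal)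
      also have "\<dots> \<le> (\<Sum>k\<in>box n. ennreal (exp (- \<delta> * lattice_norm k)) * ennreal B)"
        by (intro sum_mono mult_left_mono mom) auto
      also have "\<dots> = ennreal ((\<Sum>k\<in>box n. exp (- \<delta> * lattice_norm k)) * B)"
        using B by (simp add: ennreal_mult[symmetric] sum_distrib_right)
      also have "\<dots> \<le> ennreal (S * B)"
        using S(2)[OF finite_box[of n]] B by (intro ennreal_leI mult_right_mono) auto
      finally show "(\<integral>\<^sup>+\<omega>. (\<Sum>k\<in>box n. ennreal (exp (- \<delta> * lattice_norm k) * sq (\<omega> k))) \<partial>\<mu>) \<le> ennreal (S * B)" .
    qed
    finally have "(\<integral>\<^sup>+\<omega>. weighted \<delta> \<omega> \<partial>\<mu>) \<noteq> \<infinity>" by (auto simp: top_unique)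
    then show ?thesis using nn_integral_PInf_AE[of "weighted \<delta>" \<mu>] by (auto simp: less_top)
  qed
  have "AE \<omega> in \<mu>. \<forall>n::nat. weighted (1 / real (n + 2)) \<omega> < \<infinity>"
    unfolding AE_all_countable by (intro allI AEw) simp
  then have "AE \<omega> in \<mu>. \<omega> \<in> tempered_configs \<beta>"
    using AE_space by eventually_elim (simp add: tempered_eq sp)
  moreover have "tempered_configs \<beta> \<in> sets \<mu>" unfolding tempered_eq \<mu>(2) by measurable
  ultimately have "measure \<mu> (tempered_configs \<beta>) = 1" by (simp add: \<mu>.prob_eq_1)
  then show ?thesis using eg by (auto simp: tempered_gibbs_measures_def)
qed

end

theorem theoremI:
  fixes \<beta> m a J :: real and V :: "real \<Rightarrow> real"
  assumes "\<beta> > 0" and "m > 0" and "a\<^sup>2 > 0" and "J > 0"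
    and "C2_function V" and "growth_condition V"
  shows "(tempered_gibbs_measures \<beta> m a J V :: ('d::finite) config measure set) \<noteq> {}"
proof -
  interpret loop_model \<beta> m a J V "TYPE('d)" using assms by unfold_locales
  show ?thesis by (rule tempered_nonempty)
qed

end
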